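(* Let $N\ge1$, $0<\alpha<1$, $\lambda\in\mathbb{C}\setminus\{0\}$ and $-\frac\pi2\le\theta\le\frac\pi2$. Suppose $s>3+\frac N2+\alpha$. There exists $u_0\in C^\infty_c(\mathbb{R}^N)$ such that there is no $T>0$ for which there exists a solution $u\in C([0,T],H^s(\mathbb{R}^N))$ of $$u_t=e^{i\theta}\Delta u+\lambda|u|^\alpha u,\qquad u(0)=u_0.$$
   Context: All functions are complex-valued. $C^\infty_c(\mathbb{R}^N)$ is the space of smooth compactly supported functions. $H^s(\mathbb{R}^N)$ is the usual $L^2$-based Sobolev space with norm $\|u\|_{H^s}=\|\mathcal{F}^{-1}[(1+|\xi|^2)^{s/2}\widehat u]\|_{L^2}$. Since $s>3+\frac N2$, for $u\in C([0,T],H^s(\mathbb{R}^N))$ the functions $\Delta u$ and $|u|^\alpha u$ belong to $C([0,T]\times\mathbb{R}^N)\cap C([0,T],L^2(\mathbb{R}^N))$, so the equation makes sense for such $u$; a solution is a $u\in C([0,T],H^s(\mathbb{R}^N))$ satisfying the equation on $[0,T]\times\mathbb{R}^N$ (so that $u_t\in C([0,T]\times\mathbb{R}^N)\cap C([0,T],L^2(\mathbb{R}^N))$) together with the initial condition. *)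

theory Defs
  imports "HOL-Analysis.Analysis"
begin

definition partial :: "'a \<Rightarrow> ('a::euclidean_space \<Rightarrow> complex) \<Rightarrow> 'a \<Rightarrow> complex" where
  "partial b f x = vector_derivative (\<lambda>h. f (x + h *\<^sub>R b)) (at (0::real))"

definition laplacian :: "('a::euclidean_space \<Rightarrow> complex) \<Rightarrow> 'a \<Rightarrow> complex" where
  "laplacian f x = (\<Sum>b\<in>Basis. partial b (partial b f) x)"

primrec C_k :: "nat \<Rightarrow> ('a::euclidean_space \<Rightarrow> complex) \<Rightarrow> bool" where
  "C_k 0 f \<longleftrightarrow> continuous_on UNIV f"
| "C_k (Suc k) f \<longleftrightarrow> f differentiable_on UNIV \<and> (\<forall>b\<in>Basis. C_k k (partial b f))"

definition smooth_compact_support :: "('a::euclidean_space \<Rightarrow> complex) \<Rightarrow> bool" where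
  "smooth_compact_support f \<longleftrightarrow> (\<forall>k. C_k k f) \<and> compact (closure {x. f x \<noteq> 0})"

definition L2 :: "('a::euclidean_space \<Rightarrow> complex) \<Rightarrow> bool" where
  "L2 f \<longleftrightarrow> f \<in> borel_measurable lborel \<and> integrable lborel (\<lambda>x. (cmod (f x))\<^sup>2)"

definition L2_norm :: "('a::euclidean_space \<Rightarrow> complex) \<Rightarrow> real" where
  "L2_norm f = sqrt (LINT x|lborel. (cmod (f x))\<^sup>2)"

definition fourier_integral :: "('a::euclidean_space \<Rightarrow> complex) \<Rightarrow> 'a \<Rightarrow> complex" where
  "fourier_integral f \<xi> =
     of_real ((2 * pi) powr (- (real DIM('a) / 2))) * (LINT x|lborel. cis (- (x \<bullet> \<xi>)) * f x)"

definition inv_fourier_integral :: "('a::euclidean_space \<Rightarrow> complex) \<Rightarrow> 'a \<Rightarrow> complex" where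
  "inv_fourier_integral g x =
     of_real ((2 * pi) powr (- (real DIM('a) / 2))) * (LINT \<xi>|lborel. cis (x \<bullet> \<xi>) * g \<xi>)"

(* g is the image of f under the continuous extension to all of L2 of an operator F given on
   the intersection of L1 and L2.  As elements of L2 are functions here, g is determined by f
   only up to null sets, hence a relation rather than a function. *)
definition L2_extension ::
    "(('a::euclidean_space \<Rightarrow> complex) \<Rightarrow> 'a \<Rightarrow> complex) \<Rightarrow> ('a \<Rightarrow> complex) \<Rightarrow> ('a \<Rightarrow> complex) \<Rightarrow> bool" where
  "L2_extension F f g \<longleftrightarrow> L2 f \<and> L2 g \<and>
     (\<exists>\<phi> :: nat \<Rightarrow> 'a \<Rightarrow> complex.
        (\<forall>k. integrable lborel (\<phi> k) \<and> L2 (\<phi> k) \<and> L2 (F (\<phi> k))) \<and>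
        (\<lambda>k. L2_norm (\<lambda>x. \<phi> k x - f x)) \<longlonglongrightarrow> 0 \<and>
        (\<lambda>k. L2_norm (\<lambda>\<xi>. F (\<phi> k) \<xi> - g \<xi>)) \<longlonglongrightarrow> 0)"

(* w is the inverse Fourier transform of the function (1 + |xi|^2)^(s/2) * (Fourier transform of f),
   for s >= 0, where H^s is contained in L2 and no tempered distributions are needed. *)
definition bessel_potential :: "real \<Rightarrow> ('a::euclidean_space \<Rightarrow> complex) \<Rightarrow> ('a \<Rightarrow> complex) \<Rightarrow> bool" where
  "bessel_potential s f w \<longleftrightarrow>
     (\<exists>g. L2_extension fourier_integral f g \<and>
          L2_extension inv_fourier_integral
            (\<lambda>\<xi>. of_real ((1 + (norm \<xi>)\<^sup>2) powr (s / 2)) * g \<xi>) w)"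

definition sobolev :: "real \<Rightarrow> ('a::euclidean_space \<Rightarrow> complex) \<Rightarrow> bool" where
  "sobolev s f \<longleftrightarrow> (\<exists>w. bessel_potential s f w)"

(* All admissible choices of w agree almost everywhere, so the norm does not depend on it. *)
definition sobolev_norm :: "real \<Rightarrow> ('a::euclidean_space \<Rightarrow> complex) \<Rightarrow> real" where
  "sobolev_norm s f = L2_norm (SOME w. bessel_potential s f w)"

definition continuous_into_sobolev ::
    "real \<Rightarrow> real \<Rightarrow> (real \<Rightarrow> 'a::euclidean_space \<Rightarrow> complex) \<Rightarrow> bool" where
  "continuous_into_sobolev s T u \<longleftrightarrow>
     (\<forall>t\<in>{0..T}. sobolev s (u t)) \<and>
     (\<forall>t\<in>{0..T}. ((\<lambda>\<tau>. sobolev_norm s (\<lambda>x. u \<tau> x - u t x)) \<longlongrightarrow> 0) (at t within {0..T}))"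

(* For s > N/2 every class in H^s has exactly one continuous representative, and continuity of u t
   selects it.  If moreover s > 2 + N/2, that representative is twice continuously differentiable,
   so the Laplacian below is the classical one and the equation can be read pointwise.
   The time derivative is one-sided at the end points of {0..T}. *)
definition is_solution ::
    "real \<Rightarrow> complex \<Rightarrow> real \<Rightarrow> real \<Rightarrow> real \<Rightarrow> ('a::euclidean_space \<Rightarrow> complex) \<Rightarrow>
     (real \<Rightarrow> 'a \<Rightarrow> complex) \<Rightarrow> bool" where
  "is_solution \<theta> \<mu> \<alpha> s T u0 u \<longleftrightarrow>
     continuous_into_sobolev s T u \<and>
     (\<forall>t\<in>{0..T}. continuous_on UNIV (u t)) \<and>
     (\<forall>t\<in>{0..T}. \<forall>x. ((\<lambda>\<tau>. u \<tau> x) has_vector_derivative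
         (cis \<theta> * laplacian (u t) x + \<mu> * of_real (cmod (u t x) powr \<alpha>) * u t x)) (at t within {0..T})) \<and>
     u 0 = u0"

end

theory Submission
  imports Defs "HOL-Probability.Probability"
begin

text \<open>
  The initial datum is the odd function \<open>u\<^sub>0 x = (x \<bullet> e) \<phi>(x)\<close> with a bump \<open>\<phi>\<close>.  A solution stays odd, since
  \<open>w(t, x) = u(t, x) + u(t, - x)\<close> starts at 0 and satisfies
  \<open>\<bar>w\<^sub>t - exp(\<i>\<theta>) \<Delta> w\<bar> \<le> L \<bar>w\<bar>\<close>, so that an energy estimate gives \<open>w = 0\<close>.
  Hence \<open>u(t, 0) = \<Delta> u(t, 0) = 0\<close>, while \<open>Re u(t, h e) \<ge> c h\<close> for small \<open>t\<close> and \<open>h\<close>.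
  For \<open>U(t) = u(t, 2 h e) - 2 u(t, h e)\<close> the equation gives
  \<open>U' = exp(\<i>\<theta>) (\<Delta> u(t, 2 h e) - 2 \<Delta> u(t, h e)) + \<mu> (\<bar>u\<bar>\<^sup>\<alpha> u (t, 2 h e) - 2 \<bar>u\<bar>\<^sup>\<alpha> u (t, h e))\<close>.
  Some \<open>\<beta> > \<alpha>\<close> still satisfies \<open>s > 3 + \<beta> + N / 2\<close>, so the functions \<open>\<Delta> u(t)\<close> are bounded in
  \<open>C\<^sup>1\<^sup>,\<^sup>\<beta>\<close> and the first term is \<open>O(h\<^sup>1\<^sup>+\<^sup>\<beta>)\<close>.  The power is homogeneous of degree \<open>1 + \<alpha>\<close> and
  \<open>2\<^sup>1\<^sup>+\<^sup>\<alpha> > 2\<close>, so \<open>Re (U' / \<mu>)\<close> is at least of order \<open>h\<^sup>1\<^sup>+\<^sup>\<alpha>\<close> on a fixed time interval.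
  But \<open>U = O(h\<^sup>2)\<close>, which is impossible as \<open>h\<close> tends to 0, because \<open>\<alpha> < 1\<close>.
\<close>

section \<open>Square-integrable functions and Gaussians\<close>

text \<open>Oddness makes \<open>U\<close> a second difference: as \<open>u t 0\<close> and
  \<open>laplacian (u t) 0\<close> vanish, \<open>U\<close> and its Laplacian part are second
  differences at 0 with step \<open>h e\<close>. These annihilate affine functions, so smooth terms
  come out small, while the nonlinearity is no better than C^(1,\<alpha>) where u crosses zero with
  nonzero slope and is seen at its own order. The slope of the datum survives for a short time
  because closeness in H^s controls differences; the contradiction then arises on any interval,
  however short. Dividing by \<mu> before taking real parts removes its argument. Of \<theta> only
  the sign of \<open>cos \<theta>\<close> enters, so the Schroedinger endpoints are covered.

  The analytic obstacle is that the Sobolev norm is defined through L2 limits of Fourier integrals.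
  Two consequences of Gaussian damping take the place of the full L2 theory: a norm inequality, and
  pointwise inversion for a continuous function with integrable transform. From there on each time
  slice is an absolutely convergent Fourier integral, and its regularity is Cauchy-Schwarz against
  the weight.\<close>

lemma L2_borel_measurable [measurable_dest]: "L2 f \<Longrightarrow> f \<in> borel_measurable borel"
  by (simp add: L2_def)

lemma L2_norm_nonneg [simp]: "0 \<le> L2_norm f"
  by (simp add: L2_norm_def)

lemma L2_norm_square: "(L2_norm f)\<^sup>2 = (LINT x|lborel. (cmod (f x))\<^sup>2)"
  by (simp add: L2_norm_def)

lemma L2_integrable_square: "L2 f \<Longrightarrow> integrable lborel (\<lambda>x. (cmod (f x))\<^sup>2)"
  by (simp add: L2_def)

lemma L2_nn_integral: "L2 f \<Longrightarrow> (\<integral>\<^sup>+x. ennreal ((cmod (f x))\<^sup>2) \<partial>lborel) = ennreal ((L2_norm f)\<^sup>2)"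
  unfolding L2_norm_square by (intro nn_integral_eq_integral) (auto simp: L2_def)

text \<open>An integral in \<open>ennreal\<close> exists before square integrability is known, so a
  single estimate yields membership and bound together. Fatou's lemma delivers its limits in this
  form.\<close>

lemma L2I_nn_integral:
  assumes [measurable]: "f \<in> borel_measurable borel" and "0 \<le> A"
    and "(\<integral>\<^sup>+x. ennreal ((cmod (f x))\<^sup>2) \<partial>lborel) \<le> ennreal (A\<^sup>2)"
  shows "L2 f" and "L2_norm f \<le> A"
proof -
  have *: "(\<integral>\<^sup>+x. ennreal ((cmod (f x))\<^sup>2) \<partial>lborel) < \<infinity>"
    using assms(3) by (metis ennreal_less_top infinity_ennreal_def order_le_less_trans)
  show L: "L2 f"
    unfolding L2_def by (intro conjI integrableI_nonneg) (use * in auto)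
  have "(L2_norm f)\<^sup>2 \<le> A\<^sup>2"
    using assms(3) unfolding L2_nn_integral[OF L] by (subst (asm) ennreal_le_iff) auto
  then show "L2_norm f \<le> A"
    using assms(2) by (simp add: power2_le_iff_abs_le)
qed

lemma L2_bound:
  assumes "L2 g" and [measurable]: "f \<in> borel_measurable borel" and "0 \<le> c"
    and "\<And>x. cmod (f x) \<le> c * cmod (g x)"
  shows "L2 f" and "L2_norm f \<le> c * L2_norm g"
proof -
  have [measurable]: "g \<in> borel_measurable borel" using assms(1) by measurable
  have "(\<integral>\<^sup>+x. ennreal ((cmod (f x))\<^sup>2) \<partial>lborel) \<le> (\<integral>\<^sup>+x. ennreal (c\<^sup>2) * ennreal ((cmod (g x))\<^sup>2) \<partial>lborel)"
    by (intro nn_integral_mono)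
       (metis assms(4) ennreal_leI ennreal_mult' norm_ge_zero power_mono power_mult_distrib zero_le_power2)
  also have "\<dots> = ennreal ((c * L2_norm g)\<^sup>2)"
    by (subst nn_integral_cmult) (auto simp: L2_nn_integral[OF assms(1)] ennreal_mult' power_mult_distrib)
  finally have *: "(\<integral>\<^sup>+x. ennreal ((cmod (f x))\<^sup>2) \<partial>lborel) \<le> ennreal ((c * L2_norm g)\<^sup>2)" .
  have c: "0 \<le> c * L2_norm g" using assms(3) by simp
  show "L2 f" and "L2_norm f \<le> c * L2_norm g"
    using L2I_nn_integral[OF assms(2) c *] by auto
qed

lemma L2_mult_integrable:
  assumes "L2 f" "L2 g"
  shows "integrable lborel (\<lambda>x. f x * g x)"
proof (rule Bochner_Integration.integrable_bound)
  show "integrable lborel (\<lambda>x. (cmod (f x))\<^sup>2 + (cmod (g x))\<^sup>2)"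
    using assms by (auto simp: L2_def)
  have [measurable]: "f \<in> borel_measurable borel" "g \<in> borel_measurable borel" using assms by measurable
  show "(\<lambda>x. f x * g x) \<in> borel_measurable lborel" by simp
  have "cmod (f x * g x) \<le> norm ((cmod (f x))\<^sup>2 + (cmod (g x))\<^sup>2)" for x
  proof -
    have "2 * (cmod (f x) * cmod (g x)) \<le> (cmod (f x))\<^sup>2 + (cmod (g x))\<^sup>2"
      using sum_squares_bound[of "cmod (f x)" "cmod (g x)"] by (simp add: mult.assoc)
    moreover have "0 \<le> cmod (f x) * cmod (g x)" by simp
    ultimately have "cmod (f x) * cmod (g x) \<le> (cmod (f x))\<^sup>2 + (cmod (g x))\<^sup>2" by linarith
    then show ?thesis by (simp add: norm_mult)
  qed
  then show "AE x in lborel. norm (f x * g x) \<le> norm ((cmod (f x))\<^sup>2 + (cmod (g x))\<^sup>2)" by simp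
qed

lemma L2_Cauchy_Schwarz_norm:
  assumes "L2 f" "L2 g"
  shows "(LINT x|lborel. cmod (f x * g x)) \<le> L2_norm f * L2_norm g"
proof -
  have [measurable]: "f \<in> borel_measurable borel" "g \<in> borel_measurable borel" using assms by measurable
  let ?I = "LINT x|lborel. cmod (f x * g x)"
  have "(\<integral>\<^sup>+x. ennreal (cmod (f x)) * ennreal (cmod (g x)) \<partial>lborel)\<^sup>2
      \<le> (\<integral>\<^sup>+x. (ennreal (cmod (f x)))\<^sup>2 \<partial>lborel) * (\<integral>\<^sup>+x. (ennreal (cmod (g x)))\<^sup>2 \<partial>lborel)"
    by (rule Cauchy_Schwarz_nn_integral) auto
  also have "\<dots> = ennreal ((L2_norm f)\<^sup>2 * (L2_norm g)\<^sup>2)"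
    using L2_nn_integral[OF assms(1)] L2_nn_integral[OF assms(2)]
    by (simp add: ennreal_power ennreal_mult')
  also have "(\<integral>\<^sup>+x. ennreal (cmod (f x)) * ennreal (cmod (g x)) \<partial>lborel)
      = (\<integral>\<^sup>+x. ennreal (cmod (f x * g x)) \<partial>lborel)"
    by (simp add: ennreal_mult' norm_mult)
  also have "\<dots> = ennreal ?I"
    by (intro nn_integral_eq_integral integrable_norm L2_mult_integrable assms) auto
  finally have "?I\<^sup>2 \<le> (L2_norm f * L2_norm g)\<^sup>2"
    by (simp add: ennreal_power power_mult_distrib)
  then show ?thesis
    by (rule power2_le_imp_le) simp
qed

lemma L2_Cauchy_Schwarz:
  assumes "L2 f" "L2 g"
  shows "cmod (LINT x|lborel. f x * g x) \<le> L2_norm f * L2_norm g"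
  using L2_Cauchy_Schwarz_norm[OF assms] integral_norm_bound[of lborel "\<lambda>x. f x * g x"] by linarith

lemma L2_add:
  assumes "L2 f" "L2 g"
  shows "L2 (\<lambda>x. f x + g x)" and "L2_norm (\<lambda>x. f x + g x) \<le> L2_norm f + L2_norm g"
proof -
  have [measurable]: "f \<in> borel_measurable borel" "g \<in> borel_measurable borel" using assms by measurable
  have fg: "integrable lborel (\<lambda>x. cmod (f x * g x))"
    by (intro integrable_norm L2_mult_integrable assms)
  have le: "(cmod (f x + g x))\<^sup>2 \<le> (cmod (f x))\<^sup>2 + 2 * cmod (f x * g x) + (cmod (g x))\<^sup>2" for x
    using power_mono[OF norm_triangle_ineq[of "f x" "g x"] norm_ge_zero, of 2]
    by (simp add: power2_sum norm_mult mult.assoc)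
  have int: "integrable lborel (\<lambda>x. (cmod (f x))\<^sup>2 + 2 * cmod (f x * g x) + (cmod (g x))\<^sup>2)"
    using assms fg by (auto simp: L2_def)
  show L: "L2 (\<lambda>x. f x + g x)"
    unfolding L2_def
    by (intro conjI Bochner_Integration.integrable_bound[OF int]) (use le in \<open>auto intro: order_trans[OF _ abs_ge_self]\<close>)
  have "(L2_norm (\<lambda>x. f x + g x))\<^sup>2 \<le> (LINT x|lborel. (cmod (f x))\<^sup>2 + 2 * cmod (f x * g x) + (cmod (g x))\<^sup>2)"
    unfolding L2_norm_square using L le int by (intro integral_mono) (auto simp: L2_def)
  also have "\<dots> = (L2_norm f)\<^sup>2 + 2 * (LINT x|lborel. cmod (f x * g x)) + (L2_norm g)\<^sup>2"
    unfolding L2_norm_square using assms fg by (simp add: L2_def)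
  also have "\<dots> \<le> (L2_norm f + L2_norm g)\<^sup>2"
    using L2_Cauchy_Schwarz_norm[OF assms] by (simp add: power2_sum mult.assoc)
  finally show "L2_norm (\<lambda>x. f x + g x) \<le> L2_norm f + L2_norm g"
    by (rule power2_le_imp_le) simp
qed

lemma L2_norm_uminus [simp]: "L2_norm (\<lambda>x. - f x) = L2_norm f"
  by (simp add: L2_norm_def)

lemma L2_diff:
  assumes "L2 f" "L2 g"
  shows "L2 (\<lambda>x. f x - g x)" and "L2_norm (\<lambda>x. f x - g x) \<le> L2_norm f + L2_norm g"
proof -
  have "L2 (\<lambda>x. - g x)" using assms(2) by (auto simp: L2_def)
  from L2_add[OF assms(1) this]
  show "L2 (\<lambda>x. f x - g x)" "L2_norm (\<lambda>x. f x - g x) \<le> L2_norm f + L2_norm g" by auto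
qed

text \<open>Cauchy-Schwarz applied to the difference. It is how the approximating sequences inside
  \<open>L2_extension\<close> are replaced by their limits.\<close>

lemma L2_pairing_tendsto:
  assumes "\<And>k. L2 (a k)" "L2 f" "L2 b" "(\<lambda>k. L2_norm (\<lambda>x. a k x - f x)) \<longlonglongrightarrow> 0"
  shows "(\<lambda>k. LINT x|lborel. a k x * b x) \<longlonglongrightarrow> (LINT x|lborel. f x * b x)"
proof (rule LIM_zero_cancel, rule Lim_null_comparison)
  have "(LINT x|lborel. a k x * b x) - (LINT x|lborel. f x * b x) = (LINT x|lborel. (a k x - f x) * b x)" for k
    by (subst Bochner_Integration.integral_diff[symmetric])
       (auto intro!: L2_mult_integrable assms simp: algebra_simps)
  then have "cmod ((LINT x|lborel. a k x * b x) - (LINT x|lborel. f x * b x)) \<le> L2_norm (\<lambda>x. a k x - f x) * L2_norm b" for k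
    using L2_Cauchy_Schwarz[OF L2_diff(1)[OF assms(1)[of k] assms(2)] assms(3)] by simp
  then show "\<forall>\<^sub>F k in sequentially. cmod ((LINT x|lborel. a k x * b x) - (LINT x|lborel. f x * b x)) \<le> L2_norm (\<lambda>x. a k x - f x) * L2_norm b"
    by simp
  show "(\<lambda>k. L2_norm (\<lambda>x. a k x - f x) * L2_norm b) \<longlonglongrightarrow> 0"
    using tendsto_mult_left_zero[OF assms(4)] by simp
qed

section \<open>Affine substitutions and product integrals\<close>

lemma lborel_nn_integral_affine:
  fixes f :: "'a::euclidean_space \<Rightarrow> ennreal"
  assumes [measurable]: "f \<in> borel_measurable borel" and c: "c \<noteq> 0"
  shows "integral\<^sup>N lborel f = ennreal (\<bar>c\<bar> ^ DIM('a)) * (\<integral>\<^sup>+x. f (t + c *\<^sub>R x) \<partial>lborel)"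
  by (subst lborel_affine[OF c, where t=t])
     (simp add: nn_integral_density nn_integral_distr nn_integral_cmult)

lemma lborel_integrable_affine:
  fixes f :: "'a::euclidean_space \<Rightarrow> 'b::{banach, second_countable_topology}"
  assumes f: "integrable lborel f" and c: "c \<noteq> 0"
  shows "integrable lborel (\<lambda>x. f (t + c *\<^sub>R x))"
proof -
  have [measurable]: "f \<in> borel_measurable borel" using f by simp
  from f show ?thesis
    unfolding integrable_iff_bounded using c
    by (auto simp: lborel_nn_integral_affine[of "\<lambda>x. ennreal (norm (f x))", OF _ c, of t] ennreal_mult_less_top)
qed

lemma lborel_integral_affine:
  fixes f :: "'a::euclidean_space \<Rightarrow> 'b::{banach, second_countable_topology}"
  assumes [measurable]: "f \<in> borel_measurable borel" and c: "c \<noteq> 0"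
  shows "integral\<^sup>L lborel f = \<bar>c\<bar> ^ DIM('a) *\<^sub>R (LINT x|lborel. f (t + c *\<^sub>R x))"
  by (subst lborel_affine[OF c, where t=t])
     (simp add: integral_density integral_distr)

lemma lborel_integral_uminus:
  fixes f :: "'a::euclidean_space \<Rightarrow> 'b::{banach, second_countable_topology}"
  assumes "f \<in> borel_measurable borel"
  shows "(LINT x|lborel. f (- x)) = integral\<^sup>L lborel f"
  using lborel_integral_affine[OF assms, of "-1" 0] by simp

text \<open>\<open>lborel\<close> is the image of a product of one-dimensional Lebesgue measures
  under the coordinate map. This reduces the Gaussian integrals to the line.\<close>

lemma lborel_integral_prod:
  fixes f :: "'a::euclidean_space \<Rightarrow> real \<Rightarrow> complex"
  assumes "\<And>b. b \<in> Basis \<Longrightarrow> integrable lborel (f b)"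
  shows "integrable lborel (\<lambda>x. \<Prod>b\<in>Basis. f b (x \<bullet> b))"
    and "(LINT x|lborel. (\<Prod>b\<in>Basis. f b (x \<bullet> b))) = (\<Prod>b\<in>Basis. integral\<^sup>L lborel (f b))"
proof -
  interpret product_sigma_finite "\<lambda>_::'a. lborel :: real measure" ..
  have [measurable]: "\<And>b. b \<in> Basis \<Longrightarrow> f b \<in> borel_measurable borel" using assms by auto
  have *: "(\<lambda>x::'a. \<Prod>b\<in>Basis. f b (x \<bullet> b)) \<in> borel_measurable borel" by measurable
  have **: "(\<lambda>g. \<Sum>b\<in>Basis. g b *\<^sub>R b) \<in> (\<Pi>\<^sub>M b\<in>(Basis::'a set). lborel) \<rightarrow>\<^sub>M borel" by measurable
  have eq: "(\<Prod>b\<in>Basis. f b ((\<Sum>c\<in>Basis. g c *\<^sub>R c) \<bullet> b)) = (\<Prod>b\<in>Basis. f b (g b))" for g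
    by (intro prod.cong refl) simp
  show "integrable lborel (\<lambda>x. \<Prod>b\<in>Basis. f b (x \<bullet> b))"
    apply (subst lborel_eq)
    apply (subst integrable_distr_eq[OF ** *])
    unfolding eq by (intro product_integrable_prod) (use assms in auto)
  show "(LINT x|lborel. (\<Prod>b\<in>Basis. f b (x \<bullet> b))) = (\<Prod>b\<in>Basis. integral\<^sup>L lborel (f b))"
    apply (subst lborel_eq)
    apply (subst integral_distr[OF ** *])
    unfolding eq by (intro product_integral_prod) (use assms in auto)
qed

section \<open>The standard Gaussian and its transform\<close>

definition gauss :: "'a::euclidean_space \<Rightarrow> real" where
  "gauss z = (2 * pi) powr (- (real DIM('a) / 2)) * exp (- (norm z)\<^sup>2 / 2)"

lemma gauss_nonneg [simp]: "0 \<le> gauss z"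
  by (simp add: gauss_def)

lemma gauss_measurable [measurable]: "gauss \<in> borel_measurable borel"
  unfolding gauss_def by measurable

lemma gauss_eq_prod: "gauss z = (\<Prod>b\<in>Basis. std_normal_density (z \<bullet> b))"
proof -
  have n: "(norm z)\<^sup>2 = (\<Sum>b\<in>Basis. (z \<bullet> b)\<^sup>2)"
    unfolding power2_norm_eq_inner by (subst euclidean_inner) (simp add: power2_eq_square)
  have "(1 / sqrt (2 * pi)) ^ DIM('a) = (2 * pi) powr (- (real DIM('a) / 2))"
    by (simp add: powr_half_sqrt[symmetric] powr_minus powr_realpow[symmetric] powr_powr
        power_one_over inverse_eq_divide powr_minus_divide)
  then show ?thesis
    unfolding std_normal_density_def gauss_def prod.distrib
    by (simp add: n exp_sum[symmetric] sum_negf sum_divide_distrib)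
qed

lemma cis_measurable [measurable]: "cis \<in> borel_measurable borel"
  by (intro borel_measurable_continuous_onI continuous_intros)

lemma cis_sum: "cis (sum f A) = (\<Prod>a\<in>A. cis (f a))"
  by (induction A rule: infinite_finite_induct) (auto simp: cis_mult[symmetric])

text \<open>The density and the character both factor over the coordinates, and on the line the
  integral is the characteristic function of the standard normal distribution. Integrability is read
  off from the product, since \<open>cis\<close> has modulus 1.\<close>

lemma gauss_FT:
  fixes v :: "'a::euclidean_space"
  shows "integrable lborel (gauss :: 'a \<Rightarrow> real)"
    and "(LINT x|lborel. cis (x \<bullet> v) * of_real (gauss x)) = of_real (exp (- (norm v)\<^sup>2 / 2))"
proof -
  define f where "f b y = cis (y * (v \<bullet> b)) * of_real (std_normal_density y)" for b :: 'a and y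
  have std: "integrable lborel std_normal_density"
    using integrable_normal_moment[of 1 0 0] by simp
  have "integrable lborel (\<lambda>y. cis (y * c) * of_real (std_normal_density y))" for c
    by (rule Bochner_Integration.integrable_bound[OF std]) (auto simp: norm_mult)
  then have int: "integrable lborel (f b)" for b unfolding f_def .
  have val: "integral\<^sup>L lborel (f b) = of_real (exp (- (v \<bullet> b)\<^sup>2 / 2))" for b
  proof -
    have "char std_normal_distribution (v \<bullet> b) = integral\<^sup>L lborel (f b)"
      unfolding char_def f_def
      by (subst integral_density) (auto simp: scaleR_conv_of_real mult_ac normal_density_nonneg cis_conv_exp)
    then show ?thesis by (simp add: char_std_normal_distribution)
  qed
  have eq: "(\<Prod>b\<in>Basis. f b (x \<bullet> b)) = cis (x \<bullet> v) * of_real (gauss x)" for x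
    unfolding f_def prod.distrib gauss_eq_prod
    by (subst euclidean_inner) (simp add: cis_sum)
  have n: "(norm v)\<^sup>2 = (\<Sum>b\<in>Basis. (v \<bullet> b)\<^sup>2)"
    unfolding power2_norm_eq_inner by (subst euclidean_inner) (simp add: power2_eq_square)
  show "(LINT x|lborel. cis (x \<bullet> v) * of_real (gauss x)) = of_real (exp (- (norm v)\<^sup>2 / 2))"
    using lborel_integral_prod(2)[of f, OF int] unfolding eq val
    by (simp add: n exp_sum[symmetric] sum_negf sum_divide_distrib flip: of_real_prod)
  have "integrable lborel (\<lambda>x. norm (cis (x \<bullet> v) * of_real (gauss x)))"
    using lborel_integral_prod(1)[of f, OF int] unfolding eq by (rule integrable_norm)
  then show "integrable lborel (gauss :: 'a \<Rightarrow> real)" by (simp add: norm_mult)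
qed

lemma integral_gauss: "(LINT x|lborel. gauss x) = 1"
proof -
  have "complex_of_real (LINT x|lborel. gauss (x::'a)) = 1"
    using gauss_FT(2)[of "0::'a"] by simp
  then show ?thesis using of_real_eq_1_iff by blast
qed

section \<open>The Fourier integral\<close>

text \<open>The sign \<sigma> treats the transform (-1) and its inverse (1) together: a result
  proved for \<sigma> serves both, with \<open>FT (- \<sigma>)\<close> in the role of the
  inverse.\<close>

definition FT :: "real \<Rightarrow> ('a::euclidean_space \<Rightarrow> complex) \<Rightarrow> 'a \<Rightarrow> complex" where
  "FT \<sigma> f \<xi> = of_real ((2 * pi) powr (- (real DIM('a) / 2))) * (LINT x|lborel. cis (\<sigma> * (x \<bullet> \<xi>)) * f x)"

lemma fourier_integral_eq_FT: "fourier_integral = FT (-1)"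
  by (intro ext) (simp add: fourier_integral_def FT_def)

lemma inv_fourier_integral_eq_FT: "inv_fourier_integral = FT 1"
  by (intro ext) (simp add: inv_fourier_integral_def FT_def inner_commute)

lemma FT_const_le_1: "(2 * pi) powr (- (real n / 2)) \<le> 1"
proof -
  have "1 \<le> 2 * pi" using pi_ge_two by linarith
  then have "(2 * pi) powr (- (real n / 2)) \<le> (2 * pi) powr 0" by (intro powr_mono) auto
  then show ?thesis by simp
qed

lemma integrable_cis_mult:
  assumes "integrable lborel f"
  shows "integrable lborel (\<lambda>x::'a::euclidean_space. cis (\<sigma> * (x \<bullet> \<xi>)) * f x)"
  by (rule Bochner_Integration.integrable_bound[OF assms]) (use assms in \<open>auto simp: norm_mult\<close>)

text \<open>The normalising constant is at most 1 and is dropped; no later estimate depends on sharp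
  constants.\<close>

lemma FT_norm_le:
  assumes "integrable lborel f"
  shows "cmod (FT \<sigma> f \<xi>) \<le> (LINT x|lborel. cmod (f x))"
proof -
  have "cmod (LINT x|lborel. cis (\<sigma> * (x \<bullet> \<xi>)) * f x) \<le> (LINT x|lborel. cmod (f x))"
    using integral_norm_bound[of lborel "\<lambda>x. cis (\<sigma> * (x \<bullet> \<xi>)) * f x"] by (simp add: norm_mult)
  moreover have "0 \<le> (LINT x|lborel. cmod (f x))" by simp
  ultimately show ?thesis
    using mult_mono[OF FT_const_le_1[of "DIM('a)"]] by (fastforce simp: FT_def norm_mult)
qed

lemma FT_add:
  assumes "integrable lborel f" "integrable lborel g"
  shows "FT \<sigma> (\<lambda>x. f x + g x) \<xi> = FT \<sigma> f \<xi> + FT \<sigma> g \<xi>"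
  using assms by (simp add: FT_def ring_distribs integrable_cis_mult)

lemma FT_diff:
  assumes "integrable lborel f" "integrable lborel g"
  shows "FT \<sigma> (\<lambda>x. f x - g x) \<xi> = FT \<sigma> f \<xi> - FT \<sigma> g \<xi>"
  using assms by (simp add: FT_def ring_distribs integrable_cis_mult)

lemma FT_cnj: "cnj (FT \<sigma> f \<xi>) = FT (- \<sigma>) (\<lambda>x. cnj (f x)) \<xi>"
  unfolding FT_def
  by (simp only: complex_cnj_mult complex_cnj_complex_of_real Bochner_Integration.integral_cnj[symmetric]) (simp add: cis_cnj)

lemma FT_tendsto:
  assumes f: "integrable lborel f" and "X \<longlonglongrightarrow> \<xi>"
  shows "(\<lambda>n. FT \<sigma> f (X n)) \<longlonglongrightarrow> FT \<sigma> f \<xi>"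
  unfolding FT_def
proof (intro tendsto_mult_left integral_dominated_convergence[where w="\<lambda>x. cmod (f x)"])
  have "(\<lambda>n. cis (\<sigma> * (x \<bullet> X n)) * f x) \<longlonglongrightarrow> cis (\<sigma> * (x \<bullet> \<xi>)) * f x" for x
    by (intro tendsto_intros assms)
  then show "AE x in lborel. (\<lambda>n. cis (\<sigma> * (x \<bullet> X n)) * f x) \<longlonglongrightarrow> cis (\<sigma> * (x \<bullet> \<xi>)) * f x" by simp
qed (use f in \<open>auto simp: norm_mult intro!: borel_measurable_times\<close>)

lemma FT_continuous:
  assumes "integrable lborel f"
  shows "continuous_on UNIV (FT \<sigma> f)"
  unfolding continuous_on_sequentially comp_def using FT_tendsto[OF assms] by auto

lemma FT_measurable [measurable]:
  "integrable lborel f \<Longrightarrow> FT \<sigma> f \<in> borel_measurable borel"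
  by (rule borel_measurable_continuous_onI[OF FT_continuous])

text \<open>The multiplication formula: the kernel \<open>cis (\<sigma> * (x \<bullet> y))\<close>
  is symmetric, so Fubini moves the transform to the other factor with the same sign.\<close>

lemma FT_swap:
  fixes f g :: "'a::euclidean_space \<Rightarrow> complex"
  assumes f: "integrable lborel f" and g: "integrable lborel g"
  shows "(LINT x|lborel. FT \<sigma> f x * g x) = (LINT x|lborel. f x * FT \<sigma> g x)"
proof -
  have [measurable]: "f \<in> borel_measurable borel" "g \<in> borel_measurable borel" using f g by auto
  let ?h = "\<lambda>x y. cis (\<sigma> * (y \<bullet> x)) * f y * g x"
  let ?c = "complex_of_real ((2 * pi) powr (- (real DIM('a) / 2)))"
  have int: "integrable (lborel \<Otimes>\<^sub>M lborel) (\<lambda>(x, y). ?h x y)"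
  proof (rule lborel_pair.Fubini_integrable)
    show "(\<lambda>(x, y). ?h x y) \<in> borel_measurable (lborel \<Otimes>\<^sub>M lborel)" by measurable
    show "integrable lborel (\<lambda>x. LINT y|lborel. norm (case (x, y) of (x, y) \<Rightarrow> ?h x y))"
      using f g by (auto simp: norm_mult)
    show "AE x in lborel. integrable lborel (\<lambda>y. case (x, y) of (x, y) \<Rightarrow> ?h x y)"
      using integrable_cis_mult[OF f, of \<sigma>] by auto
  qed
  have "(LINT x|lborel. FT \<sigma> f x * g x) = ?c * (LINT x|lborel. LINT y|lborel. ?h x y)"
    unfolding FT_def by (simp add: mult.assoc flip: integral_mult_left_zero)
  also have "(LINT x|lborel. LINT y|lborel. ?h x y) = (LINT y|lborel. LINT x|lborel. ?h x y)"
    using lborel_pair.Fubini_integral[OF int] by simp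
  also have "?c * \<dots> = (LINT x|lborel. f x * FT \<sigma> g x)"
  proof -
    have "(LINT x|lborel. ?h x y) = f y * (LINT x|lborel. cis (\<sigma> * (x \<bullet> y)) * g x)" for y
      by (subst integral_mult_right_zero[symmetric])
         (intro Bochner_Integration.integral_cong refl, simp add: inner_commute mult_ac)
    then have "?c * (LINT y|lborel. LINT x|lborel. ?h x y)
        = (LINT y|lborel. ?c * (f y * (LINT x|lborel. cis (\<sigma> * (x \<bullet> y)) * g x)))"
      by (simp only: integral_mult_right_zero)
    also have "\<dots> = (LINT x|lborel. f x * FT \<sigma> g x)"
      unfolding FT_def by (intro Bochner_Integration.integral_cong refl) (simp only: mult.left_commute)
    finally show ?thesis .
  qed
  finally show ?thesis .
qed

section \<open>Gaussian damping, mollification and the L2 bound for the transform\<close>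

text \<open>A convergence factor: the transform of an integrable function is only known to be
  bounded, its product with \<open>gdamp \<delta>\<close> is integrable, and the factor tends to 1
  as \<delta> tends to 0.\<close>

definition gdamp :: "real \<Rightarrow> 'a::euclidean_space \<Rightarrow> real" where
  "gdamp \<delta> x = exp (- (\<delta>\<^sup>2 * (norm x)\<^sup>2) / 2)"

lemma gdamp_measurable [measurable]: "gdamp \<delta> \<in> borel_measurable borel"
  unfolding gdamp_def by measurable

lemma gdamp_bounds [simp]: "0 \<le> gdamp \<delta> x" "gdamp \<delta> x \<le> 1" "\<bar>gdamp \<delta> x\<bar> \<le> 1"
  by (auto simp: gdamp_def)

lemma gdamp_eq_gauss:
  "gdamp \<delta> (x::'a::euclidean_space) = (2 * pi) powr (real DIM('a) / 2) * gauss (\<delta> *\<^sub>R x)"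
  by (simp add: gdamp_def gauss_def power_mult_distrib powr_minus)

lemma gdamp_integrable:
  assumes "\<delta> \<noteq> 0"
  shows "integrable lborel (gdamp \<delta> :: 'a::euclidean_space \<Rightarrow> real)"
  unfolding gdamp_eq_gauss
  using lborel_integrable_affine[OF gauss_FT(1) assms, of 0] by auto

lemma gdamp_FT:
  fixes v :: "'a::euclidean_space"
  assumes "\<delta> > 0"
  shows "(LINT x|lborel. cis (x \<bullet> v) * of_real (gdamp \<delta> x))
    = of_real ((2 * pi) powr (real DIM('a)) * gauss ((1 / \<delta>) *\<^sub>R v) / \<delta> ^ DIM('a))"
proof -
  have "(2 * pi) powr (real DIM('a) / 2) * (2 * pi) powr (real DIM('a) / 2) = (2 * pi) powr (real DIM('a))"
    by (simp flip: powr_add)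
  then have *: "(2 * pi) powr (real DIM('a) / 2) * exp (- (norm ((1 / \<delta>) *\<^sub>R v))\<^sup>2 / 2)
     = (2 * pi) powr (real DIM('a)) * gauss ((1 / \<delta>) *\<^sub>R v)"
    by (simp add: gauss_def powr_minus field_simps)
  have m: "(\<lambda>x. cis (x \<bullet> ((1 / \<delta>) *\<^sub>R v)) * complex_of_real (gauss x)) \<in> borel_measurable borel"
    by measurable
  have "of_real (exp (- (norm ((1 / \<delta>) *\<^sub>R v))\<^sup>2 / 2))
      = (LINT x|lborel. cis (x \<bullet> ((1 / \<delta>) *\<^sub>R v)) * complex_of_real (gauss (x::'a)))"
    by (rule gauss_FT(2)[symmetric])
  also have "\<dots> = (\<bar>\<delta>\<bar> ^ DIM('a)) *\<^sub>R (LINT x|lborel. cis (x \<bullet> v) * of_real (gauss (\<delta> *\<^sub>R x)))"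
    using assms by (subst lborel_integral_affine[OF m, of \<delta> 0]) auto
  finally have "complex_of_real ((2 * pi) powr (real DIM('a) / 2) * exp (- (norm ((1 / \<delta>) *\<^sub>R v))\<^sup>2 / 2))
     = of_real (\<delta> ^ DIM('a)) * (of_real ((2 * pi) powr (real DIM('a) / 2)) * (LINT x|lborel. cis (x \<bullet> v) * of_real (gauss (\<delta> *\<^sub>R x))))"
    using assms by (simp add: scaleR_conv_of_real)
  also have "of_real ((2 * pi) powr (real DIM('a) / 2)) * (LINT x|lborel. cis (x \<bullet> v) * of_real (gauss (\<delta> *\<^sub>R x)))
      = (LINT x|lborel. cis (x \<bullet> v) * of_real (gdamp \<delta> x))"
    unfolding gdamp_eq_gauss
    by (subst integral_mult_right_zero[symmetric])
       (intro Bochner_Integration.integral_cong refl, simp add: mult_ac)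
  finally show ?thesis using assms unfolding * by (simp add: field_simps)
qed

text \<open>Convolution with the normal density of width \<delta>, written as an average over the
  unscaled variable. Thus \<delta> occurs only in the shift, and the limit \<delta> to 0 is taken
  under a fixed measure.\<close>

definition moll :: "real \<Rightarrow> ('a::euclidean_space \<Rightarrow> complex) \<Rightarrow> 'a \<Rightarrow> complex" where
  "moll \<delta> \<psi> y = (LINT z|lborel. \<psi> (y - \<delta> *\<^sub>R z) * of_real (gauss z))"

lemma integrable_gdamp_mult:
  assumes "\<delta> \<noteq> 0" and [measurable]: "f \<in> borel_measurable borel" and "\<And>x. cmod (f x) \<le> B"
  shows "integrable lborel (\<lambda>x::'a::euclidean_space. of_real (gdamp \<delta> x) * f x)"
proof (rule Bochner_Integration.integrable_bound)
  show "integrable lborel (\<lambda>x::'a. B * gdamp \<delta> x)" by (intro integrable_mult_right gdamp_integrable assms)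
  have "gdamp \<delta> x * cmod (f x) \<le> gdamp \<delta> x * B" for x
    by (intro mult_left_mono assms) simp
  then show "AE x in lborel. norm (of_real (gdamp \<delta> x) * f x) \<le> norm (B * gdamp \<delta> x)"
    by (auto simp: norm_mult mult.commute intro!: order_trans[OF _ abs_ge_self])
qed measurable

lemma integrable_gdamp_FT:
  assumes "\<delta> \<noteq> 0" "integrable lborel \<psi>"
  shows "integrable lborel (\<lambda>x. of_real (gdamp \<delta> x) * FT \<sigma> \<psi> x)"
  by (rule integrable_gdamp_mult[OF assms(1) FT_measurable[OF assms(2)] FT_norm_le[OF assms(2)]])

text \<open>Fourier inversion up to a Gaussian factor: the only form of inversion that is computed explicitly.\<close>

lemma FT_gdamp_FT:
  fixes \<psi> :: "'a::euclidean_space \<Rightarrow> complex"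
  assumes \<sigma>: "\<bar>\<sigma>\<bar> = 1" and \<delta>: "\<delta> > 0" and \<psi>: "integrable lborel \<psi>"
  shows "FT (- \<sigma>) (\<lambda>x. of_real (gdamp \<delta> x) * FT \<sigma> \<psi> x) y = moll \<delta> \<psi> y"
proof -
  have [measurable]: "\<psi> \<in> borel_measurable borel" using \<psi> by auto
  let ?c = "complex_of_real ((2 * pi) powr (- (real DIM('a) / 2)))"
  let ?g = "\<lambda>x. cis (- \<sigma> * (x \<bullet> y)) * of_real (gdamp \<delta> x)"
  have g: "integrable lborel ?g"
    using integrable_gdamp_mult[of \<delta> "\<lambda>x. cis (- \<sigma> * (x \<bullet> y))" 1] \<delta> by (simp add: mult.commute)
  have cc: "?c * ?c * of_real ((2 * pi) powr (real DIM('a))) = 1"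
    by (simp flip: of_real_mult powr_add)
  \<comment> \<open>The two characters combine into one with frequency
    \<open>\<sigma> *\<^sub>R (\<eta> - y)\<close>, so that \<open>gdamp_FT\<close> applies.\<close>
  have FTg: "FT \<sigma> ?g \<eta> = of_real ((2 * pi) powr (real DIM('a) / 2) * gauss ((1 / \<delta>) *\<^sub>R (\<sigma> *\<^sub>R (\<eta> - y))) / \<delta> ^ DIM('a))" for \<eta>
  proof -
    have "FT \<sigma> ?g \<eta> = ?c * (LINT x|lborel. cis (x \<bullet> (\<sigma> *\<^sub>R (\<eta> - y))) * of_real (gdamp \<delta> x))"
      unfolding FT_def by (simp add: mult.assoc[symmetric] cis_mult inner_diff_right ring_distribs)
    also have "\<dots> = ?c * of_real ((2 * pi) powr (real DIM('a)) * gauss ((1 / \<delta>) *\<^sub>R (\<sigma> *\<^sub>R (\<eta> - y))) / \<delta> ^ DIM('a))"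
      by (subst gdamp_FT[OF \<delta>]) simp
    also have "\<dots> = of_real (((2 * pi) powr (- (real DIM('a) / 2)) * (2 * pi) powr (real DIM('a))) * gauss ((1 / \<delta>) *\<^sub>R (\<sigma> *\<^sub>R (\<eta> - y))) / \<delta> ^ DIM('a))"
      by simp
    also have "(2 * pi) powr (- (real DIM('a) / 2)) * (2 * pi) powr (real DIM('a)) = (2 * pi) powr (real DIM('a) / 2)"
      by (simp flip: powr_add)
    finally show ?thesis .
  qed
  have gs: "gauss ((1 / \<delta>) *\<^sub>R (\<sigma> *\<^sub>R (\<eta> - y))) = gauss ((1 / \<delta>) *\<^sub>R (\<eta> - y))" for \<eta>
    using \<sigma> by (simp add: gauss_def)
  have "FT (- \<sigma>) (\<lambda>x. of_real (gdamp \<delta> x) * FT \<sigma> \<psi> x) y = ?c * (LINT x|lborel. FT \<sigma> \<psi> x * ?g x)"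
    unfolding FT_def[of "- \<sigma>"] by (simp add: mult_ac)
  also have "\<dots> = ?c * (LINT \<eta>|lborel. \<psi> \<eta> * FT \<sigma> ?g \<eta>)"
    by (subst FT_swap[OF \<psi> g]) simp
  \<comment> \<open>Substitution of \<open>y - \<delta> *\<^sub>R z\<close> for \<eta>; its Jacobian
    cancels the denominator in \<open>FTg\<close>.\<close>
  also have "\<dots> = ?c * (\<bar>- \<delta>\<bar> ^ DIM('a) *\<^sub>R (LINT z|lborel. \<psi> (y + (- \<delta>) *\<^sub>R z) * FT \<sigma> ?g (y + (- \<delta>) *\<^sub>R z)))"
    by (subst lborel_integral_affine[where c="- \<delta>" and t=y]) (use \<delta> FT_measurable[OF g] in auto)
  also have "\<dots> = (LINT z|lborel. ?c * (of_real (\<delta> ^ DIM('a)) * (\<psi> (y + (- \<delta>) *\<^sub>R z) * FT \<sigma> ?g (y + (- \<delta>) *\<^sub>R z))))"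
    using \<delta> by (simp add: scaleR_conv_of_real)
  also have "\<dots> = moll \<delta> \<psi> y"
    unfolding moll_def
  proof (intro Bochner_Integration.integral_cong refl)
    fix z
    have "?c * of_real ((2 * pi) powr (real DIM('a) / 2)) = 1"
      by (simp flip: of_real_mult powr_add)
    moreover have "FT \<sigma> ?g (y + (- \<delta>) *\<^sub>R z) = of_real ((2 * pi) powr (real DIM('a) / 2)) * of_real (gauss z) / of_real (\<delta> ^ DIM('a))"
      unfolding FTg gs using \<delta> by (simp add: gauss_def)
    moreover have "c * (D * (P * (C * G / D))) = P * G" if "c * C = 1" "D \<noteq> 0" for c C D P G :: complex
    proof -
      have "c * (D * (P * (C * G / D))) = (c * C) * (P * G) * (D / D)" by (simp add: mult_ac)
      then show ?thesis using that by simp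
    qed
    moreover have "complex_of_real (\<delta> ^ DIM('a)) \<noteq> 0" using \<delta> by simp
    ultimately show "?c * (of_real (\<delta> ^ DIM('a)) * (\<psi> (y + (- \<delta>) *\<^sub>R z) * FT \<sigma> ?g (y + (- \<delta>) *\<^sub>R z))) = \<psi> (y - \<delta> *\<^sub>R z) * of_real (gauss z)"
      by (simp only: add_uminus_conv_diff scaleR_minus_left)
  qed
  finally show ?thesis .
qed

lemma L2_translate:
  assumes "L2 \<psi>"
  shows "L2 (\<lambda>y. \<psi> (y - v))" and "L2_norm (\<lambda>y. \<psi> (y - v)) = L2_norm \<psi>"
proof -
  have [measurable]: "\<psi> \<in> borel_measurable borel" using assms by measurable
  have "integrable lborel (\<lambda>y. (cmod (\<psi> (- v + 1 *\<^sub>R y)))\<^sup>2)"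
    by (rule lborel_integrable_affine[OF L2_integrable_square[OF assms]]) simp
  then show "L2 (\<lambda>y. \<psi> (y - v))" by (simp add: L2_def)
  have "(LINT x|lborel. (cmod (\<psi> x))\<^sup>2) = \<bar>1\<bar> ^ DIM('a) *\<^sub>R (LINT x|lborel. (cmod (\<psi> (- v + 1 *\<^sub>R x)))\<^sup>2)"
    by (rule lborel_integral_affine) auto
  then show "L2_norm (\<lambda>y. \<psi> (y - v)) = L2_norm \<psi>" by (simp add: L2_norm_def)
qed

lemma cnj_measurable [measurable]: "cnj \<in> borel_measurable borel"
  by (intro borel_measurable_continuous_onI continuous_intros)

lemma L2_cnj: "L2 h \<Longrightarrow> L2 (\<lambda>x. cnj (h x))" "L2_norm (\<lambda>x. cnj (h x)) = L2_norm h"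
  by (auto simp: L2_def L2_norm_def)

text \<open>By Fubini, pairing with a mollified function is the Gaussian average of the pairings
  with translates. Translates keep the L2 norm and the weight has mass 1, so the bound is uniform in
  \<delta>.\<close>

lemma integral_mult_moll:
  fixes f \<psi> :: "'a::euclidean_space \<Rightarrow> complex"
  assumes f: "L2 f" and \<psi>: "L2 \<psi>"
  shows "(LINT y|lborel. f y * moll \<delta> \<psi> y) = (LINT z|lborel. (LINT y|lborel. f y * \<psi> (y - \<delta> *\<^sub>R z)) * of_real (gauss z))"
    and "cmod (LINT y|lborel. f y * moll \<delta> \<psi> y) \<le> L2_norm f * L2_norm \<psi>"
    and "\<And>z. cmod (LINT y|lborel. f y * \<psi> (y - \<delta> *\<^sub>R z)) \<le> L2_norm f * L2_norm \<psi>"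
    and "(\<lambda>z. LINT y|lborel. f y * \<psi> (y - \<delta> *\<^sub>R z)) \<in> borel_measurable borel"
proof -
  have [measurable]: "f \<in> borel_measurable borel" "\<psi> \<in> borel_measurable borel" using f \<psi> by measurable
  let ?h = "\<lambda>z y. f y * \<psi> (y - \<delta> *\<^sub>R z) * of_real (gauss z)"
  have cs: "(LINT y|lborel. cmod (f y * \<psi> (y - \<delta> *\<^sub>R z))) \<le> L2_norm f * L2_norm \<psi>" for z
    using L2_Cauchy_Schwarz_norm[OF f L2_translate(1)[OF \<psi>]] L2_translate(2)[OF \<psi>] by simp
  show bd: "cmod (LINT y|lborel. f y * \<psi> (y - \<delta> *\<^sub>R z)) \<le> L2_norm f * L2_norm \<psi>" for z
    using L2_Cauchy_Schwarz[OF f L2_translate(1)[OF \<psi>]] L2_translate(2)[OF \<psi>] by simp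
  show [measurable]: "(\<lambda>z. LINT y|lborel. f y * \<psi> (y - \<delta> *\<^sub>R z)) \<in> borel_measurable borel"
    by measurable
  have eq: "(LINT y|lborel. norm (?h z y)) = (LINT y|lborel. cmod (f y * \<psi> (y - \<delta> *\<^sub>R z))) * gauss z" for z
    by (subst integral_mult_left_zero[symmetric]) (simp add: norm_mult)
  have ig: "integrable lborel (\<lambda>z::'a. L2_norm f * L2_norm \<psi> * gauss z)"
    by (intro integrable_mult_right gauss_FT(1))
  have int: "integrable (lborel \<Otimes>\<^sub>M lborel) (\<lambda>(z, y). ?h z y)"
  proof (rule lborel_pair.Fubini_integrable)
    show "(\<lambda>(z, y). ?h z y) \<in> borel_measurable (lborel \<Otimes>\<^sub>M lborel)" by measurable
    have "AE z in lborel. norm (LINT y|lborel. norm (?h z y)) \<le> norm (L2_norm f * L2_norm \<psi> * gauss z)"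
      unfolding eq using cs by (auto simp: abs_mult intro!: mult_right_mono)
    then show "integrable lborel (\<lambda>z. LINT y|lborel. norm (case (z, y) of (z, y) \<Rightarrow> ?h z y))"
      by (intro Bochner_Integration.integrable_bound[OF ig]) auto
    show "AE z in lborel. integrable lborel (\<lambda>y. case (z, y) of (z, y) \<Rightarrow> ?h z y)"
      using L2_mult_integrable[OF f L2_translate(1)[OF \<psi>]] by auto
  qed
  have "(LINT y|lborel. f y * moll \<delta> \<psi> y) = (LINT y|lborel. LINT z|lborel. ?h z y)"
    unfolding moll_def
    by (intro Bochner_Integration.integral_cong refl, subst integral_mult_right_zero[symmetric]) (simp add: mult.assoc)
  also have "\<dots> = (LINT z|lborel. LINT y|lborel. ?h z y)"
    using lborel_pair.Fubini_integral[OF int] by simp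
  also have "\<dots> = (LINT z|lborel. (LINT y|lborel. f y * \<psi> (y - \<delta> *\<^sub>R z)) * of_real (gauss z))"
    by (simp only: integral_mult_left_zero)
  finally show *: "(LINT y|lborel. f y * moll \<delta> \<psi> y) = (LINT z|lborel. (LINT y|lborel. f y * \<psi> (y - \<delta> *\<^sub>R z)) * of_real (gauss z))" .
  have "cmod (LINT y|lborel. f y * moll \<delta> \<psi> y)
      \<le> (LINT z|lborel. cmod ((LINT y|lborel. f y * \<psi> (y - \<delta> *\<^sub>R z)) * of_real (gauss z)))"
    unfolding * by (rule integral_norm_bound)
  also have "\<dots> \<le> (LINT z|lborel. L2_norm f * L2_norm \<psi> * gauss (z::'a))"
  proof (rule integral_mono)
    show "integrable lborel (\<lambda>z. cmod ((LINT y|lborel. f y * \<psi> (y - \<delta> *\<^sub>R z)) * of_real (gauss z)))"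
      by (intro Bochner_Integration.integrable_bound[OF ig])
        (use bd in \<open>auto simp: norm_mult abs_mult intro!: mult_right_mono\<close>)
    show "cmod ((LINT y|lborel. f y * \<psi> (y - \<delta> *\<^sub>R z)) * of_real (gauss z)) \<le> L2_norm f * L2_norm \<psi> * gauss z" for z
      using bd by (auto simp: norm_mult intro!: mult_right_mono)
  qed (rule ig)
  also have "\<dots> = L2_norm f * L2_norm \<psi>"
    by (simp add: integral_gauss)
  finally show "cmod (LINT y|lborel. f y * moll \<delta> \<psi> y) \<le> L2_norm f * L2_norm \<psi>" .
qed

lemma gdamp_tendsto_1: "X \<longlonglongrightarrow> 0 \<Longrightarrow> (\<lambda>n. gdamp (X n) x) \<longlonglongrightarrow> 1"
proof -
  assume "X \<longlonglongrightarrow> 0"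
  then have "(\<lambda>n. exp (- ((X n)\<^sup>2 * (norm x)\<^sup>2) / 2)) \<longlonglongrightarrow> exp (- (0\<^sup>2 * (norm x)\<^sup>2) / 2)"
    by (intro tendsto_intros) auto
  then show ?thesis by (simp add: gdamp_def)
qed

text \<open>One half of Plancherel. Since \<open>cnj (FT \<sigma> h)\<close> is
  \<open>FT (- \<sigma>)\<close> of \<open>cnj h\<close>, the damped integral of
  \<open>(cmod (FT \<sigma> h x))\<^sup>2\<close> is a pairing to which \<open>FT_swap\<close>
  applies; it becomes the pairing of \<open>h\<close> with the mollified \<open>cnj h\<close>, which
  is at most \<open>(L2_norm h)\<^sup>2\<close> for every \<delta>. Fatou removes the
  damping.\<close>

lemma L2_FT:
  fixes h :: "'a::euclidean_space \<Rightarrow> complex"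
  assumes \<sigma>: "\<bar>\<sigma>\<bar> = 1" and h1: "integrable lborel h" and h2: "L2 h"
  shows "L2 (FT \<sigma> h)" and "L2_norm (FT \<sigma> h) \<le> L2_norm h"
proof -
  note [measurable] = FT_measurable[OF h1]
  let ?F = "FT \<sigma> h"
  have cnj1: "integrable lborel (\<lambda>x. cnj (h x))" using h1 by simp
  have le: "(\<integral>\<^sup>+x. ennreal ((cmod (?F x))\<^sup>2 * gdamp \<delta> x) \<partial>lborel) \<le> ennreal ((L2_norm h)\<^sup>2)" if \<delta>: "\<delta> > 0" for \<delta>
  proof -
    have G: "integrable lborel (\<lambda>x. of_real (gdamp \<delta> x) * FT (- \<sigma>) (\<lambda>x. cnj (h x)) x)"
      by (rule integrable_gdamp_FT) (use \<delta> cnj1 in auto)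
    have eq: "?F x * (of_real (gdamp \<delta> x) * FT (- \<sigma>) (\<lambda>x. cnj (h x)) x) = of_real ((cmod (?F x))\<^sup>2 * gdamp \<delta> x)" for x
    proof -
      have "?F x * (of_real (gdamp \<delta> x) * cnj (?F x)) = (?F x * cnj (?F x)) * of_real (gdamp \<delta> x)"
        by (simp only: mult_ac)
      then show ?thesis by (simp only: FT_cnj[symmetric] complex_norm_square[symmetric] of_real_mult)
    qed
    have int: "integrable lborel (\<lambda>x. (cmod (?F x))\<^sup>2 * gdamp \<delta> x)"
    proof (rule Bochner_Integration.integrable_bound[OF integrable_norm[OF integrable_gdamp_mult[of \<delta> "\<lambda>x. of_real ((cmod (?F x))\<^sup>2)" "(LINT x|lborel. cmod (h x))\<^sup>2"]]])
      show "cmod (of_real ((cmod (?F x))\<^sup>2)) \<le> (LINT x|lborel. cmod (h x))\<^sup>2" for x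
        using power_mono[OF FT_norm_le[OF h1] norm_ge_zero, of \<sigma> x 2] by (simp add: norm_power)
      show "AE x in lborel. norm ((cmod (?F x))\<^sup>2 * gdamp \<delta> x) \<le> norm (cmod (of_real (gdamp \<delta> x) * of_real ((cmod (?F x))\<^sup>2)))"
        by (simp add: norm_mult abs_mult norm_power mult.commute)
    qed (use \<delta> in auto)
    have "complex_of_real (LINT x|lborel. (cmod (?F x))\<^sup>2 * gdamp \<delta> x)
      = (LINT x|lborel. ?F x * (of_real (gdamp \<delta> x) * FT (- \<sigma>) (\<lambda>x. cnj (h x)) x))"
      unfolding eq by (simp only: integral_complex_of_real)
    also have "\<dots> = (LINT x|lborel. h x * FT \<sigma> (\<lambda>x. of_real (gdamp \<delta> x) * FT (- \<sigma>) (\<lambda>x. cnj (h x)) x) x)"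
      by (rule FT_swap[OF h1 G])
    also have "\<dots> = (LINT x|lborel. h x * moll \<delta> (\<lambda>x. cnj (h x)) x)"
      using FT_gdamp_FT[of "- \<sigma>" \<delta> "\<lambda>x. cnj (h x)"] \<sigma> \<delta> cnj1 by simp
    finally have "cmod (of_real (LINT x|lborel. (cmod (?F x))\<^sup>2 * gdamp \<delta> x)) \<le> L2_norm h * L2_norm h"
      using integral_mult_moll(2)[OF h2 L2_cnj(1)[OF h2], of \<delta>] by (simp add: L2_cnj(2))
    then have "(LINT x|lborel. (cmod (?F x))\<^sup>2 * gdamp \<delta> x) \<le> (L2_norm h)\<^sup>2"
      by (simp add: power2_eq_square)
    then show ?thesis
      by (subst nn_integral_eq_integral[OF int]) (auto intro!: ennreal_leI)
  qed
  define X where "X n = 1 / real (Suc n)" for n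
  have X: "X \<longlonglongrightarrow> 0" unfolding X_def by (rule LIMSEQ_Suc) (rule lim_1_over_n)
  have "(\<integral>\<^sup>+x. ennreal ((cmod (?F x))\<^sup>2) \<partial>lborel)
     = (\<integral>\<^sup>+x. liminf (\<lambda>n. ennreal ((cmod (?F x))\<^sup>2 * gdamp (X n) x)) \<partial>lborel)"
  proof (intro nn_integral_cong lim_imp_Liminf[symmetric])
    fix x
    have "(\<lambda>n. (cmod (?F x))\<^sup>2 * gdamp (X n) x) \<longlonglongrightarrow> (cmod (?F x))\<^sup>2 * 1"
      by (intro tendsto_intros gdamp_tendsto_1 X)
    then show "(\<lambda>n. ennreal ((cmod (?F x))\<^sup>2 * gdamp (X n) x)) \<longlonglongrightarrow> ennreal ((cmod (?F x))\<^sup>2)"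
      by (intro tendsto_ennrealI) simp
  qed simp
  also have "\<dots> \<le> liminf (\<lambda>n. \<integral>\<^sup>+x. ennreal ((cmod (?F x))\<^sup>2 * gdamp (X n) x) \<partial>lborel)"
    by (rule nn_integral_liminf) measurable
  also have "\<dots> \<le> ennreal ((L2_norm h)\<^sup>2)"
  proof -
    have "liminf (\<lambda>n. \<integral>\<^sup>+x. ennreal ((cmod (?F x))\<^sup>2 * gdamp (X n) x) \<partial>lborel) \<le> liminf (\<lambda>n::nat. ennreal ((L2_norm h)\<^sup>2))"
      by (intro Liminf_mono always_eventually allI le) (simp add: X_def)
    then show ?thesis by (simp add: Liminf_const)
  qed
  finally show "L2 ?F" "L2_norm ?F \<le> L2_norm h"
    using L2I_nn_integral[of ?F "L2_norm h"] by auto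
qed

section \<open>Continuous test functions and duality\<close>

text \<open>Mere continuity suffices for testing, because \<open>L2_FT\<close> already places the
  transforms of these functions in L2. Support is expressed by a ball so that multiples of an
  indicator serve as dominating functions.\<close>

definition Cc :: "('a::euclidean_space \<Rightarrow> complex) \<Rightarrow> bool" where
  "Cc \<psi> \<longleftrightarrow> continuous_on UNIV \<psi> \<and> (\<exists>R. \<forall>x. R < norm x \<longrightarrow> \<psi> x = 0)"

lemma integrable_indicator_cball: "integrable lborel (indicator (cball (0::'a::euclidean_space) R) :: 'a \<Rightarrow> real)"
  by (intro integrable_real_indicator) (auto simp: emeasure_bounded_finite[unfolded infinity_ennreal_def])

lemma CcE:
  assumes "Cc \<psi>"
  obtains R B where "0 \<le> R" "0 \<le> B" "\<And>x. R < norm x \<Longrightarrow> \<psi> x = 0"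
    "\<And>x. cmod (\<psi> x) \<le> B * indicator (cball 0 R) x"
proof -
  from assms obtain R0 where R0: "\<And>x. R0 < norm x \<Longrightarrow> \<psi> x = 0" and c: "continuous_on UNIV \<psi>"
    unfolding Cc_def by auto
  define R where "R = max 0 R0"
  have z: "\<psi> x = 0" if "R < norm x" for x using R0 that by (simp add: R_def)
  have "compact (\<psi> ` cball 0 R)"
    by (intro compact_continuous_image continuous_on_subset[OF c]) auto
  then obtain B where B: "\<forall>x\<in>cball 0 R. cmod (\<psi> x) \<le> B"
    using compact_imp_bounded bounded_iff by (metis (no_types, lifting) imageI)
  have "cmod (\<psi> x) \<le> max 0 B * indicator (cball 0 R) x" for x
    using B z[of x] by (cases "norm x \<le> R") (auto simp: indicator_def le_max_iff_disj)
  with z show ?thesis by (intro that[of R "max 0 B"]) (auto simp: R_def)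
qed

lemma Cc_measurable: "Cc \<psi> \<Longrightarrow> \<psi> \<in> borel_measurable borel"
  by (auto simp: Cc_def intro: borel_measurable_continuous_onI)

lemma L2_of_bound_indicator:
  assumes [measurable]: "f \<in> borel_measurable borel" and B: "\<And>x. cmod (f x) \<le> B * indicator (cball (0::'a::euclidean_space) R) x"
  shows "integrable lborel f" "L2 f"
proof -
  show "integrable lborel f"
    by (rule Bochner_Integration.integrable_bound[OF integrable_mult_right[OF integrable_indicator_cball[of R]], of _ B])
       (use B in \<open>auto intro: order_trans[OF _ abs_ge_self]\<close>)
  have "(cmod (f x))\<^sup>2 \<le> B\<^sup>2 * indicator (cball 0 R) x" for x
    using power_mono[OF B[of x] norm_ge_zero, of 2] by (auto simp: indicator_def power_mult_distrib split: if_splits)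
  then show "L2 f" unfolding L2_def
    by (intro conjI Bochner_Integration.integrable_bound[OF integrable_mult_right[OF integrable_indicator_cball[of R]], of _ "B\<^sup>2"])
       (auto intro: order_trans[OF _ abs_ge_self])
qed

lemma Cc_L2: "Cc \<psi> \<Longrightarrow> L2 \<psi>" and Cc_integrable: "Cc \<psi> \<Longrightarrow> integrable lborel \<psi>"
  by (meson CcE Cc_measurable L2_of_bound_indicator)+

text \<open>Dominated convergence twice. For fixed z, \<open>\<bar>X n\<bar> \<le> 1\<close> keeps
  all translates inside the ball of radius \<open>R + norm z\<close>; then the pairings, as
  functions of z, are dominated by a multiple of \<open>gauss\<close>.\<close>

lemma integral_mult_moll_tendsto:
  fixes f :: "'a::euclidean_space \<Rightarrow> complex"
  assumes f: "L2 f" and \<psi>: "Cc \<psi>" and X: "X \<longlonglongrightarrow> 0" "\<And>n. \<bar>X n\<bar> \<le> 1"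
  shows "(\<lambda>n. LINT y|lborel. f y * moll (X n) \<psi> y) \<longlonglongrightarrow> (LINT y|lborel. f y * \<psi> y)"
proof -
  have [measurable]: "f \<in> borel_measurable borel" using f by measurable
  note [measurable] = Cc_measurable[OF \<psi>]
  obtain R B where RB: "0 \<le> R" "0 \<le> B" "\<And>x. R < norm x \<Longrightarrow> \<psi> x = 0"
    "\<And>x. cmod (\<psi> x) \<le> B * indicator (cball 0 R) x" using CcE[OF \<psi>] by metis
  have cont: "continuous_on UNIV \<psi>" using \<psi> by (simp add: Cc_def)
  have inner: "(\<lambda>n. LINT y|lborel. f y * \<psi> (y - X n *\<^sub>R z)) \<longlonglongrightarrow> (LINT y|lborel. f y * \<psi> y)" for z
  proof (rule integral_dominated_convergence[where w="\<lambda>y. cmod (f y * of_real (B * indicator (cball 0 (R + norm z)) y))"])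
    have "L2 (\<lambda>y::'a. complex_of_real (B * indicator (cball 0 (R + norm z)) y))"
      by (rule L2_of_bound_indicator(2)[where B=B and R="R + norm z"]) (measurable, use RB in \<open>auto simp: norm_mult\<close>)
    then show "integrable lborel (\<lambda>y. cmod (f y * of_real (B * indicator (cball 0 (R + norm z)) y)))"
      by (intro integrable_norm L2_mult_integrable f)
    have "cmod (\<psi> (y - X n *\<^sub>R z)) \<le> B * indicator (cball 0 (R + norm z)) y" for y n
    proof -
      have "norm y \<le> norm (y - X n *\<^sub>R z) + norm (X n *\<^sub>R z)"
        by (metis diff_add_cancel norm_triangle_ineq)
      moreover have "norm (X n *\<^sub>R z) \<le> norm z"
        using X(2)[of n] by (simp add: mult_left_le_one_le)
      ultimately have "y \<notin> cball 0 (R + norm z) \<Longrightarrow> R < norm (y - X n *\<^sub>R z)" by auto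
      moreover have "cmod (\<psi> (y - X n *\<^sub>R z)) \<le> B"
        using RB(4)[of "y - X n *\<^sub>R z"] RB(2)
        by (cases "norm (y - X n *\<^sub>R z) \<le> R") (auto simp: indicator_def)
      ultimately show ?thesis using RB by (auto simp: indicator_def)
    qed
    then show "AE y in lborel. norm (f y * \<psi> (y - X n *\<^sub>R z)) \<le> cmod (f y * of_real (B * indicator (cball 0 (R + norm z)) y))" for n
      using RB by (auto simp: norm_mult intro!: mult_left_mono)
    have "(\<lambda>n. \<psi> (y - X n *\<^sub>R z)) \<longlonglongrightarrow> \<psi> y" for y
    proof -
      have "(\<lambda>n. y - X n *\<^sub>R z) \<longlonglongrightarrow> y - 0 *\<^sub>R z"
        by (intro tendsto_intros X(1))
      then have "(\<lambda>n. y - X n *\<^sub>R z) \<longlonglongrightarrow> y" by simp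
      from continuous_on_tendsto_compose[OF cont this] show ?thesis by simp
    qed
    then show "AE y in lborel. (\<lambda>n. f y * \<psi> (y - X n *\<^sub>R z)) \<longlonglongrightarrow> f y * \<psi> y"
      by (intro AE_I2 tendsto_mult_left)
  qed measurable
  have "(\<lambda>n. LINT z|lborel. (LINT y|lborel. f y * \<psi> (y - X n *\<^sub>R z)) * of_real (gauss z))
     \<longlonglongrightarrow> (LINT z|lborel. (LINT y|lborel. f y * \<psi> y) * of_real (gauss (z::'a)))"
  proof (rule integral_dominated_convergence[where w="\<lambda>z. L2_norm f * L2_norm \<psi> * gauss z"])
    show "(\<lambda>z. (LINT y|lborel. f y * \<psi> (y - X n *\<^sub>R z)) * complex_of_real (gauss z)) \<in> borel_measurable lborel" for n
      by measurable
    show "integrable lborel (\<lambda>z::'a. L2_norm f * L2_norm \<psi> * gauss z)"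
      by (intro integrable_mult_right gauss_FT(1))
    show "AE z in lborel. (\<lambda>n. (LINT y|lborel. f y * \<psi> (y - X n *\<^sub>R z)) * of_real (gauss z)) \<longlonglongrightarrow> (LINT y|lborel. f y * \<psi> y) * of_real (gauss (z::'a))"
      by (intro AE_I2 tendsto_mult_right inner)
    show "AE z in lborel. norm ((LINT y|lborel. f y * \<psi> (y - X n *\<^sub>R z)) * of_real (gauss z)) \<le> L2_norm f * L2_norm \<psi> * gauss z" for n
      using integral_mult_moll(3)[OF f Cc_L2[OF \<psi>]] by (auto simp: norm_mult intro!: mult_right_mono)
  qed measurable
  then show ?thesis
    unfolding integral_mult_moll(1)[OF f Cc_L2[OF \<psi>]]
    by (simp only: integral_mult_right_zero integral_complex_of_real integral_gauss of_real_1 mult_1_right)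
qed

text \<open>This replaces Plancherel's theorem: an \<open>L2_extension\<close> is only ever evaluated against
  continuous functions of compact support, where the approximating sequence can be removed.\<close>

lemma L2_extension_pairing:
  fixes f g :: "'a::euclidean_space \<Rightarrow> complex"
  assumes \<sigma>: "\<bar>\<sigma>\<bar> = 1" and ext: "L2_extension (FT \<sigma>) f g" and \<psi>: "Cc \<psi>"
  shows "(LINT x|lborel. f x * \<psi> x) = (LINT x|lborel. g x * FT (- \<sigma>) \<psi> x)"
proof -
  from ext obtain \<phi> where f: "L2 f" and g: "L2 g"
    and \<phi>: "\<And>k. integrable lborel (\<phi> k)" "\<And>k. L2 (\<phi> k)" "\<And>k. L2 (FT \<sigma> (\<phi> k))"
    and lim: "(\<lambda>k. L2_norm (\<lambda>x. \<phi> k x - f x)) \<longlonglongrightarrow> 0" "(\<lambda>k. L2_norm (\<lambda>\<xi>. FT \<sigma> (\<phi> k) \<xi> - g \<xi>)) \<longlonglongrightarrow> 0"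
    unfolding L2_extension_def by auto
  have \<sigma>': "\<bar>- \<sigma>\<bar> = 1" using \<sigma> by simp
  note \<psi>1 = Cc_integrable[OF \<psi>] and \<psi>2 = Cc_L2[OF \<psi>]
  note [measurable] = FT_measurable[OF \<psi>1]
  note F2 = L2_FT[OF \<sigma>' \<psi>1 \<psi>2]
  \<comment> \<open>The damped transform of \<psi> is integrable and in L2, and its own transform is
    \<open>moll \<delta> \<psi>\<close>. Hence \<open>FT_swap\<close> applies to every
    \<open>\<phi> k\<close>, and both sides pass to the limit in k by L2 convergence.\<close>
  have *: "(LINT x|lborel. g x * (of_real (gdamp \<delta> x) * FT (- \<sigma>) \<psi> x)) = (LINT x|lborel. f x * moll \<delta> \<psi> x)"
    if \<delta>: "\<delta> > 0" for \<delta>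
  proof -
    let ?\<eta> = "\<lambda>x. of_real (gdamp \<delta> x) * FT (- \<sigma>) \<psi> x"
    have \<eta>1: "integrable lborel ?\<eta>" by (rule integrable_gdamp_FT) (use \<delta> \<psi>1 in auto)
    have \<eta>2: "L2 ?\<eta>"
      by (rule L2_bound(1)[OF F2(1), of _ 1]) (auto simp: norm_mult intro!: mult_left_le_one_le)
    have FT\<eta>: "FT \<sigma> ?\<eta> = moll \<delta> \<psi>"
      using FT_gdamp_FT[OF \<sigma>' \<delta> \<psi>1] by auto
    have m2: "L2 (moll \<delta> \<psi>)" using L2_FT(1)[OF \<sigma> \<eta>1 \<eta>2] by (simp add: FT\<eta>)
    have eq: "(LINT x|lborel. FT \<sigma> (\<phi> k) x * ?\<eta> x) = (LINT x|lborel. \<phi> k x * moll \<delta> \<psi> x)" for k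
      using FT_swap[OF \<phi>(1) \<eta>1] by (simp add: FT\<eta>)
    have "(\<lambda>k. LINT x|lborel. FT \<sigma> (\<phi> k) x * ?\<eta> x) \<longlonglongrightarrow> (LINT x|lborel. g x * ?\<eta> x)"
      by (rule L2_pairing_tendsto[OF \<phi>(3) g \<eta>2 lim(2)])
    moreover have "(\<lambda>k. LINT x|lborel. \<phi> k x * moll \<delta> \<psi> x) \<longlonglongrightarrow> (LINT x|lborel. f x * moll \<delta> \<psi> x)"
      by (rule L2_pairing_tendsto[OF \<phi>(2) f m2 lim(1)])
    ultimately show ?thesis unfolding eq by (rule LIMSEQ_unique)
  qed
  define X where "X n = 1 / real (Suc n)" for n
  have X: "X \<longlonglongrightarrow> 0" unfolding X_def by (rule LIMSEQ_Suc) (rule lim_1_over_n)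
  have Xp: "0 < X n" "\<bar>X n\<bar> \<le> 1" for n by (auto simp: X_def)
  have [measurable]: "g \<in> borel_measurable borel" using g by measurable
  have "(\<lambda>n. LINT x|lborel. g x * (of_real (gdamp (X n) x) * FT (- \<sigma>) \<psi> x)) \<longlonglongrightarrow> (LINT x|lborel. g x * FT (- \<sigma>) \<psi> x)"
  proof (rule integral_dominated_convergence[where w="\<lambda>x. cmod (g x * FT (- \<sigma>) \<psi> x)"])
    show "integrable lborel (\<lambda>x. cmod (g x * FT (- \<sigma>) \<psi> x))"
      by (intro integrable_norm L2_mult_integrable g F2)
    have "(\<lambda>n. g x * (of_real (gdamp (X n) x) * FT (- \<sigma>) \<psi> x)) \<longlonglongrightarrow> g x * (of_real 1 * FT (- \<sigma>) \<psi> x)" for x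
      by (intro tendsto_intros gdamp_tendsto_1 X)
    then show "AE x in lborel. (\<lambda>n. g x * (of_real (gdamp (X n) x) * FT (- \<sigma>) \<psi> x)) \<longlonglongrightarrow> g x * FT (- \<sigma>) \<psi> x"
      by simp
    show "AE x in lborel. norm (g x * (of_real (gdamp (X n) x) * FT (- \<sigma>) \<psi> x)) \<le> cmod (g x * FT (- \<sigma>) \<psi> x)" for n
      by (auto simp: norm_mult intro!: mult_left_mono mult_left_le_one_le)
  qed measurable
  then have "(\<lambda>n. LINT x|lborel. f x * moll (X n) \<psi> x) \<longlonglongrightarrow> (LINT x|lborel. g x * FT (- \<sigma>) \<psi> x)"
    using *[OF Xp(1)] by simp
  with integral_mult_moll_tendsto[OF f \<psi> X Xp(2)] show ?thesis
    by (rule LIMSEQ_unique)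
qed

text \<open>The ideal test function is \<open>cnj h\<close>. It is truncated to a set where x and
  \<open>h x\<close> are bounded by R, approximated almost everywhere by members of
  \<open>Cc\<close>, and R is finally sent to infinity by Fatou.\<close>

lemma L2_norm_le_of_pairing:
  fixes h :: "'a::euclidean_space \<Rightarrow> complex"
  assumes h: "L2 h" and M: "0 \<le> M"
    and le: "\<And>\<psi>. Cc \<psi> \<Longrightarrow> cmod (LINT x|lborel. h x * \<psi> x) \<le> M * L2_norm \<psi>"
  shows "L2_norm h \<le> M"
proof -
  have hm [measurable]: "h \<in> borel_measurable borel" using h by measurable
  define S where "S R = {x. norm x \<le> R \<and> cmod (h x) \<le> R}" for R :: real
  have S [measurable]: "S R \<in> sets borel" for R unfolding S_def by measurable
  have le': "(\<integral>\<^sup>+x. ennreal ((cmod (h x))\<^sup>2 * indicator (S R) x) \<partial>lborel) \<le> ennreal (M\<^sup>2)" if R: "R > 0" for R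
  proof -
    define k where "k x = cnj (h x) * indicator (S R) x" for x
    have km [measurable]: "k \<in> borel_measurable borel" unfolding k_def by measurable
    have kb: "cmod (k x) \<le> R * indicator (cball 0 R) x" for x
      using R by (auto simp: k_def S_def indicator_def)
    note k1 = L2_of_bound_indicator(1)[OF km kb] and k2 = L2_of_bound_indicator(2)[OF km kb]
    \<comment> \<open>Approximants need a common bound and a common support: \<open>clip\<close> is
      the radial retraction onto the disc of radius R, and \<open>q\<close> equals 1 on the ball of
      radius R and 0 outside radius \<open>R + 1\<close>. Neither changes the limit
      \<open>k\<close>.\<close>
    define clip where "clip z = of_real (R / max R (cmod z)) * z" for z :: complex
    define q :: "'a \<Rightarrow> real" where "q x = max 0 (min 1 (R + 1 - norm x))" for x
    have clip_cont: "continuous_on UNIV clip" unfolding clip_def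
      using R by (intro continuous_intros) auto
    have clip_bd: "cmod (clip z) \<le> R" for z
    proof (cases "cmod z \<le> R")
      case False
      then have "z \<noteq> 0" using R by auto
      then show ?thesis using False R by (simp add: clip_def norm_mult norm_divide max_def)
    qed (use R in \<open>simp add: clip_def max_def\<close>)
    have clip_id: "clip z = z" if "cmod z \<le> R" for z
    proof -
      have "max R (cmod z) = R" using that by simp
      then show ?thesis using R by (simp add: clip_def)
    qed
    have q_cont: "continuous_on UNIV q" unfolding q_def by (intro continuous_intros)
    have q01: "0 \<le> q x" "q x \<le> 1" for x by (auto simp: q_def)
    \<comment> \<open>\<open>measurable_on\<close> supplies continuous functions converging to
      \<open>k\<close> off a negligible set.\<close>
    have "k measurable_on UNIV"
      by (rule lebesgue_measurable_imp_measurable_on) (use km in \<open>auto intro: measurable_completion\<close>)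
    then obtain N g where N: "negligible N" and g: "\<And>n. continuous_on UNIV (g n)"
      and gk: "\<And>x. x \<notin> N \<Longrightarrow> (\<lambda>n. g n x) \<longlonglongrightarrow> k x"
      unfolding measurable_on_def by auto
    define \<psi> where "\<psi> n x = of_real (q x) * clip (g n x)" for n :: nat and x
    have c: "continuous_on UNIV (\<psi> n)" for n
      unfolding \<psi>_def
      by (intro continuous_on_mult continuous_on_of_real q_cont continuous_on_compose2[OF clip_cont g]) auto
    have Cc: "Cc (\<psi> n)" for n unfolding Cc_def using c
      by (auto intro!: exI[of _ "R + 1"] simp: \<psi>_def q_def)
    note [measurable] = Cc_measurable[OF Cc]
    have \<psi>b: "cmod (\<psi> n x) \<le> R * indicator (cball 0 (R + 1)) x" for n x
    proof (cases "norm x \<le> R + 1")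
      case True
      have "q x * cmod (clip (g n x)) \<le> 1 * R" by (intro mult_mono q01 clip_bd) auto
      then show ?thesis using True q01[of x] by (simp add: \<psi>_def norm_mult)
    qed (simp add: \<psi>_def q_def)
    have \<psi>k: "(\<lambda>n. \<psi> n x) \<longlonglongrightarrow> k x" if "x \<notin> N" for x
    proof -
      have "(\<lambda>n. clip (g n x)) \<longlonglongrightarrow> clip (k x)"
        using continuous_on_tendsto_compose[OF clip_cont gk[OF that]] by simp
      moreover have "clip (k x) = k x"
        by (rule clip_id) (use kb[of x] R in \<open>cases "norm x \<le> R"; auto simp: indicator_def\<close>)
      ultimately have "(\<lambda>n. \<psi> n x) \<longlonglongrightarrow> of_real (q x) * k x"
        unfolding \<psi>_def by (simp add: tendsto_mult_left)
      moreover have "of_real (q x) * k x = k x"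
        by (cases "norm x \<le> R") (auto simp: q_def k_def S_def)
      ultimately show ?thesis by simp
    qed
    have AE: "AE x in lborel. (\<lambda>n. \<psi> n x) \<longlonglongrightarrow> k x"
    proof -
      have "AE x in lebesgue. x \<notin> N"
        using N by (intro AE_not_in) (simp add: negligible_iff_null_sets)
      then have "AE x in lebesgue. (\<lambda>n. \<psi> n x) \<longlonglongrightarrow> k x" by eventually_elim (rule \<psi>k)
      then show ?thesis by (simp add: AE_completion_iff)
    qed
    have lim1: "(\<lambda>n. LINT x|lborel. h x * \<psi> n x) \<longlonglongrightarrow> (LINT x|lborel. h x * k x)"
    proof (rule integral_dominated_convergence[where w="\<lambda>x. cmod (h x * of_real (R * indicator (cball 0 (R + 1)) x))"])
      have "L2 (\<lambda>x::'a. complex_of_real (R * indicator (cball 0 (R + 1)) x))"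
        by (rule L2_of_bound_indicator(2)[where B=R and R="R + 1"]) (measurable, use R in \<open>auto simp: norm_mult\<close>)
      then show "integrable lborel (\<lambda>x. cmod (h x * of_real (R * indicator (cball 0 (R + 1)) x)))"
        by (intro integrable_norm L2_mult_integrable h)
      show "AE x in lborel. norm (h x * \<psi> n x) \<le> cmod (h x * of_real (R * indicator (cball 0 (R + 1)) x))" for n
        using \<psi>b R by (auto simp: norm_mult abs_mult intro!: mult_left_mono)
      show "AE x in lborel. (\<lambda>n. h x * \<psi> n x) \<longlonglongrightarrow> h x * k x"
        using AE by eventually_elim (rule tendsto_mult_left)
    qed measurable
    have "(\<lambda>n. LINT x|lborel. (cmod (\<psi> n x))\<^sup>2) \<longlonglongrightarrow> (LINT x|lborel. (cmod (k x))\<^sup>2)"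
    proof (rule integral_dominated_convergence[where w="\<lambda>x. R\<^sup>2 * indicator (cball 0 (R + 1)) x"])
      show "integrable lborel (\<lambda>x. R\<^sup>2 * indicator (cball (0::'a) (R + 1)) x)"
        by (intro integrable_mult_right integrable_indicator_cball)
      have "(cmod (\<psi> n x))\<^sup>2 \<le> R\<^sup>2 * indicator (cball 0 (R + 1)) x" for n x
        using power_mono[OF \<psi>b[of n x] norm_ge_zero, of 2]
        by (cases "x \<in> cball 0 (R + 1)") (auto simp: power_mult_distrib indicator_def)
      then show "AE x in lborel. norm ((cmod (\<psi> n x))\<^sup>2) \<le> R\<^sup>2 * indicator (cball 0 (R + 1)) x" for n by simp
      show "AE x in lborel. (\<lambda>n. (cmod (\<psi> n x))\<^sup>2) \<longlonglongrightarrow> (cmod (k x))\<^sup>2"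
        using AE by eventually_elim (intro tendsto_intros)
    qed measurable
    then have "(\<lambda>n. M * L2_norm (\<psi> n)) \<longlonglongrightarrow> M * L2_norm k"
      unfolding L2_norm_def by (intro tendsto_intros)
    from LIMSEQ_le[OF tendsto_norm[OF lim1] this] le[OF Cc]
    have *: "cmod (LINT x|lborel. h x * k x) \<le> M * L2_norm k" by auto
    \<comment> \<open>By the choice of \<open>k\<close> the left-hand side of \<open>*\<close> is
      the square of \<open>L2_norm k\<close>, so one factor can be cancelled.\<close>
    have "h x * k x = of_real ((cmod (k x))\<^sup>2)" for x
      by (auto simp: k_def indicator_def complex_norm_square simp del: of_real_power)
    then have "(LINT x|lborel. h x * k x) = of_real ((L2_norm k)\<^sup>2)"
      by (simp add: L2_norm_square del: of_real_power)
    with * have "L2_norm k * L2_norm k \<le> M * L2_norm k"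
      by (simp add: norm_power power2_eq_square norm_mult)
    then have "L2_norm k \<le> M"
      using M L2_norm_nonneg[of k] by (cases "L2_norm k = 0") auto
    moreover have "(cmod (h x))\<^sup>2 * indicator (S R) x = (cmod (k x))\<^sup>2" for x
      by (auto simp: k_def indicator_def)
    ultimately show ?thesis
      by (simp add: L2_nn_integral[OF k2] power_mono ennreal_leI)
  qed
  have "(\<integral>\<^sup>+x. ennreal ((cmod (h x))\<^sup>2) \<partial>lborel)
     = (\<integral>\<^sup>+x. liminf (\<lambda>n. ennreal ((cmod (h x))\<^sup>2 * indicator (S (real (Suc n))) x)) \<partial>lborel)"
  proof (intro nn_integral_cong lim_imp_Liminf[symmetric])
    fix x
    obtain n0 :: nat where n0: "max (norm x) (cmod (h x)) \<le> real n0" using real_arch_simple by blast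
    have "\<forall>\<^sub>F n in sequentially. ennreal ((cmod (h x))\<^sup>2 * indicator (S (real (Suc n))) x) = ennreal ((cmod (h x))\<^sup>2)"
      using eventually_ge_at_top[of n0] by eventually_elim (use n0 in \<open>auto simp: S_def indicator_def\<close>)
    then show "(\<lambda>n. ennreal ((cmod (h x))\<^sup>2 * indicator (S (real (Suc n))) x)) \<longlonglongrightarrow> ennreal ((cmod (h x))\<^sup>2)"
      by (rule tendsto_eventually)
  qed simp
  also have "\<dots> \<le> liminf (\<lambda>n. \<integral>\<^sup>+x. ennreal ((cmod (h x))\<^sup>2 * indicator (S (real (Suc n))) x) \<partial>lborel)"
    by (rule nn_integral_liminf) measurable
  also have "\<dots> \<le> liminf (\<lambda>n::nat. ennreal (M\<^sup>2))"
    by (intro Liminf_mono always_eventually allI le') simp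
  also have "\<dots> = ennreal (M\<^sup>2)" by (simp add: Liminf_const)
  finally show ?thesis using L2I_nn_integral(2)[OF hm M] by simp
qed

text \<open>Duality: against \<psi>, \<open>f\<close> pairs as \<open>g\<close> does against
  \<open>FT (- \<sigma>) \<psi>\<close>, whose norm \<open>L2_FT\<close> bounds by that of \<psi>.
  With \<open>\<sigma> = 1\<close> it bounds the weighted transform in
  \<open>bessel_potential\<close> by \<open>w\<close>.\<close>

lemma L2_extension_norm_le:
  assumes \<sigma>: "\<bar>\<sigma>\<bar> = 1" and ext: "L2_extension (FT \<sigma>) f g"
  shows "L2_norm f \<le> L2_norm g"
proof (rule L2_norm_le_of_pairing)
  show "L2 f" using ext by (simp add: L2_extension_def)
  have g: "L2 g" using ext by (simp add: L2_extension_def)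
  have \<sigma>': "\<bar>- \<sigma>\<bar> = 1" using \<sigma> by simp
  fix \<psi> :: "'a \<Rightarrow> complex" assume \<psi>: "Cc \<psi>"
  note F = L2_FT[OF \<sigma>' Cc_integrable[OF \<psi>] Cc_L2[OF \<psi>]]
  have "cmod (LINT x|lborel. f x * \<psi> x) \<le> L2_norm g * L2_norm (FT (- \<sigma>) \<psi>)"
    unfolding L2_extension_pairing[OF \<sigma> ext \<psi>] by (rule L2_Cauchy_Schwarz[OF g F(1)])
  also have "\<dots> \<le> L2_norm g * L2_norm \<psi>" by (intro mult_left_mono F) simp
  finally show "cmod (LINT x|lborel. f x * \<psi> x) \<le> L2_norm g * L2_norm \<psi>" .
qed simp

lemma continuous_nonneg_integral_zero:
  fixes p :: "'a::euclidean_space \<Rightarrow> real"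
  assumes p: "continuous_on UNIV p" "\<And>x. 0 \<le> p x" "integrable lborel p" and z: "(LINT x|lborel. p x) = 0"
  shows "p x = 0"
proof (rule ccontr)
  assume "p x \<noteq> 0"
  have "AE x in lborel. p x = 0"
    using integral_nonneg_eq_0_iff_AE[OF p(3)] p(2) z by simp
  then have "AE x in lborel. x \<notin> {x. p x \<noteq> 0}" by simp
  moreover have op: "open {x. p x \<noteq> 0}"
    using p(1) by (intro open_Collect_neq) auto
  ultimately have "{x. p x \<noteq> 0} \<in> null_sets lborel"
    by (subst AE_iff_null_sets) auto
  then have "negligible {x. p x \<noteq> 0}"
    by (simp add: negligible_iff_null_sets null_sets_completionI)
  then show False using open_not_negligible[OF op] \<open>p x \<noteq> 0\<close> by blast
qed

text \<open>Turns a relation known up to null sets into an identity at every point: the difference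
  \<open>d\<close> of the two sides is continuous, and testing with \<open>cnj d\<close> times a
  tent function around x gives a vanishing integral of a continuous nonnegative function that equals
  \<open>(cmod (d x))\<^sup>2\<close> at x.\<close>

lemma L2_extension_inversion:
  assumes \<sigma>: "\<bar>\<sigma>\<bar> = 1" and ext: "L2_extension (FT \<sigma>) f g"
    and g1: "integrable lborel g" and cont: "continuous_on UNIV f"
  shows "f x = FT (- \<sigma>) g x"
proof -
  define d where "d y = f y - FT (- \<sigma>) g y" for y
  define q :: "'a \<Rightarrow> real" where "q y = max 0 (1 - dist y x)" for y
  define \<psi> where "\<psi> y = cnj (d y) * of_real (q y)" for y
  have dc: "continuous_on UNIV d" unfolding d_def by (intro continuous_intros cont FT_continuous g1)
  have qc: "continuous_on UNIV q" unfolding q_def by (intro continuous_intros)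
  have \<psi>: "Cc \<psi>" unfolding Cc_def
  proof (intro conjI exI allI impI)
    show "continuous_on UNIV \<psi>" unfolding \<psi>_def by (intro continuous_intros dc qc)
    fix y :: 'a assume "norm x + 1 < norm y"
    then have "1 < dist y x" using norm_triangle_ineq2[of y x] by (simp add: dist_norm)
    then show "\<psi> y = 0" by (simp add: \<psi>_def q_def)
  qed
  note \<psi>1 = Cc_integrable[OF \<psi>] and \<psi>2 = Cc_L2[OF \<psi>]
  have f: "L2 f" using ext by (simp add: L2_extension_def)
  obtain R B where RB: "\<And>x. R < norm x \<Longrightarrow> \<psi> x = 0"
    "\<And>x. cmod (\<psi> x) \<le> B * indicator (cball 0 R) x" using CcE[OF \<psi>] by metis
  have i1: "integrable lborel (\<lambda>y. f y * \<psi> y)" by (rule L2_mult_integrable[OF f \<psi>2])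
  have i2: "integrable lborel (\<lambda>y. FT (- \<sigma>) g y * \<psi> y)"
  proof (rule Bochner_Integration.integrable_bound[OF integrable_mult_right[OF integrable_norm[OF \<psi>1]]])
    show "(\<lambda>y. FT (- \<sigma>) g y * \<psi> y) \<in> borel_measurable lborel"
      using FT_measurable[OF g1] Cc_measurable[OF \<psi>] by auto
    show "AE y in lborel. norm (FT (- \<sigma>) g y * \<psi> y) \<le> norm ((LINT x|lborel. cmod (g x)) * norm (\<psi> y))"
      using FT_norm_le[OF g1, of "- \<sigma>"] by (auto simp: norm_mult abs_mult intro!: mult_right_mono order_trans[OF _ abs_ge_self])
  qed
  have eq: "f y * \<psi> y - FT (- \<sigma>) g y * \<psi> y = of_real ((cmod (d y))\<^sup>2 * q y)" for y
  proof -
    have "f y * \<psi> y - FT (- \<sigma>) g y * \<psi> y = (d y * cnj (d y)) * of_real (q y)"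
      by (simp add: \<psi>_def d_def algebra_simps)
    then show ?thesis by (simp only: complex_norm_square[symmetric] of_real_mult)
  qed
  have "(LINT y|lborel. f y * \<psi> y) = (LINT y|lborel. g y * FT (- \<sigma>) \<psi> y)"
    by (rule L2_extension_pairing[OF \<sigma> ext \<psi>])
  also have "\<dots> = (LINT y|lborel. FT (- \<sigma>) g y * \<psi> y)"
    by (rule FT_swap[OF g1 \<psi>1, symmetric])
  finally have "(LINT y|lborel. complex_of_real ((cmod (d y))\<^sup>2 * q y)) = 0"
    unfolding eq[symmetric] using i1 i2 by simp
  then have "complex_of_real (LINT y|lborel. (cmod (d y))\<^sup>2 * q y) = 0"
    by (simp only: integral_complex_of_real)
  then have z: "(LINT y|lborel. (cmod (d y))\<^sup>2 * q y) = 0" by (simp only: of_real_eq_0_iff)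
  have "integrable lborel (\<lambda>y. complex_of_real ((cmod (d y))\<^sup>2 * q y))"
    unfolding eq[symmetric] using i1 i2 by simp
  then have i: "integrable lborel (\<lambda>y. (cmod (d y))\<^sup>2 * q y)" by (simp only: complex_of_real_integrable_eq)
  have "(cmod (d x))\<^sup>2 * q x = 0"
    by (rule continuous_nonneg_integral_zero[OF _ _ i z]) (auto intro!: continuous_intros dc qc simp: q_def)
  then show ?thesis by (simp add: q_def d_def)
qed

lemma L2_extension_diff:
  assumes "L2_extension (FT \<sigma>) f g" and "L2_extension (FT \<sigma>) f' g'"
  shows "L2_extension (FT \<sigma>) (\<lambda>x. f x - f' x) (\<lambda>x. g x - g' x)"
proof -
  from assms(1) obtain \<phi> where 1: "L2 f" "L2 g"
    "\<And>k. integrable lborel (\<phi> k)" "\<And>k. L2 (\<phi> k)" "\<And>k. L2 (FT \<sigma> (\<phi> k))"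
    "(\<lambda>k. L2_norm (\<lambda>x. \<phi> k x - f x)) \<longlonglongrightarrow> 0" "(\<lambda>k. L2_norm (\<lambda>\<xi>. FT \<sigma> (\<phi> k) \<xi> - g \<xi>)) \<longlonglongrightarrow> 0"
    unfolding L2_extension_def by auto
  from assms(2) obtain \<phi>' where 2: "L2 f'" "L2 g'"
    "\<And>k. integrable lborel (\<phi>' k)" "\<And>k. L2 (\<phi>' k)" "\<And>k. L2 (FT \<sigma> (\<phi>' k))"
    "(\<lambda>k. L2_norm (\<lambda>x. \<phi>' k x - f' x)) \<longlonglongrightarrow> 0" "(\<lambda>k. L2_norm (\<lambda>\<xi>. FT \<sigma> (\<phi>' k) \<xi> - g' \<xi>)) \<longlonglongrightarrow> 0"
    unfolding L2_extension_def by auto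
  have lim: "(\<lambda>k. L2_norm (\<lambda>x. (a k x - a' k x) - (b x - b' x))) \<longlonglongrightarrow> 0"
    if "\<And>k. L2 (a k)" "\<And>k. L2 (a' k)" "L2 b" "L2 b'"
      "(\<lambda>k. L2_norm (\<lambda>x. a k x - b x)) \<longlonglongrightarrow> 0" "(\<lambda>k. L2_norm (\<lambda>x. a' k x - b' x)) \<longlonglongrightarrow> 0"
    for a a' :: "nat \<Rightarrow> 'a \<Rightarrow> complex" and b b'
  proof (rule Lim_null_comparison)
    have "L2_norm (\<lambda>x. (a k x - a' k x) - (b x - b' x)) \<le> L2_norm (\<lambda>x. a k x - b x) + L2_norm (\<lambda>x. a' k x - b' x)" for k
      using L2_diff(2)[OF L2_diff(1)[OF that(1)[of k] that(3)] L2_diff(1)[OF that(2)[of k] that(4)]]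
      by (simp add: algebra_simps)
    then show "\<forall>\<^sub>F k in sequentially. norm (L2_norm (\<lambda>x. (a k x - a' k x) - (b x - b' x))) \<le> L2_norm (\<lambda>x. a k x - b x) + L2_norm (\<lambda>x. a' k x - b' x)"
      by simp
    show "(\<lambda>k. L2_norm (\<lambda>x. a k x - b x) + L2_norm (\<lambda>x. a' k x - b' x)) \<longlonglongrightarrow> 0"
      using tendsto_add[OF that(5,6)] by simp
  qed
  have FTd: "FT \<sigma> (\<lambda>x. \<phi> k x - \<phi>' k x) = (\<lambda>\<xi>. FT \<sigma> (\<phi> k) \<xi> - FT \<sigma> (\<phi>' k) \<xi>)" for k
    using FT_diff[OF 1(3) 2(3)] by auto
  show ?thesis
    unfolding L2_extension_def
  proof (intro conjI exI[of _ "\<lambda>k x. \<phi> k x - \<phi>' k x"] allI)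
    show "(\<lambda>k. L2_norm (\<lambda>x. \<phi> k x - \<phi>' k x - (f x - f' x))) \<longlonglongrightarrow> 0"
      by (rule lim) (use 1 2 in auto)
    show "(\<lambda>k. L2_norm (\<lambda>\<xi>. FT \<sigma> (\<lambda>x. \<phi> k x - \<phi>' k x) \<xi> - (g \<xi> - g' \<xi>))) \<longlonglongrightarrow> 0"
      unfolding FTd by (rule lim) (use 1 2 in auto)
    show "L2 (FT \<sigma> (\<lambda>x. \<phi> k x - \<phi>' k x))" for k
      unfolding FTd by (rule L2_diff(1)[OF 1(5) 2(5)])
  qed (use 1 2 in \<open>auto intro: L2_diff\<close>)
qed

text \<open>Exhibits an admissible choice for a difference, so that the \<open>SOME\<close> in its
  \<open>sobolev_norm\<close> selects a genuine potential.\<close>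

lemma bessel_potential_diff:
  assumes "bessel_potential s f w" "bessel_potential s f' w'"
  shows "bessel_potential s (\<lambda>x. f x - f' x) (\<lambda>x. w x - w' x)"
proof -
  from assms obtain g g' where g: "L2_extension fourier_integral f g"
      "L2_extension inv_fourier_integral (\<lambda>\<xi>. of_real ((1 + (norm \<xi>)\<^sup>2) powr (s / 2)) * g \<xi>) w"
    and g': "L2_extension fourier_integral f' g'"
      "L2_extension inv_fourier_integral (\<lambda>\<xi>. of_real ((1 + (norm \<xi>)\<^sup>2) powr (s / 2)) * g' \<xi>) w'"
    unfolding bessel_potential_def by blast
  show ?thesis
    unfolding bessel_potential_def
    using L2_extension_diff[OF g(1)[unfolded fourier_integral_eq_FT] g'(1)[unfolded fourier_integral_eq_FT]]
      L2_extension_diff[OF g(2)[unfolded inv_fourier_integral_eq_FT] g'(2)[unfolded inv_fourier_integral_eq_FT]]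
    unfolding fourier_integral_eq_FT inv_fourier_integral_eq_FT
    by (intro exI[of _ "\<lambda>\<xi>. g \<xi> - g' \<xi>"] conjI) (simp_all add: right_diff_distrib)
qed

section \<open>Sobolev regularity\<close>

text \<open>On the half line \<open>(1 + y)\<^sup>2 \<le> 2 * (1 + y\<^sup>2)\<close> gives a
  majorant with an explicit primitive; the other half follows by symmetry.\<close>

lemma one_plus_square_powr_integrable:
  fixes q :: real
  assumes q: "q > 1 / 2"
  shows "(\<integral>\<^sup>+y. ennreal ((1 + y\<^sup>2) powr (- q)) \<partial>lborel) < \<infinity>"
proof -
  let ?h = "\<lambda>y::real. ennreal ((1 + y\<^sup>2) powr (- q))"
  let ?f = "\<lambda>y::real. 2 powr q * (1 + y) powr (- (2 * q))"
  have "(\<integral>\<^sup>+y. ennreal (?f y) * indicator {0..} y \<partial>lborel)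
      = ennreal (0 - (- (2 powr q / (2 * q - 1)) * (1 + 0) powr (1 - 2 * q)))"
  proof (rule nn_integral_FTC_atLeast)
    show "DERIV (\<lambda>y. - (2 powr q / (2 * q - 1)) * (1 + y) powr (1 - 2 * q)) y :> ?f y" if "0 \<le> y" for y
    proof -
      have "(2 powr q / (2 * q - 1)) * (2 * q - 1) = 2 powr q" using q by simp
      moreover have "DERIV (\<lambda>y. - (2 powr q / (2 * q - 1)) * (1 + y) powr (1 - 2 * q)) y :> - (2 powr q / (2 * q - 1)) * ((1 - 2 * q) * (1 + y) powr (1 - 2 * q - 1))"
        using that q DERIV_cmult[OF DERIV_fun_powr[of "\<lambda>y. 1 + y" 1 y "1 - 2 * q"], of "- (2 powr q / (2 * q - 1))"]
        by (auto intro!: derivative_eq_intros)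
      moreover have "- (2 powr q / (2 * q - 1)) * ((1 - 2 * q) * (1 + y) powr (1 - 2 * q - 1)) = ((2 powr q / (2 * q - 1)) * (2 * q - 1)) * (1 + y) powr (- (2 * q))"
        by (simp only: minus_mult_left[symmetric] mult.assoc) (simp add: algebra_simps diff_divide_distrib)
      ultimately show ?thesis by simp
    qed
    have "((\<lambda>y::real. (1 + y) powr (1 - 2 * q)) \<longlongrightarrow> 0) at_top"
      by (rule tendsto_neg_powr) (use q in \<open>auto intro!: filterlim_tendsto_add_at_top filterlim_ident\<close>)
    then show "((\<lambda>y::real. - (2 powr q / (2 * q - 1)) * (1 + y) powr (1 - 2 * q)) \<longlongrightarrow> 0) at_top"
      by (rule tendsto_mult_right_zero)
  qed simp_all
  then have fin: "(\<integral>\<^sup>+y. ennreal (?f y) * indicator {0..} y \<partial>lborel) < \<infinity>" by simp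
  have le: "(1 + y\<^sup>2) powr (- q) \<le> ?f y" if "0 \<le> y" for y
  proof -
    have "(1 + y)\<^sup>2 / 2 \<le> 1 + y\<^sup>2"
      using zero_le_power2[of "1 - y"] by (simp add: power2_sum power2_diff)
    then have "(1 + y\<^sup>2) powr (- q) \<le> ((1 + y)\<^sup>2 / 2) powr (- q)"
      using q that by (intro powr_mono2') auto
    also have "\<dots> = ((1 + y) powr 2) powr (- q) / 2 powr (- q)"
      using that by (simp add: powr_divide)
    also have "\<dots> = ?f y"
      unfolding powr_powr by (simp add: powr_minus[of 2 q] divide_inverse mult.commute)
    finally show ?thesis .
  qed
  have half: "(\<integral>\<^sup>+y. ?h y * indicator {0..} y \<partial>lborel) < \<infinity>"
    by (rule order_le_less_trans[OF nn_integral_mono fin]) (auto simp: indicator_def le)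
  have "(\<integral>\<^sup>+y. ?h y * indicator {..0} y \<partial>lborel) = (\<integral>\<^sup>+y. ?h (- y) * indicator {..0} (- y) \<partial>lborel)"
    using lborel_nn_integral_affine[of "\<lambda>y. ?h y * indicator {..0} y" "-1" 0] by simp
  also have "\<dots> = (\<integral>\<^sup>+y. ?h y * indicator {0..} y \<partial>lborel)"
    by (intro nn_integral_cong) (simp add: indicator_def)
  finally have half': "(\<integral>\<^sup>+y. ?h y * indicator {..0} y \<partial>lborel) < \<infinity>" using half by simp
  have "(\<integral>\<^sup>+y. ?h y \<partial>lborel) \<le> (\<integral>\<^sup>+y. ?h y * indicator {0..} y + ?h y * indicator {..0} y \<partial>lborel)"
    by (intro nn_integral_mono) (auto simp: indicator_def)
  also have "\<dots> < \<infinity>"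
    by (subst nn_integral_add) (use half half' in auto)
  finally show ?thesis .
qed

lemma one_plus_norm_square_pos: "0 < 1 + (norm x)\<^sup>2"
  by (simp add: add_pos_nonneg)

text \<open>Replaces polar coordinates: the exponent is shared equally among the coordinates, and
  \<open>\<bar>\<xi> \<bullet> b\<bar> \<le> norm \<xi>\<close> bounds each share by a function of
  one coordinate. The share \<open>p / DIM('a)\<close> exceeds 1/2 exactly when
  \<open>p > DIM('a) / 2\<close>.\<close>

lemma integrable_weight:
  fixes p :: real
  assumes p: "p > real DIM('a::euclidean_space) / 2"
  shows "integrable lborel (\<lambda>\<xi>::'a. (1 + (norm \<xi>)\<^sup>2) powr (- p))"
proof (intro integrableI_nonneg)
  let ?N = "DIM('a)"
  let ?q = "p / real ?N"
  have q: "?q > 1 / 2" using p by (simp add: field_simps)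
  have le: "(1 + (norm \<xi>)\<^sup>2) powr (- p) \<le> (\<Prod>b\<in>Basis. (1 + (\<xi> \<bullet> b)\<^sup>2) powr (- ?q))" for \<xi> :: 'a
  proof -
    have "(1 + (norm \<xi>)\<^sup>2) powr (- p) = ((1 + (norm \<xi>)\<^sup>2) powr (- ?q)) powr real ?N"
      by (simp add: powr_powr)
    also have "\<dots> = (\<Prod>b\<in>(Basis::'a set). (1 + (norm \<xi>)\<^sup>2) powr (- ?q))"
      by (subst powr_realpow) (simp_all add: one_plus_norm_square_pos[THEN less_imp_neq, symmetric])
    also have "\<dots> \<le> (\<Prod>b\<in>Basis. (1 + (\<xi> \<bullet> b)\<^sup>2) powr (- ?q))"
    proof (intro prod_mono conjI powr_mono2')
      show "1 + (\<xi> \<bullet> b)\<^sup>2 \<le> 1 + (norm \<xi>)\<^sup>2" if "b \<in> Basis" for b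
        using Basis_le_norm[OF that, of \<xi>] by (simp add: abs_le_square_iff[symmetric])
    qed (use q in \<open>auto simp: add_pos_nonneg\<close>)
    finally show ?thesis .
  qed
  have "(\<integral>\<^sup>+\<xi>. ennreal ((1 + (norm (\<xi>::'a))\<^sup>2) powr (- p)) \<partial>lborel)
    \<le> (\<integral>\<^sup>+\<xi>. (\<Prod>b\<in>(Basis::'a set). ennreal ((1 + (\<xi> \<bullet> b)\<^sup>2) powr (- ?q))) \<partial>lborel)"
    by (intro nn_integral_mono) (simp add: prod_ennreal ennreal_leI le)
  also have "\<dots> = (\<Prod>b\<in>(Basis::'a set). (\<integral>\<^sup>+y. ennreal ((1 + y\<^sup>2) powr (- ?q)) \<partial>lborel))"
    by (rule nn_integral_lborel_prod) auto
  also have "\<dots> < \<infinity>"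
    using one_plus_square_powr_integrable[OF q] by (simp add: power_less_top_ennreal)
  finally show "(\<integral>\<^sup>+\<xi>. ennreal ((1 + (norm (\<xi>::'a))\<^sup>2) powr (- p)) \<partial>lborel) < \<infinity>" .
qed auto

section \<open>Sobolev weights and functions given by a Fourier integral\<close>

definition wt :: "real \<Rightarrow> 'a::euclidean_space \<Rightarrow> real" where
  "wt m \<xi> = (1 + (norm \<xi>)\<^sup>2) powr (m / 2)"

lemma wt_measurable [measurable]: "wt m \<in> borel_measurable borel"
  unfolding wt_def by measurable

lemma wt_nonneg [simp]: "0 \<le> wt m \<xi>"
  by (simp add: wt_def)

lemma wt_0 [simp]: "wt 0 \<xi> = 1"
  using one_plus_norm_square_pos[of \<xi>] by (auto simp: wt_def)

lemma wt_ge_1: "0 \<le> m \<Longrightarrow> 1 \<le> wt m \<xi>"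
  by (simp add: wt_def ge_one_powr_ge_zero)

lemma wt_mono: "m \<le> m' \<Longrightarrow> wt m \<xi> \<le> wt m' \<xi>"
  by (simp add: wt_def powr_mono)

lemma norm_powr_le_wt: "0 \<le> m \<Longrightarrow> norm \<xi> powr m \<le> wt m \<xi>"
proof -
  assume m: "0 \<le> m"
  have "norm \<xi> powr m = ((norm \<xi>)\<^sup>2) powr (m / 2)"
    by (cases "\<xi> = 0") (simp_all add: powr_powr flip: powr_numeral)
  also have "\<dots> \<le> wt m \<xi>" unfolding wt_def using m by (intro powr_mono2) auto
  finally show ?thesis .
qed

lemma norm_power_le_wt: "norm \<xi> ^ k \<le> wt (real k) \<xi>"
  using norm_powr_le_wt[of "real k" \<xi>] by (cases "\<xi> = 0"; cases "k = 0") (auto simp: powr_realpow wt_ge_1 power_0_left)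

text \<open>A workable form of "continuous, with H^s norm at most A": equality with the Fourier
  integral holds at every point, and \<open>A\<close> is a bound rather than the norm, so it can be
  enlarged, added and chosen uniformly in time.\<close>

definition Hs_rep :: "real \<Rightarrow> real \<Rightarrow> ('a::euclidean_space \<Rightarrow> complex) \<Rightarrow> ('a \<Rightarrow> complex) \<Rightarrow> bool" where
  "Hs_rep s A f g \<longleftrightarrow> g \<in> borel_measurable borel \<and> L2 (\<lambda>\<xi>. of_real (wt s \<xi>) * g \<xi>)
     \<and> L2_norm (\<lambda>\<xi>. of_real (wt s \<xi>) * g \<xi>) \<le> A \<and> f = FT 1 g"

text \<open>The Sobolev embedding on the Fourier side: Cauchy-Schwarz after writing
  \<open>wt m\<close> as \<open>wt (m - s)\<close> times \<open>wt s\<close>. The norm of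
  \<open>wt (m - s)\<close> is the embedding constant in all pointwise bounds below.\<close>

lemma wt_mult_integrable:
  fixes g :: "'a::euclidean_space \<Rightarrow> complex"
  assumes [measurable]: "g \<in> borel_measurable borel" and g: "L2 (\<lambda>\<xi>. of_real (wt s \<xi>) * g \<xi>)"
    and m: "s - m > real DIM('a) / 2"
  shows "integrable lborel (\<lambda>\<xi>. wt m \<xi> * cmod (g \<xi>))"
    and "(LINT \<xi>|lborel. wt m \<xi> * cmod (g \<xi>)) \<le> L2_norm (\<lambda>\<xi>::'a. of_real (wt (m - s) \<xi>)) * L2_norm (\<lambda>\<xi>. of_real (wt s \<xi>) * g \<xi>)"
proof -
  have "(wt (m - s) \<xi>)\<^sup>2 = (1 + (norm \<xi>)\<^sup>2) powr (- (s - m))" for \<xi> :: 'a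
    unfolding wt_def by (simp flip: powr_add add: power2_eq_square)
  then have 2: "L2 (\<lambda>\<xi>::'a. complex_of_real (wt (m - s) \<xi>))"
    unfolding L2_def using integrable_weight[OF m] by auto
  have eq: "wt m \<xi> * cmod (g \<xi>) = cmod (of_real (wt (m - s) \<xi>) * (of_real (wt s \<xi>) * g \<xi>))" for \<xi>
  proof -
    have "wt (m - s) \<xi> * wt s \<xi> = wt m \<xi>"
      unfolding wt_def by (simp flip: powr_add add: field_simps)
    then show ?thesis by (simp add: norm_mult mult.assoc[symmetric])
  qed
  show "integrable lborel (\<lambda>\<xi>. wt m \<xi> * cmod (g \<xi>))"
    unfolding eq by (intro integrable_norm L2_mult_integrable 2 g)
  show "(LINT \<xi>|lborel. wt m \<xi> * cmod (g \<xi>)) \<le> L2_norm (\<lambda>\<xi>::'a. of_real (wt (m - s) \<xi>)) * L2_norm (\<lambda>\<xi>. of_real (wt s \<xi>) * g \<xi>)"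
    unfolding eq by (rule L2_Cauchy_Schwarz_norm[OF 2 g])
qed

text \<open>The bound holds for every admissible \<open>w\<close>, in particular for the one that \<open>SOME\<close> selects in
  \<open>sobolev_norm\<close>.\<close>

lemma bessel_potential_imp_Hs_rep:
  fixes f :: "'a::euclidean_space \<Rightarrow> complex"
  assumes f: "continuous_on UNIV f" "bessel_potential s f w" and s: "s > real DIM('a) / 2"
  shows "\<exists>g. Hs_rep s (L2_norm w) f g"
proof -
  from f(2) obtain g where g: "L2_extension (FT (-1)) f g" "L2_extension (FT 1) (\<lambda>\<xi>. of_real (wt s \<xi>) * g \<xi>) w"
    unfolding bessel_potential_def fourier_integral_eq_FT inv_fourier_integral_eq_FT wt_def by blast
  have gm [measurable]: "g \<in> borel_measurable borel" using g(1) by (auto simp: L2_extension_def L2_def)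
  have L: "L2 (\<lambda>\<xi>. of_real (wt s \<xi>) * g \<xi>)" using g(2) by (simp add: L2_extension_def)
  have "integrable lborel (\<lambda>\<xi>. cmod (g \<xi>))"
    using wt_mult_integrable(1)[OF gm L, of 0] s by simp
  then have g1: "integrable lborel g" using gm by (simp add: integrable_norm_iff)
  \<comment> \<open>Continuity of \<open>f\<close> selects the representative for which inversion
    holds everywhere.\<close>
  have "f = FT 1 g" using L2_extension_inversion[OF _ g(1) g1 f(1)] by auto
  moreover have "L2_norm (\<lambda>\<xi>. of_real (wt s \<xi>) * g \<xi>) \<le> L2_norm w"
    by (rule L2_extension_norm_le[OF _ g(2)]) simp
  ultimately show ?thesis using L gm unfolding Hs_rep_def by blast
qed

lemma Hs_rep_add:
  fixes f f' :: "'a::euclidean_space \<Rightarrow> complex"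
  assumes "Hs_rep s A f g" "Hs_rep s A' f' g'" and s: "s > real DIM('a) / 2"
  shows "Hs_rep s (A + A') (\<lambda>x. f x + f' x) (\<lambda>\<xi>. g \<xi> + g' \<xi>)"
proof -
  have 1: "g \<in> borel_measurable borel" "L2 (\<lambda>\<xi>. of_real (wt s \<xi>) * g \<xi>)" "L2_norm (\<lambda>\<xi>. of_real (wt s \<xi>) * g \<xi>) \<le> A" "f = FT 1 g"
    and 2: "g' \<in> borel_measurable borel" "L2 (\<lambda>\<xi>. of_real (wt s \<xi>) * g' \<xi>)" "L2_norm (\<lambda>\<xi>. of_real (wt s \<xi>) * g' \<xi>) \<le> A'" "f' = FT 1 g'"
    using assms by (auto simp: Hs_rep_def)
  have "integrable lborel (\<lambda>\<xi>. cmod (g \<xi>))" "integrable lborel (\<lambda>\<xi>. cmod (g' \<xi>))"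
    using wt_mult_integrable(1)[OF 1(1,2), of 0] wt_mult_integrable(1)[OF 2(1,2), of 0] s by simp_all
  then have i: "integrable lborel g" "integrable lborel g'" using 1 2 by (simp_all add: integrable_norm_iff)
  show ?thesis unfolding Hs_rep_def
    using L2_add[OF 1(2) 2(2)] 1 2 FT_add[OF i] by (auto simp: ring_distribs)
qed

lemma FT_reflect: "f \<in> borel_measurable borel \<Longrightarrow> FT \<sigma> (\<lambda>\<xi>. f (- \<xi>)) x = FT \<sigma> f (- x)"
  unfolding FT_def using lborel_integral_uminus[of "\<lambda>\<xi>. cis (- (\<sigma> * (\<xi> \<bullet> x))) * f \<xi>"] by simp

lemma Hs_rep_reflect:
  assumes "Hs_rep s A f g"
  shows "Hs_rep s A (\<lambda>x. f (- x)) (\<lambda>\<xi>. g (- \<xi>))"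
proof -
  have g [measurable]: "g \<in> borel_measurable borel" and L: "L2 (\<lambda>\<xi>. of_real (wt s \<xi>) * g \<xi>)"
    and A: "L2_norm (\<lambda>\<xi>. of_real (wt s \<xi>) * g \<xi>) \<le> A" and f: "f = FT 1 g"
    using assms by (auto simp: Hs_rep_def)
  have m: "(\<lambda>\<xi>. (cmod (of_real (wt s \<xi>) * g \<xi>))\<^sup>2) \<in> borel_measurable borel" by measurable
  have w: "wt s (- \<xi>) = wt s \<xi>" for \<xi> :: 'a by (simp add: wt_def)
  have "integrable lborel (\<lambda>\<xi>. (cmod (of_real (wt s \<xi>) * g (- \<xi>)))\<^sup>2)"
    using lborel_integrable_affine[OF L2_integrable_square[OF L], of "-1" 0] by (simp add: w)
  then have "L2 (\<lambda>\<xi>. of_real (wt s \<xi>) * g (- \<xi>))" by (simp add: L2_def)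
  moreover have "L2_norm (\<lambda>\<xi>. of_real (wt s \<xi>) * g (- \<xi>)) = L2_norm (\<lambda>\<xi>. of_real (wt s \<xi>) * g \<xi>)"
    unfolding L2_norm_def using lborel_integral_uminus[OF m] by (simp add: w)
  ultimately show ?thesis using A g unfolding Hs_rep_def f by (auto simp: FT_reflect)
qed

section \<open>Differences and derivatives of Fourier integrals\<close>

lemma cmod_cis_minus_1: "cmod (cis y - 1) \<le> \<bar>y\<bar>"
  using iexp_approx1[of y 0] by (simp add: cis_conv_exp)

text \<open>Interpolates between the quadratic bound for small y and the constant bound 4 for large
  y. The fractional exponent is what later yields the order \<open>1 + \<beta>\<close>.\<close>

lemma cmod_cis_minus_1_square:
  assumes "0 \<le> \<gamma>" "\<gamma> \<le> 2"
  shows "(cmod (cis y - 1))\<^sup>2 \<le> 4 * \<bar>y\<bar> powr \<gamma>"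
proof (cases "\<bar>y\<bar> \<le> 1")
  case True
  have "(cmod (cis y - 1))\<^sup>2 \<le> \<bar>y\<bar>\<^sup>2" by (intro power_mono cmod_cis_minus_1) auto
  also have "\<dots> \<le> 4 * \<bar>y\<bar> powr \<gamma>"
  proof (cases "y = 0")
    case False
    then have "\<bar>y\<bar>\<^sup>2 = \<bar>y\<bar> powr 2" by simp
    also have "\<dots> \<le> \<bar>y\<bar> powr \<gamma>" using True assms False by (intro powr_mono') auto
    also have "\<dots> \<le> 4 * \<bar>y\<bar> powr \<gamma>" by simp
    finally show ?thesis .
  qed simp
  finally show ?thesis .
next
  case False
  have "cmod (cis y - 1) \<le> 2" using norm_triangle_ineq4[of "cis y" 1] by simp
  then have "(cmod (cis y - 1))\<^sup>2 \<le> 2\<^sup>2" by (intro power_mono) auto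
  also have "\<dots> \<le> 4 * \<bar>y\<bar> powr \<gamma>" using False assms by (simp add: ge_one_powr_ge_zero)
  finally show ?thesis .
qed

lemma cmod_cis_taylor: "cmod (cis y - 1 - \<i> * of_real y) \<le> y\<^sup>2 / 2"
  using iexp_approx1[of y 1] by (simp add: cis_conv_exp power2_eq_square field_simps)

lemma FT_first_difference:
  assumes G: "integrable lborel G" and G1: "integrable lborel (\<lambda>\<xi>. norm \<xi> * cmod (G \<xi>))"
  shows "cmod (FT 1 G (x + v) - FT 1 G x) \<le> norm v * (LINT \<xi>|lborel. norm \<xi> * cmod (G \<xi>))"
proof -
  have "FT 1 G (x + v) - FT 1 G x = FT 1 (\<lambda>\<xi>. (cis (\<xi> \<bullet> v) - 1) * G \<xi>) x"
  proof -
    note i = integrable_cis_mult[OF G, of 1, simplified]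
    have "(LINT \<xi>|lborel. cis (\<xi> \<bullet> x) * ((cis (\<xi> \<bullet> v) - 1) * G \<xi>))
      = (LINT \<xi>|lborel. cis (\<xi> \<bullet> (x + v)) * G \<xi> - cis (\<xi> \<bullet> x) * G \<xi>)"
      by (intro Bochner_Integration.integral_cong refl)
        (simp only: inner_add_right cis_mult[symmetric], simp add: algebra_simps)
    also have "\<dots> = (LINT \<xi>|lborel. cis (\<xi> \<bullet> (x + v)) * G \<xi>) - (LINT \<xi>|lborel. cis (\<xi> \<bullet> x) * G \<xi>)"
      by (rule Bochner_Integration.integral_diff[OF i i])
    finally show ?thesis unfolding FT_def mult_1 by (simp only: right_diff_distrib)
  qed
  also have "cmod \<dots> \<le> (LINT \<xi>|lborel. cmod ((cis (\<xi> \<bullet> v) - 1) * G \<xi>))"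
    using integrable_cis_mult[OF G, of 1 v] G by (intro FT_norm_le) (simp add: left_diff_distrib)
  also have "\<dots> \<le> (LINT \<xi>|lborel. norm v * (norm \<xi> * cmod (G \<xi>)))"
  proof (rule integral_mono)
    show "integrable lborel (\<lambda>\<xi>. cmod ((cis (\<xi> \<bullet> v) - 1) * G \<xi>))"
      using integrable_cis_mult[OF G, of 1 v] G by (intro integrable_norm) (simp add: left_diff_distrib)
    show "cmod ((cis (\<xi> \<bullet> v) - 1) * G \<xi>) \<le> norm v * (norm \<xi> * cmod (G \<xi>))" for \<xi>
    proof -
      have "cmod (cis (\<xi> \<bullet> v) - 1) \<le> norm v * norm \<xi>"
        using cmod_cis_minus_1[of "\<xi> \<bullet> v"] Cauchy_Schwarz_ineq2[of \<xi> v] by (simp add: mult.commute)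
      then show ?thesis by (simp add: norm_mult mult_right_mono flip: mult.assoc)
    qed
  qed (use G1 in simp)
  finally show ?thesis by simp
qed

text \<open>The second difference with step v is the Fourier multiplier
  \<open>(cis (\<xi> \<bullet> v) - 1)\<^sup>2\<close>. One formula thus covers every order between
  0 and 2, and Hoelder norms never have to be introduced.\<close>

lemma FT_second_difference:
  assumes G: "integrable lborel G" and G1: "integrable lborel (\<lambda>\<xi>. norm \<xi> powr \<gamma> * cmod (G \<xi>))"
    and \<gamma>: "0 \<le> \<gamma>" "\<gamma> \<le> 2"
  shows "cmod (FT 1 G (x + 2 *\<^sub>R v) - 2 * FT 1 G (x + v) + FT 1 G x)
    \<le> 4 * norm v powr \<gamma> * (LINT \<xi>|lborel. norm \<xi> powr \<gamma> * cmod (G \<xi>))"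
proof -
  note i = integrable_cis_mult[OF G, of 1, simplified]
  let ?H = "\<lambda>\<xi>. (cis (\<xi> \<bullet> v) - 1)\<^sup>2 * G \<xi>"
  have dbl: "cis (\<xi> \<bullet> (2 *\<^sub>R v)) = cis (\<xi> \<bullet> v) * cis (\<xi> \<bullet> v)" for \<xi>
    by (simp add: cis_mult)
  have sq: "?H = (\<lambda>\<xi>. cis (\<xi> \<bullet> (2 *\<^sub>R v)) * G \<xi> - 2 * (cis (\<xi> \<bullet> v) * G \<xi>) + G \<xi>)"
    unfolding dbl by (auto simp: power2_eq_square algebra_simps)
  have H: "integrable lborel ?H"
    unfolding sq using i[of "2 *\<^sub>R v"] i[of v] G by simp
  have "FT 1 G (x + 2 *\<^sub>R v) - 2 * FT 1 G (x + v) + FT 1 G x = FT 1 ?H x"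
  proof -
    have "(LINT \<xi>|lborel. cis (\<xi> \<bullet> x) * ?H \<xi>)
      = (LINT \<xi>|lborel. cis (\<xi> \<bullet> (x + 2 *\<^sub>R v)) * G \<xi> - 2 * (cis (\<xi> \<bullet> (x + v)) * G \<xi>) + cis (\<xi> \<bullet> x) * G \<xi>)"
      by (intro Bochner_Integration.integral_cong refl)
        (simp only: inner_add_right cis_mult[symmetric] dbl, simp add: power2_eq_square algebra_simps)
    also have "\<dots> = (LINT \<xi>|lborel. cis (\<xi> \<bullet> (x + 2 *\<^sub>R v)) * G \<xi>) - 2 * (LINT \<xi>|lborel. cis (\<xi> \<bullet> (x + v)) * G \<xi>) + (LINT \<xi>|lborel. cis (\<xi> \<bullet> x) * G \<xi>)"
      using i[of "x + 2 *\<^sub>R v"] i[of "x + v"] i[of x] by simp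
    finally have eq: "(LINT \<xi>|lborel. cis (\<xi> \<bullet> x) * ?H \<xi>) = \<dots>" .
    have "c * I1 - 2 * (c * I2) + c * I3 = c * (I1 - 2 * I2 + I3)" for c I1 I2 I3 :: complex
      by (simp add: algebra_simps)
    then show ?thesis unfolding FT_def mult_1 eq .
  qed
  also have "cmod \<dots> \<le> (LINT \<xi>|lborel. cmod (?H \<xi>))" by (rule FT_norm_le[OF H])
  also have "\<dots> \<le> (LINT \<xi>|lborel. 4 * norm v powr \<gamma> * (norm \<xi> powr \<gamma> * cmod (G \<xi>)))"
  proof (rule integral_mono[OF integrable_norm[OF H] integrable_mult_right[OF G1]])
    fix \<xi> :: 'a
    have "(cmod (cis (\<xi> \<bullet> v) - 1))\<^sup>2 \<le> 4 * \<bar>\<xi> \<bullet> v\<bar> powr \<gamma>" by (rule cmod_cis_minus_1_square[OF \<gamma>])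
    also have "\<dots> \<le> 4 * (norm v * norm \<xi>) powr \<gamma>"
      using Cauchy_Schwarz_ineq2[of \<xi> v] \<gamma> by (intro mult_left_mono powr_mono2) (auto simp: mult.commute)
    also have "\<dots> = 4 * norm v powr \<gamma> * norm \<xi> powr \<gamma>" by (simp add: powr_mult)
    finally show "cmod (?H \<xi>) \<le> 4 * norm v powr \<gamma> * (norm \<xi> powr \<gamma> * cmod (G \<xi>))"
      by (simp add: norm_mult norm_power mult_right_mono flip: mult.assoc)
  qed
  finally show ?thesis by simp
qed

lemma has_vector_derivative_quadratic:
  fixes F :: "real \<Rightarrow> complex"
  assumes "\<And>h. cmod (F h - F 0 - of_real h * D) \<le> K * h\<^sup>2"
  shows "(F has_vector_derivative D) (at 0)"
  unfolding has_vector_derivative_def has_derivative_at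
proof
  show "bounded_linear (\<lambda>h. h *\<^sub>R D)" by (rule bounded_linear_scaleR_left)
  show "(\<lambda>h. norm (F (0 + h) - F 0 - h *\<^sub>R D) / norm h) \<midarrow>0\<rightarrow> 0"
  proof (rule Lim_null_comparison)
    have "norm (norm (F (0 + h) - F 0 - h *\<^sub>R D) / norm h) \<le> K * \<bar>h\<bar>" for h
    proof (cases "h = 0")
      case False
      have "norm (F h - F 0 - h *\<^sub>R D) \<le> K * \<bar>h\<bar> * \<bar>h\<bar>"
        using assms[of h] by (simp add: scaleR_conv_of_real power2_eq_square mult.assoc)
      then show ?thesis using False by (simp add: divide_le_eq)
    qed simp
    then show "\<forall>\<^sub>F h in at 0. norm (norm (F (0 + h) - F 0 - h *\<^sub>R D) / norm h) \<le> K * \<bar>h\<bar>" by simp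
    show "(\<lambda>h. K * \<bar>h\<bar>) \<midarrow>0\<rightarrow> 0" by (rule tendsto_eq_intros refl)+ simp
  qed
qed

text \<open>The Taylor remainder of \<open>cis\<close> is integrated, which gives a quadratic error
  bound. The price is a second moment of \<open>G\<close>; differentiating f twice in this way uses
  a third moment of its transform, which \<open>s > 3 + DIM('a) / 2\<close> provides.\<close>

lemma FT_has_vector_derivative:
  assumes G: "integrable lborel G" and G1: "integrable lborel (\<lambda>\<xi>. of_real (\<xi> \<bullet> b) * G \<xi>)"
    and G2: "integrable lborel (\<lambda>\<xi>. (norm \<xi>)\<^sup>2 * cmod (G \<xi>))"
  shows "((\<lambda>h. FT 1 G (x + h *\<^sub>R b)) has_vector_derivative FT 1 (\<lambda>\<xi>. \<i> * of_real (\<xi> \<bullet> b) * G \<xi>) x) (at 0)"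
proof (rule has_vector_derivative_quadratic)
  fix h :: real
  note i = integrable_cis_mult[OF G, of 1, simplified]
  let ?H = "\<lambda>\<xi>. (cis (\<xi> \<bullet> (h *\<^sub>R b)) - 1 - \<i> * of_real (\<xi> \<bullet> (h *\<^sub>R b))) * G \<xi>"
  have sq: "?H = (\<lambda>\<xi>. cis (\<xi> \<bullet> (h *\<^sub>R b)) * G \<xi> - G \<xi> - (\<i> * of_real h) * (of_real (\<xi> \<bullet> b) * G \<xi>))"
    by (auto simp: algebra_simps)
  have H: "integrable lborel ?H"
    unfolding sq by (intro Bochner_Integration.integrable_diff integrable_mult_right i G G1)
  have i2: "integrable lborel (\<lambda>\<xi>. cis (\<xi> \<bullet> x) * (\<i> * of_real (\<xi> \<bullet> b) * G \<xi>))"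
    using integrable_mult_right[OF integrable_cis_mult[OF G1, of 1 x], of \<i>] by (simp add: mult_ac)
  have "FT 1 G (x + h *\<^sub>R b) - FT 1 G (x + 0 *\<^sub>R b) - of_real h * FT 1 (\<lambda>\<xi>. \<i> * of_real (\<xi> \<bullet> b) * G \<xi>) x = FT 1 ?H x"
  proof -
    have "(LINT \<xi>|lborel. cis (\<xi> \<bullet> x) * ?H \<xi>)
      = (LINT \<xi>|lborel. cis (\<xi> \<bullet> (x + h *\<^sub>R b)) * G \<xi> - cis (\<xi> \<bullet> x) * G \<xi> - of_real h * (cis (\<xi> \<bullet> x) * (\<i> * of_real (\<xi> \<bullet> b) * G \<xi>)))"
      by (intro Bochner_Integration.integral_cong refl)
        (simp add: inner_add_right cis_mult[symmetric] algebra_simps)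
    also have "\<dots> = (LINT \<xi>|lborel. cis (\<xi> \<bullet> (x + h *\<^sub>R b)) * G \<xi>) - (LINT \<xi>|lborel. cis (\<xi> \<bullet> x) * G \<xi>) - of_real h * (LINT \<xi>|lborel. cis (\<xi> \<bullet> x) * (\<i> * of_real (\<xi> \<bullet> b) * G \<xi>))"
      using i[of "x + h *\<^sub>R b"] i[of x] i2 by (simp only: Bochner_Integration.integral_diff Bochner_Integration.integrable_diff integrable_mult_right integral_mult_right_zero)
    finally have eq: "(LINT \<xi>|lborel. cis (\<xi> \<bullet> x) * ?H \<xi>) = \<dots>" .
    have "c * I1 - c * I2 - h' * (c * I3) = c * (I1 - I2 - h' * I3)" for c I1 I2 I3 h' :: complex
      by (simp add: algebra_simps)
    then show ?thesis unfolding FT_def mult_1 scaleR_zero_left add_0_right eq .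
  qed
  moreover have "cmod (FT 1 ?H x) \<le> (LINT \<xi>|lborel. cmod (?H \<xi>))" by (rule FT_norm_le[OF H])
  moreover have "(LINT \<xi>|lborel. cmod (?H \<xi>)) \<le> (LINT \<xi>|lborel. (h\<^sup>2 * (norm b)\<^sup>2 / 2) * ((norm \<xi>)\<^sup>2 * cmod (G \<xi>)))"
  proof (rule integral_mono[OF integrable_norm[OF H] integrable_mult_right[OF G2]])
    fix \<xi> :: 'a
    have "cmod (cis (\<xi> \<bullet> (h *\<^sub>R b)) - 1 - \<i> * of_real (\<xi> \<bullet> (h *\<^sub>R b))) \<le> (\<xi> \<bullet> (h *\<^sub>R b))\<^sup>2 / 2"
      by (rule cmod_cis_taylor)
    also have "\<dots> \<le> (norm \<xi> * norm (h *\<^sub>R b))\<^sup>2 / 2"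
      using power_mono[OF Cauchy_Schwarz_ineq2[of \<xi> "h *\<^sub>R b"], of 2] by simp
    also have "\<dots> = (h\<^sup>2 * (norm b)\<^sup>2 / 2) * (norm \<xi>)\<^sup>2" by (simp add: power_mult_distrib)
    finally show "cmod (?H \<xi>) \<le> (h\<^sup>2 * (norm b)\<^sup>2 / 2) * ((norm \<xi>)\<^sup>2 * cmod (G \<xi>))"
      unfolding norm_mult by (subst mult.assoc[symmetric]) (rule mult_right_mono, auto)
  qed
  ultimately show "cmod (FT 1 G (x + h *\<^sub>R b) - FT 1 G (x + 0 *\<^sub>R b) - of_real h * FT 1 (\<lambda>\<xi>. \<i> * of_real (\<xi> \<bullet> b) * G \<xi>) x)
    \<le> (norm b)\<^sup>2 / 2 * (LINT \<xi>|lborel. (norm \<xi>)\<^sup>2 * cmod (G \<xi>)) * h\<^sup>2"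
    unfolding integral_mult_right_zero by (simp add: mult.commute mult.left_commute del: inner_scaleR_right scaleR_zero_left)
qed

section \<open>Regularity of a single time slice\<close>

locale Hs_function =
  fixes s A :: real and f g :: "'a::euclidean_space \<Rightarrow> complex"
  assumes rep: "Hs_rep s A f g" and s3: "s > 3 + real DIM('a) / 2"
begin

lemma g_measurable [measurable]: "g \<in> borel_measurable borel"
  and wg: "L2 (\<lambda>\<xi>. of_real (wt s \<xi>) * g \<xi>)" "L2_norm (\<lambda>\<xi>. of_real (wt s \<xi>) * g \<xi>) \<le> A" and f_eq: "f = FT 1 g"
  using rep by (auto simp: Hs_rep_def)

lemma A_nonneg: "0 \<le> A"
  using wg(2) L2_norm_nonneg order_trans by blast

text \<open>Every pointwise estimate of the locale passes through this: a multiplier of order m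
  costs a constant depending on m and s, times \<open>A\<close>. The bounds are therefore uniform
  over all times sharing the same \<open>A\<close>.\<close>

lemma weighted:
  fixes H :: "'a \<Rightarrow> complex"
  assumes [measurable]: "H \<in> borel_measurable borel" and le: "\<And>\<xi>. cmod (H \<xi>) \<le> wt m \<xi> * cmod (g \<xi>)"
    and m: "s - m > real DIM('a) / 2"
  shows "integrable lborel H" and "(LINT \<xi>|lborel. cmod (H \<xi>)) \<le> L2_norm (\<lambda>\<xi>::'a. of_real (wt (m - s) \<xi>)) * A"
proof -
  note w = wt_mult_integrable[OF g_measurable wg(1) m]
  show i: "integrable lborel H"
    by (rule Bochner_Integration.integrable_bound[OF w(1)]) (use le in \<open>auto simp: abs_mult\<close>)
  have "(LINT \<xi>|lborel. cmod (H \<xi>)) \<le> (LINT \<xi>|lborel. wt m \<xi> * cmod (g \<xi>))"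
    by (rule integral_mono[OF integrable_norm[OF i] w(1) le])
  also have "\<dots> \<le> L2_norm (\<lambda>\<xi>::'a. of_real (wt (m - s) \<xi>)) * A"
    using w(2) mult_left_mono[OF wg(2), of "L2_norm (\<lambda>\<xi>::'a. of_real (wt (m - s) \<xi>))"] by simp
  finally show "(LINT \<xi>|lborel. cmod (H \<xi>)) \<le> L2_norm (\<lambda>\<xi>::'a. of_real (wt (m - s) \<xi>)) * A" .
qed

text \<open>\<open>wt 1 \<le> wt s\<close> and \<open>L2_FT\<close> give the bound \<open>A\<close>
  without a constant. Order one covers \<open>f\<close> and its first partial derivatives, the
  functions whose L2 norms enter the energy estimate.\<close>

lemma L2_weighted:
  fixes H :: "'a \<Rightarrow> complex"
  assumes [measurable]: "H \<in> borel_measurable borel" and le: "\<And>\<xi>. cmod (H \<xi>) \<le> wt 1 \<xi> * cmod (g \<xi>)"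
  shows "L2 (FT 1 H)" and "L2_norm (FT 1 H) \<le> A"
proof -
  have i: "integrable lborel H" by (rule weighted(1)[OF _ le]) (use s3 in auto)
  have "cmod (H \<xi>) \<le> 1 * cmod (of_real (wt s \<xi>) * g \<xi>)" for \<xi>
    using le[of \<xi>] mult_right_mono[OF wt_mono[of 1 s \<xi>], of "cmod (g \<xi>)"] s3 by (simp add: norm_mult)
  note H = L2_bound[OF wg(1) assms(1) _ this]
  show "L2 (FT 1 H)" "L2_norm (FT 1 H) \<le> A"
    using L2_FT[OF _ i H(1), of 1] H(2) wg(2) by (simp, simp)
qed

definition d1 :: "'a \<Rightarrow> 'a \<Rightarrow> complex" where "d1 b \<xi> = \<i> * of_real (\<xi> \<bullet> b) * g \<xi>"
definition d2 :: "'a \<Rightarrow> 'a \<Rightarrow> complex" where "d2 b \<xi> = \<i> * of_real (\<xi> \<bullet> b) * d1 b \<xi>"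

lemma d_measurable [measurable]: "d1 b \<in> borel_measurable borel" "d2 b \<in> borel_measurable borel"
  unfolding d1_def d2_def by measurable

lemma norm_power_wt:
  assumes "0 \<le> c" "c \<le> norm \<xi> ^ k" "real k \<le> m"
  shows "c \<le> wt m \<xi>"
  using assms norm_power_le_wt[of \<xi> k] wt_mono[of "real k" m \<xi>] by linarith

lemma d1_le: "b \<in> Basis \<Longrightarrow> cmod (d1 b \<xi>) \<le> norm \<xi> * cmod (g \<xi>)"
  by (simp add: d1_def norm_mult mult_right_mono Basis_le_norm)

lemma d2_le: "b \<in> Basis \<Longrightarrow> cmod (d2 b \<xi>) \<le> norm \<xi> ^ 2 * cmod (g \<xi>)"
  using mult_mono[OF Basis_le_norm[of b \<xi>] d1_le[of b \<xi>]]
  by (simp add: d2_def norm_mult power2_eq_square mult.assoc)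

lemma d1_wt: "b \<in> Basis \<Longrightarrow> cmod (d1 b \<xi>) \<le> wt 1 \<xi> * cmod (g \<xi>)"
  by (rule order_trans[OF d1_le]) (auto intro!: mult_right_mono norm_power_wt[of _ _ 1])

lemma d2_wt: "b \<in> Basis \<Longrightarrow> cmod (d2 b \<xi>) \<le> wt 2 \<xi> * cmod (g \<xi>)"
  by (rule order_trans[OF d2_le]) (auto intro!: mult_right_mono norm_power_wt[of _ _ 2])

lemma integrable_g: "integrable lborel g"
  and integrable_g2: "integrable lborel (\<lambda>\<xi>. (norm \<xi>)\<^sup>2 * cmod (g \<xi>))"
proof -
  show "integrable lborel g" by (rule weighted(1)[of _ 0]) (use s3 in auto)
  have "integrable lborel (\<lambda>\<xi>. of_real ((norm \<xi>)\<^sup>2) * g \<xi>)"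
    by (rule weighted(1)[of _ 2])
      (use s3 in \<open>auto simp: norm_mult norm_power intro!: mult_right_mono norm_power_wt[of _ _ 2]\<close>)
  from integrable_norm[OF this] show "integrable lborel (\<lambda>\<xi>. (norm \<xi>)\<^sup>2 * cmod (g \<xi>))"
    by (simp add: norm_mult norm_power)
qed

lemma integrable_d:
  assumes b: "b \<in> Basis"
  shows "integrable lborel (d1 b)" "integrable lborel (d2 b)"
    "integrable lborel (\<lambda>\<xi>. (norm \<xi>)\<^sup>2 * cmod (d1 b \<xi>))"
proof -
  show "integrable lborel (d1 b)"
    by (rule weighted(1)[of _ 1]) (use s3 in \<open>auto intro: d1_wt[OF b]\<close>)
  show "integrable lborel (d2 b)"
    by (rule weighted(1)[of _ 2]) (use s3 in \<open>auto intro: d2_wt[OF b]\<close>)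
  have "integrable lborel (\<lambda>\<xi>. of_real ((norm \<xi>)\<^sup>2) * d1 b \<xi>)"
  proof (rule weighted(1)[of _ 3])
    fix \<xi>
    have "cmod (of_real ((norm \<xi>)\<^sup>2) * d1 b \<xi>) \<le> (norm \<xi>)\<^sup>2 * (norm \<xi> * cmod (g \<xi>))"
      using mult_left_mono[OF d1_le[OF b, of \<xi>], of "(norm \<xi>)\<^sup>2"] by (simp add: norm_mult norm_power)
    also have "\<dots> = norm \<xi> ^ 3 * cmod (g \<xi>)" by (simp add: power2_eq_square power3_eq_cube)
    also have "\<dots> \<le> wt 3 \<xi> * cmod (g \<xi>)" by (intro mult_right_mono norm_power_wt[of _ _ 3]) auto
    finally show "cmod (of_real ((norm \<xi>)\<^sup>2) * d1 b \<xi>) \<le> wt 3 \<xi> * cmod (g \<xi>)" .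
  qed (use s3 in auto)
  from integrable_norm[OF this] show "integrable lborel (\<lambda>\<xi>. (norm \<xi>)\<^sup>2 * cmod (d1 b \<xi>))"
    by (simp add: norm_mult norm_power)
qed

lemma deriv1:
  assumes b: "b \<in> Basis"
  shows "((\<lambda>h. f (x + h *\<^sub>R b)) has_vector_derivative FT 1 (d1 b) x) (at 0)"
proof -
  have "integrable lborel (\<lambda>\<xi>. of_real (\<xi> \<bullet> b) * g \<xi>)"
    using integrable_mult_right[OF integrable_d(1)[OF b], of "- \<i>"] by (simp add: d1_def flip: mult.assoc)
  from FT_has_vector_derivative[OF integrable_g this integrable_g2] show ?thesis
    by (simp add: f_eq d1_def[abs_def])
qed

lemma deriv2:
  assumes b: "b \<in> Basis"
  shows "((\<lambda>h. FT 1 (d1 b) (x + h *\<^sub>R b)) has_vector_derivative FT 1 (d2 b) x) (at 0)"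
proof -
  have "integrable lborel (\<lambda>\<xi>. of_real (\<xi> \<bullet> b) * d1 b \<xi>)"
    using integrable_mult_right[OF integrable_d(2)[OF b], of "- \<i>"] by (simp add: d2_def flip: mult.assoc)
  from FT_has_vector_derivative[OF integrable_d(1)[OF b] this integrable_d(3)[OF b]] show ?thesis
    by (simp add: d2_def[abs_def])
qed

lemma partial_f: "b \<in> Basis \<Longrightarrow> partial b f = FT 1 (d1 b)"
  unfolding partial_def using vector_derivative_at[OF deriv1] by auto

lemma partial2_f: "b \<in> Basis \<Longrightarrow> partial b (partial b f) = FT 1 (d2 b)"
  unfolding partial_f unfolding partial_def using vector_derivative_at[OF deriv2] by auto

lemma laplacian_f: "laplacian f x = FT 1 (\<lambda>\<xi>. - (of_real ((norm \<xi>)\<^sup>2) * g \<xi>)) x"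
proof -
  have n: "(norm \<xi>)\<^sup>2 = (\<Sum>b\<in>Basis. (\<xi> \<bullet> b)\<^sup>2)" for \<xi> :: 'a
    unfolding power2_norm_eq_inner by (subst euclidean_inner) (simp add: power2_eq_square)
  have eq: "(\<Sum>b\<in>Basis. d2 b \<xi>) = - (of_real ((norm \<xi>)\<^sup>2) * g \<xi>)" for \<xi>
  proof -
    have "d2 b \<xi> = - (of_real ((\<xi> \<bullet> b)\<^sup>2) * g \<xi>)" for b
      by (simp add: d2_def d1_def power2_eq_square algebra_simps)
    then show ?thesis by (simp add: n sum_negf sum_distrib_right)
  qed
  have "laplacian f x = (\<Sum>b\<in>Basis. FT 1 (d2 b) x)"
    unfolding laplacian_def by (intro sum.cong refl) (simp add: partial2_f)
  also have "\<dots> = FT 1 (\<lambda>\<xi>. \<Sum>b\<in>Basis. d2 b \<xi>) x"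
    unfolding FT_def sum_distrib_left[symmetric]
    by (subst Bochner_Integration.integral_sum[symmetric]) (auto simp: sum_distrib_left intro!: integrable_cis_mult[of _ 1, simplified] integrable_d)
  finally show ?thesis by (simp add: eq)
qed

lemma f_L2: "L2 f" "L2_norm f \<le> A"
  and f_bound: "cmod (f x) \<le> L2_norm (\<lambda>\<xi>::'a. of_real (wt (0 - s) \<xi>)) * A"
  and f_continuous: "continuous_on UNIV f"
proof -
  have "cmod (g \<xi>) \<le> wt 1 \<xi> * cmod (g \<xi>)" for \<xi>
    using mult_right_mono[OF wt_ge_1[of 1 \<xi>], of "cmod (g \<xi>)"] by simp
  from L2_weighted[OF _ this] show "L2 f" "L2_norm f \<le> A" by (auto simp: f_eq)
  show "cmod (f x) \<le> L2_norm (\<lambda>\<xi>::'a. of_real (wt (0 - s) \<xi>)) * A"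
    unfolding f_eq by (rule order_trans[OF FT_norm_le[OF integrable_g] weighted(2)]) (use s3 in auto)
  show "continuous_on UNIV f" unfolding f_eq by (rule FT_continuous[OF integrable_g])
qed

lemma partial_props:
  assumes b: "b \<in> Basis"
  shows "L2 (partial b f)" "L2_norm (partial b f) \<le> A" "continuous_on UNIV (partial b f)"
    "cmod (partial b f x) \<le> L2_norm (\<lambda>\<xi>::'a. of_real (wt (1 - s) \<xi>)) * A"
    "continuous_on UNIV (partial b (partial b f))"
    "cmod (partial b (partial b f) x) \<le> L2_norm (\<lambda>\<xi>::'a. of_real (wt (2 - s) \<xi>)) * A"
    "((\<lambda>h. f (x + h *\<^sub>R b)) has_vector_derivative partial b f x) (at 0)"
    "((\<lambda>h. partial b f (x + h *\<^sub>R b)) has_vector_derivative partial b (partial b f) x) (at 0)"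
proof -
  have le1: "cmod (d1 b \<xi>) \<le> wt 1 \<xi> * cmod (g \<xi>)" for \<xi>
    by (rule d1_wt[OF b])
  have le2: "cmod (d2 b \<xi>) \<le> wt 2 \<xi> * cmod (g \<xi>)" for \<xi>
    by (rule d2_wt[OF b])
  show "L2 (partial b f)" "L2_norm (partial b f) \<le> A"
    unfolding partial_f[OF b] using L2_weighted[OF _ le1] by auto
  show "continuous_on UNIV (partial b f)"
    unfolding partial_f[OF b] by (intro FT_continuous integrable_d b)
  show "continuous_on UNIV (partial b (partial b f))"
    unfolding partial2_f[OF b] by (intro FT_continuous integrable_d b)
  show "cmod (partial b f x) \<le> L2_norm (\<lambda>\<xi>::'a. of_real (wt (1 - s) \<xi>)) * A"
    unfolding partial_f[OF b] by (rule order_trans[OF FT_norm_le[OF integrable_d(1)[OF b]] weighted(2)[OF _ le1]]) (use s3 in auto)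
  show "cmod (partial b (partial b f) x) \<le> L2_norm (\<lambda>\<xi>::'a. of_real (wt (2 - s) \<xi>)) * A"
    unfolding partial2_f[OF b] by (rule order_trans[OF FT_norm_le[OF integrable_d(2)[OF b]] weighted(2)[OF _ le2]]) (use s3 in auto)
  show "((\<lambda>h. f (x + h *\<^sub>R b)) has_vector_derivative partial b f x) (at 0)"
    unfolding partial_f[OF b] by (rule deriv1[OF b])
  show "((\<lambda>h. partial b f (x + h *\<^sub>R b)) has_vector_derivative partial b (partial b f) x) (at 0)"
    unfolding partial2_f[OF b] unfolding partial_f[OF b] by (rule deriv2[OF b])
qed

text \<open>The Laplacian costs two orders and a second difference of size
  \<open>norm v powr (1 + \<beta>)\<close> another \<open>1 + \<beta>\<close>. The total
  \<open>3 + \<beta>\<close> is the origin of the threshold on s.\<close>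

lemma laplacian_bound: "cmod (laplacian f x) \<le> L2_norm (\<lambda>\<xi>::'a. of_real (wt (2 - s) \<xi>)) * A"
  and laplacian_second_difference:
    "0 \<le> \<beta> \<Longrightarrow> \<beta> \<le> 1 \<Longrightarrow> s > 3 + \<beta> + real DIM('a) / 2 \<Longrightarrow>
     cmod (laplacian f (x + 2 *\<^sub>R v) - 2 * laplacian f (x + v) + laplacian f x)
       \<le> 4 * norm v powr (1 + \<beta>) * (L2_norm (\<lambda>\<xi>::'a. of_real (wt (3 + \<beta> - s) \<xi>)) * A)"
proof -
  let ?G = "\<lambda>\<xi>. - (of_real ((norm \<xi>)\<^sup>2) * g \<xi>)"
  have G: "cmod (?G \<xi>) \<le> wt 2 \<xi> * cmod (g \<xi>)" for \<xi>
    by (auto simp: norm_mult norm_power intro!: mult_right_mono norm_power_wt[of _ _ 2])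
  have iG: "integrable lborel ?G" by (rule weighted(1)[OF _ G]) (use s3 in auto)
  show "cmod (laplacian f x) \<le> L2_norm (\<lambda>\<xi>::'a. of_real (wt (2 - s) \<xi>)) * A"
    unfolding laplacian_f by (rule order_trans[OF FT_norm_le[OF iG] weighted(2)[OF _ G]]) (use s3 in auto)
  assume \<beta>: "0 \<le> \<beta>" "\<beta> \<le> 1" and s: "s > 3 + \<beta> + real DIM('a) / 2"
  let ?H = "\<lambda>\<xi>. of_real (norm \<xi> powr (1 + \<beta>)) * ?G \<xi>"
  have Hn: "cmod (?H \<xi>) = norm \<xi> powr (1 + \<beta>) * cmod (?G \<xi>)" for \<xi> by (simp add: norm_mult)
  have H: "cmod (?H \<xi>) \<le> wt (3 + \<beta>) \<xi> * cmod (g \<xi>)" for \<xi>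
  proof -
    have "norm \<xi> powr (1 + \<beta>) * (norm \<xi>)\<^sup>2 \<le> wt (3 + \<beta>) \<xi>"
      using norm_powr_le_wt[of "3 + \<beta>" \<xi>] \<beta>
      by (cases "\<xi> = 0") (simp_all flip: powr_numeral powr_add add: algebra_simps)
    from mult_right_mono[OF this, of "cmod (g \<xi>)"] show ?thesis by (simp add: norm_mult norm_power mult.assoc)
  qed
  have iH: "integrable lborel ?H" by (rule weighted(1)[OF _ H]) (use s in auto)
  have "(LINT \<xi>|lborel. cmod (?H \<xi>)) \<le> L2_norm (\<lambda>\<xi>::'a. of_real (wt (3 + \<beta> - s) \<xi>)) * A"
    by (rule weighted(2)[OF _ H]) (use s in auto)
  from mult_left_mono[OF this, of "4 * norm v powr (1 + \<beta>)"]
    FT_second_difference[OF iG integrable_norm[OF iH, unfolded Hn], of x v] \<beta>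
  show "cmod (laplacian f (x + 2 *\<^sub>R v) - 2 * laplacian f (x + v) + laplacian f x)
       \<le> 4 * norm v powr (1 + \<beta>) * (L2_norm (\<lambda>\<xi>::'a. of_real (wt (3 + \<beta> - s) \<xi>)) * A)"
    unfolding laplacian_f Hn by simp
qed

lemma f_first_difference:
  "cmod (f (x + v) - f x) \<le> norm v * (L2_norm (\<lambda>\<xi>::'a. of_real (wt (1 - s) \<xi>)) * A)"
proof -
  let ?H = "\<lambda>\<xi>. of_real (norm \<xi>) * g \<xi>"
  have H: "cmod (?H \<xi>) \<le> wt 1 \<xi> * cmod (g \<xi>)" for \<xi>
    by (auto simp: norm_mult intro!: mult_right_mono norm_power_wt[of _ _ 1])
  have iH: "integrable lborel ?H" by (rule weighted(1)[OF _ H]) (use s3 in auto)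
  have "(LINT \<xi>|lborel. cmod (?H \<xi>)) \<le> L2_norm (\<lambda>\<xi>::'a. of_real (wt (1 - s) \<xi>)) * A"
    by (rule weighted(2)[OF _ H]) (use s3 in auto)
  from mult_left_mono[OF this, of "norm v"] FT_first_difference[OF integrable_g, of x v] integrable_norm[OF iH]
  show ?thesis unfolding f_eq by (simp add: norm_mult)
qed

lemma f_second_difference:
  "cmod (f (x + 2 *\<^sub>R v) - 2 * f (x + v) + f x) \<le> 4 * (norm v)\<^sup>2 * (L2_norm (\<lambda>\<xi>::'a. of_real (wt (2 - s) \<xi>)) * A)"
proof -
  let ?H = "\<lambda>\<xi>. of_real ((norm \<xi>)\<^sup>2) * g \<xi>"
  have H: "cmod (?H \<xi>) \<le> wt 2 \<xi> * cmod (g \<xi>)" for \<xi>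
    by (auto simp: norm_mult norm_power intro!: mult_right_mono norm_power_wt[of _ _ 2])
  have "(LINT \<xi>|lborel. cmod (?H \<xi>)) \<le> L2_norm (\<lambda>\<xi>::'a. of_real (wt (2 - s) \<xi>)) * A"
    by (rule weighted(2)[OF _ H]) (use s3 in auto)
  from mult_left_mono[OF this, of "4 * (norm v)\<^sup>2"] FT_second_difference[OF integrable_g, of 2 x v] integrable_g2
  show ?thesis unfolding f_eq by (simp add: norm_mult norm_power)
qed

end

section \<open>The local energy estimate\<close>

lemma has_vector_derivative_shift:
  fixes G G' :: "'a::real_normed_vector \<Rightarrow> 'b::real_normed_vector"
  assumes "\<And>x. ((\<lambda>h. G (x + h *\<^sub>R b)) has_vector_derivative G' x) (at (0::real))"
  shows "((\<lambda>h. G (x + h *\<^sub>R b)) has_vector_derivative G' (x + t *\<^sub>R b)) (at t)"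
proof -
  have "((\<lambda>h. G ((x + t *\<^sub>R b) + h *\<^sub>R b)) has_vector_derivative G' (x + t *\<^sub>R b)) (at (t - t))"
    using assms by simp
  from has_vector_derivative_at_within[OF this, of UNIV]
  have "((\<lambda>h. G ((x + t *\<^sub>R b) + h *\<^sub>R b)) has_vector_derivative 1 *\<^sub>R G' (x + t *\<^sub>R b)) (at (t - t))"
    by simp
  moreover have "((\<lambda>h. h - t) has_vector_derivative 1) (at t)"
    by (auto intro!: derivative_eq_intros)
  ultimately have "((\<lambda>h. G ((x + t *\<^sub>R b) + h *\<^sub>R b)) \<circ> (\<lambda>h. h - t) has_vector_derivative 1 *\<^sub>R G' (x + t *\<^sub>R b)) (at t)"
    by (intro vector_diff_chain_at) auto
  moreover have "(x + t *\<^sub>R b) + (h - t) *\<^sub>R b = x + h *\<^sub>R b" for h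
    by (simp add: algebra_simps)
  ultimately show ?thesis by (simp add: comp_def)
qed

lemma has_vector_derivative_quotient:
  assumes "(f has_vector_derivative D) (at (0::real))"
  shows "(\<lambda>h. (f h - f 0) /\<^sub>R h) \<midarrow>0\<rightarrow> D"
proof (rule LIM_zero_cancel, rule tendsto_norm_zero_cancel)
  have "(\<lambda>h. norm (f (0 + h) - f 0 - h *\<^sub>R D) / norm h) \<midarrow>0\<rightarrow> 0"
    using assms unfolding has_vector_derivative_def has_derivative_at by blast
  moreover have "norm (f (0 + h) - f 0 - h *\<^sub>R D) / norm h = norm ((f h - f 0) /\<^sub>R h - D)" if "h \<noteq> 0" for h
  proof -
    have "(f h - f 0) /\<^sub>R h - D = (f (0 + h) - f 0 - h *\<^sub>R D) /\<^sub>R h"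
      using that by (simp add: scaleR_right_diff_distrib)
    then show ?thesis by (simp add: divide_inverse mult.commute)
  qed
  ultimately show "(\<lambda>h. norm ((f h - f 0) /\<^sub>R h - D)) \<midarrow>0\<rightarrow> 0"
    by (elim Lim_transform_eventually) (auto simp: eventually_at_filter)
qed

text \<open>By translation invariance each difference quotient of \<open>G\<close> along
  \<open>b\<close> has integral exactly 0. The quotients are bounded by the Lipschitz constant and
  supported in one ball, so dominated convergence carries this over to \<open>G'\<close>.\<close>

lemma integral_partial_eq_0:
  fixes G G' :: "'a::euclidean_space \<Rightarrow> complex"
  assumes G: "Cc G" and G': "continuous_on UNIV G'"
    and d: "\<And>x. ((\<lambda>h. G (x + h *\<^sub>R b)) has_vector_derivative G' x) (at 0)"
  shows "Cc G'" and "(LINT x|lborel. G' x) = 0"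
proof -
  obtain R B0 where R: "0 \<le> R" "\<And>x. R < norm x \<Longrightarrow> G x = 0" using CcE[OF G] by metis
  have z: "G' x = 0" if "R < norm x" for x
  proof -
    have "((\<lambda>h. 0) has_vector_derivative G' x) (at (0::real))"
    proof (rule has_vector_derivative_transform_within_open[OF d])
      show "open {h. R < norm (x + h *\<^sub>R b)}" by (intro open_Collect_less continuous_intros)
    qed (use that R in auto)
    then show ?thesis
      using has_vector_derivative_const vector_derivative_unique_at by blast
  qed
  show Cc': "Cc G'" unfolding Cc_def using G' z by blast
  obtain R' B where B: "0 \<le> B" "\<And>x. cmod (G' x) \<le> B * indicator (cball 0 R') x" using CcE[OF Cc'] by metis
  have B': "cmod (G' x) \<le> B" for x
    using B(2)[of x] B(1) by (cases "norm x \<le> R'") (auto simp: indicator_def)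
  note dd = has_vector_derivative_shift[of G b G', OF d]
  have lip: "cmod (G (x + h *\<^sub>R b) - G x) \<le> B * \<bar>h\<bar>" for x h
  proof -
    have "norm (G (x + h *\<^sub>R b) - G (x + 0 *\<^sub>R b)) \<le> B * norm (h - 0)"
    proof (rule differentiable_bound[of UNIV "\<lambda>h. G (x + h *\<^sub>R b)" "\<lambda>t h. h *\<^sub>R G' (x + t *\<^sub>R b)"])
      show "((\<lambda>h. G (x + h *\<^sub>R b)) has_derivative (\<lambda>h. h *\<^sub>R G' (x + t *\<^sub>R b))) (at t)" for t
        using dd by (simp add: has_vector_derivative_def)
      show "onorm (\<lambda>h. h *\<^sub>R G' (x + t *\<^sub>R b)) \<le> B" for t :: real
      proof (rule onorm_bound[OF B(1)])
        show "norm (h *\<^sub>R G' (x + t *\<^sub>R b)) \<le> B * norm h" for h :: real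
          using mult_right_mono[OF B'[of "x + t *\<^sub>R b"], of "\<bar>h\<bar>"] by (simp add: mult.commute)
      qed
    qed auto
    then show ?thesis by simp
  qed
  define X where "X n = 1 / real (Suc n)" for n
  have X: "X \<longlonglongrightarrow> 0" unfolding X_def by (rule LIMSEQ_Suc) (rule lim_1_over_n)
  have Xp: "0 < X n" "X n \<le> 1" for n by (auto simp: X_def)
  note [measurable] = Cc_measurable[OF G] Cc_measurable[OF Cc']
  let ?D = "\<lambda>n x. (G (x + X n *\<^sub>R b) - G x) / of_real (X n)"
  have "(\<lambda>n. LINT x|lborel. ?D n x) \<longlonglongrightarrow> (LINT x|lborel. G' x)"
  proof (rule integral_dominated_convergence[where w="\<lambda>x. B * indicator (cball 0 (R + norm b)) x"])
    show "integrable lborel (\<lambda>x. B * indicator (cball (0::'a) (R + norm b)) x)"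
      by (intro integrable_mult_right integrable_indicator_cball)
    have "cmod (?D n x) \<le> B * indicator (cball 0 (R + norm b)) x" for n x
    proof (cases "norm x \<le> R + norm b")
      case True
      then show ?thesis using lip[of x "X n"] Xp[of n] by (simp add: norm_divide divide_le_eq)
    next
      case False
      have "norm x \<le> norm (x + X n *\<^sub>R b) + norm (X n *\<^sub>R b)"
        using norm_triangle_ineq4[of "x + X n *\<^sub>R b" "X n *\<^sub>R b"] by simp
      moreover have "norm (X n *\<^sub>R b) \<le> norm b" using Xp[of n] by (simp add: mult_left_le_one_le)
      ultimately have "R < norm (x + X n *\<^sub>R b)" "R < norm x" using False norm_ge_zero[of b] by linarith+
      then show ?thesis using R B by simp
    qed
    then show "AE x in lborel. norm (?D n x) \<le> B * indicator (cball 0 (R + norm b)) x" for n by (intro AE_I2)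
    show "AE x in lborel. (\<lambda>n. ?D n x) \<longlonglongrightarrow> G' x"
    proof (rule AE_I2)
      fix x
      have "(\<lambda>h. (G (x + h *\<^sub>R b) - G x) /\<^sub>R h) \<midarrow>0\<rightarrow> G' x"
        using has_vector_derivative_quotient[OF d[of x]] by simp
      then have "((\<lambda>h. (G (x + h *\<^sub>R b) - G x) /\<^sub>R h) \<circ> X) \<longlonglongrightarrow> G' x"
        using X Xp unfolding tendsto_at_iff_sequentially by (metis DiffI UNIV_I less_irrefl singletonD)
      then show "(\<lambda>n. ?D n x) \<longlonglongrightarrow> G' x"
        by (simp add: comp_def scaleR_conv_of_real divide_inverse mult.commute)
    qed
  qed measurable
  moreover have "(LINT x|lborel. ?D n x) = 0" for n
  proof -
    have "(LINT x|lborel. G x) = (LINT x|lborel. G (x + X n *\<^sub>R b))"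
      using lborel_integral_affine[of G 1 "X n *\<^sub>R b"] by (simp add: add.commute)
    moreover have "integrable lborel (\<lambda>x. G (x + X n *\<^sub>R b))"
      using lborel_integrable_affine[OF Cc_integrable[OF G], of 1 "X n *\<^sub>R b"] by (simp add: add.commute)
    ultimately show ?thesis using Cc_integrable[OF G] by simp
  qed
  ultimately show "(LINT x|lborel. G' x) = 0" using LIMSEQ_unique by (metis (no_types, lifting) tendsto_const ext)
qed

text \<open>The square makes the cutoff continuously differentiable with a gradient of size at most \<open>4 \<epsilon>\<close>, so
  the boundary terms of the energy estimate vanish as \<open>\<epsilon>\<close> tends to 0.\<close>

definition cutoff :: "real \<Rightarrow> 'a::euclidean_space \<Rightarrow> real" where
  "cutoff \<epsilon> x = (max 0 (1 - \<epsilon>\<^sup>2 * (norm x)\<^sup>2))\<^sup>2"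

definition dcutoff :: "real \<Rightarrow> 'a \<Rightarrow> 'a::euclidean_space \<Rightarrow> real" where
  "dcutoff \<epsilon> b x = 2 * max 0 (1 - \<epsilon>\<^sup>2 * (norm x)\<^sup>2) * (- (2 * \<epsilon>\<^sup>2 * (x \<bullet> b)))"

lemma max_0_square_deriv: "((\<lambda>t. (max 0 t)\<^sup>2) has_real_derivative 2 * max 0 t) (at (t::real))"
proof (cases t "0::real" rule: linorder_cases)
  case greater
  have "((\<lambda>t. t\<^sup>2) has_real_derivative 2 * max 0 t) (at t)"
    using greater by (auto intro!: derivative_eq_intros)
  then show ?thesis
    by (rule has_field_derivative_transform_within_open[of _ _ _ "{0<..}"]) (use greater in auto)
next
  case less
  have "((\<lambda>t. 0) has_real_derivative 2 * max 0 t) (at t)"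
    using less by (auto intro!: derivative_eq_intros)
  then show ?thesis
    by (rule has_field_derivative_transform_within_open[of _ _ _ "{..<0}"]) (use less in auto)
next
  case equal
  have "(\<lambda>h::real. (max 0 h)\<^sup>2 / h) \<midarrow>0\<rightarrow> 0"
  proof (rule Lim_null_comparison)
    show "\<forall>\<^sub>F h in at (0::real). norm ((max 0 h)\<^sup>2 / h) \<le> \<bar>h\<bar>"
      by (intro always_eventually allI) (auto simp: max_def power2_eq_square)
    show "(\<lambda>h::real. \<bar>h\<bar>) \<midarrow>0\<rightarrow> 0" by (rule tendsto_eq_intros refl)+ simp
  qed
  then show ?thesis using equal by (simp add: has_field_derivative_iff)
qed

lemma cutoff_has_derivative:
  "((\<lambda>h. cutoff \<epsilon> (x + h *\<^sub>R b)) has_real_derivative dcutoff \<epsilon> b x) (at 0)"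
proof -
  have n: "(norm (x + h *\<^sub>R b))\<^sup>2 = (norm x)\<^sup>2 + 2 * h * (x \<bullet> b) + h\<^sup>2 * (norm b)\<^sup>2" for h
    unfolding power2_norm_eq_inner by (simp add: inner_add_left inner_add_right inner_commute power2_eq_square)
  have "((\<lambda>h. 1 - \<epsilon>\<^sup>2 * (norm (x + h *\<^sub>R b))\<^sup>2) has_real_derivative - (2 * \<epsilon>\<^sup>2 * (x \<bullet> b))) (at 0)"
    unfolding n by (auto intro!: derivative_eq_intros)
  moreover have "((\<lambda>t. (max 0 t)\<^sup>2) has_real_derivative 2 * max 0 (1 - \<epsilon>\<^sup>2 * (norm x)\<^sup>2)) (at (1 - \<epsilon>\<^sup>2 * (norm (x + 0 *\<^sub>R b))\<^sup>2))"
    using max_0_square_deriv by simp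
  ultimately show ?thesis
    unfolding cutoff_def[abs_def] dcutoff_def by (rule DERIV_chain2[rotated])
qed

lemma cutoff_props:
  shows cutoff_nonneg: "0 \<le> cutoff \<epsilon> x" and cutoff_le_1: "cutoff \<epsilon> x \<le> 1"
    and cutoff_continuous: "continuous_on UNIV (cutoff \<epsilon>)"
    and dcutoff_continuous: "continuous_on UNIV (dcutoff \<epsilon> b)"
proof -
  show "cutoff \<epsilon> x \<le> 1" unfolding cutoff_def by (intro power_le_one) auto
  show "continuous_on UNIV (cutoff \<epsilon>)" unfolding cutoff_def[abs_def] by (intro continuous_intros)
  show "continuous_on UNIV (dcutoff \<epsilon> b)" unfolding dcutoff_def[abs_def] by (intro continuous_intros)
qed (simp add: cutoff_def)

lemma cutoff_support:
  assumes "\<epsilon> > 0" "1 / \<epsilon> < norm x"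
  shows "cutoff \<epsilon> x = 0" "dcutoff \<epsilon> b x = 0"
proof -
  have "1 \<le> \<epsilon> * norm x" using assms by (simp add: field_simps)
  then have "1 \<le> (\<epsilon> * norm x)\<^sup>2" by (rule one_le_power)
  then show "cutoff \<epsilon> x = 0" "dcutoff \<epsilon> b x = 0" by (auto simp: cutoff_def dcutoff_def power_mult_distrib)
qed

text \<open>On the support \<open>\<epsilon> * norm x \<le> 1\<close>, so one of the two factors
  \<epsilon> is absorbed by \<open>x \<bullet> b\<close>.\<close>

lemma dcutoff_bound:
  assumes "\<epsilon> > 0" "norm b \<le> 1"
  shows "\<bar>dcutoff \<epsilon> b x\<bar> \<le> 4 * \<epsilon>"
proof (cases "1 / \<epsilon> < norm x")
  case False
  let ?m = "max 0 (1 - \<epsilon>\<^sup>2 * (norm x)\<^sup>2)"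
  have "\<epsilon> * norm x \<le> 1" using False assms by (simp add: field_simps)
  moreover have "\<bar>x \<bullet> b\<bar> \<le> norm x"
    using Cauchy_Schwarz_ineq2[of x b] assms(2) mult_left_mono[of "norm b" 1 "norm x"] by simp
  ultimately have "\<epsilon> * \<bar>x \<bullet> b\<bar> \<le> 1" using assms(1) by (meson less_imp_le mult_left_mono order_trans)
  then have "?m * (\<epsilon> * \<bar>x \<bullet> b\<bar>) \<le> 1 * 1" using assms(1) by (intro mult_mono) auto
  then have "4 * \<epsilon> * (?m * (\<epsilon> * \<bar>x \<bullet> b\<bar>)) \<le> 4 * \<epsilon> * 1" using assms(1) by (intro mult_left_mono) auto
  moreover have "\<bar>dcutoff \<epsilon> b x\<bar> = 4 * \<epsilon> * (?m * (\<epsilon> * \<bar>x \<bullet> b\<bar>))"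
    by (simp add: dcutoff_def abs_mult power2_eq_square)
  ultimately show ?thesis by simp
next
  case True
  then show ?thesis using cutoff_support(2)[OF assms(1) True] assms(1) by simp
qed

lemma Cc_cutoff_mult:
  assumes "\<epsilon> > 0" "continuous_on UNIV F"
  shows "Cc (\<lambda>x. of_real (cutoff \<epsilon> x) * F x)" "Cc (\<lambda>x. of_real (dcutoff \<epsilon> b x) * F x)"
  unfolding Cc_def
  using assms cutoff_support[OF assms(1)] cutoff_continuous dcutoff_continuous
  by (auto intro!: exI[of _ "1 / \<epsilon>"] continuous_on_mult continuous_on_of_real)

context Hs_function
begin

text \<open>The derivative along \<open>b\<close> of cutoff times \<open>cnj f\<close> times
  \<open>partial b f\<close> integrates to 0. \<open>P\<close> is the localised integral of
  \<open>(cmod (partial b f x))\<^sup>2\<close> and \<open>Q\<close> the term in which the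
  derivative hits the cutoff; later only the sign of \<open>P\<close> and the size of
  \<open>Q\<close> matter.\<close>

lemma energy_partial:
  assumes \<epsilon>: "\<epsilon> > 0" and b: "b \<in> Basis"
  shows "\<exists>P Q. (LINT x|lborel. of_real (cutoff \<epsilon> x) * (cnj (f x) * partial b (partial b f) x)) = - of_real P - Q
     \<and> 0 \<le> P \<and> cmod Q \<le> 4 * \<epsilon> * A\<^sup>2"
proof -
  let ?c = "\<lambda>x. complex_of_real (cutoff \<epsilon> x)" and ?c' = "\<lambda>x. complex_of_real (dcutoff \<epsilon> b x)"
  let ?f1 = "partial b f" and ?f2 = "partial b (partial b f)"
  note p = partial_props[OF b]
  let ?G = "\<lambda>x. ?c x * (cnj (f x) * ?f1 x)"
  let ?G' = "\<lambda>x. ?c x * (cnj (f x) * ?f2 x) + ?c x * (cnj (?f1 x) * ?f1 x) + ?c' x * (cnj (f x) * ?f1 x)"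
  have cc: "Cc (\<lambda>x. ?c x * (cnj (f x) * ?f2 x))" "Cc (\<lambda>x. ?c x * (cnj (?f1 x) * ?f1 x))" "Cc (\<lambda>x. ?c' x * (cnj (f x) * ?f1 x))"
    "Cc ?G"
    by (intro Cc_cutoff_mult \<epsilon> continuous_intros f_continuous p)+
  have contG': "continuous_on UNIV ?G'"
    using cc by (intro continuous_on_add) (auto simp: Cc_def)
  have d: "((\<lambda>h. ?G (x + h *\<^sub>R b)) has_vector_derivative ?G' x) (at 0)" for x
  proof -
    have "((\<lambda>h. cnj (f (x + h *\<^sub>R b))) has_vector_derivative cnj (?f1 x)) (at 0)"
      using p(7)[of x] by (rule has_vector_derivative_cnj)
    from has_vector_derivative_mult[OF this p(8)[of x]]
    have 1: "((\<lambda>h. cnj (f (x + h *\<^sub>R b)) * ?f1 (x + h *\<^sub>R b)) has_vector_derivative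
        (cnj (f x) * ?f2 x + cnj (?f1 x) * ?f1 x)) (at 0)" by simp
    have "((\<lambda>h. ?c (x + h *\<^sub>R b)) has_vector_derivative ?c' x) (at 0)"
      by (rule has_vector_derivative_of_real) (use cutoff_has_derivative in \<open>simp add: has_real_derivative_iff_has_vector_derivative\<close>)
    from has_vector_derivative_mult[OF this 1]
    show ?thesis by (simp add: algebra_simps)
  qed
  have "(LINT x|lborel. ?G' x) = 0" by (rule integral_partial_eq_0(2)[OF cc(4) contG' d])
  moreover have "(LINT x|lborel. ?G' x) = (LINT x|lborel. ?c x * (cnj (f x) * ?f2 x)) + (LINT x|lborel. ?c x * (cnj (?f1 x) * ?f1 x)) + (LINT x|lborel. ?c' x * (cnj (f x) * ?f1 x))"
    using cc[THEN Cc_integrable] by simp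
  moreover have "(LINT x|lborel. ?c x * (cnj (?f1 x) * ?f1 x)) = of_real (LINT x|lborel. cutoff \<epsilon> x * (cmod (?f1 x))\<^sup>2)"
  proof -
    have "?c x * (cnj (?f1 x) * ?f1 x) = of_real (cutoff \<epsilon> x * (cmod (?f1 x))\<^sup>2)" for x
      by (simp only: of_real_mult complex_norm_square mult.commute)
    then show ?thesis by (simp only: integral_complex_of_real)
  qed
  moreover have "0 \<le> (LINT x|lborel. cutoff \<epsilon> x * (cmod (?f1 x))\<^sup>2)"
    by (intro integral_nonneg_AE) (auto simp: cutoff_nonneg)
  moreover have "cmod (LINT x|lborel. ?c' x * (cnj (f x) * ?f1 x)) \<le> 4 * \<epsilon> * A\<^sup>2"
  proof -
    have "continuous_on UNIV (\<lambda>x. ?c' x * cnj (f x))"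
      by (intro continuous_intros dcutoff_continuous f_continuous)
    then have m: "(\<lambda>x. ?c' x * cnj (f x)) \<in> borel_measurable borel" by (rule borel_measurable_continuous_onI)
    have "norm b \<le> 1" using b by simp
    then have "cmod (?c' x * cnj (f x)) \<le> 4 * \<epsilon> * cmod (f x)" for x
      using mult_right_mono[OF dcutoff_bound[OF \<epsilon>, of b x], of "cmod (f x)"] by (simp add: norm_mult)
    from L2_bound[OF f_L2(1) m _ this] \<epsilon>
    have L: "L2 (\<lambda>x. ?c' x * cnj (f x))" "L2_norm (\<lambda>x. ?c' x * cnj (f x)) \<le> 4 * \<epsilon> * L2_norm f" by auto
    have "cmod (LINT x|lborel. ?c' x * (cnj (f x) * ?f1 x)) \<le> L2_norm (\<lambda>x. ?c' x * cnj (f x)) * L2_norm ?f1"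
      using L2_Cauchy_Schwarz[OF L(1) p(1)] by (simp add: mult.assoc)
    also have "\<dots> \<le> (4 * \<epsilon> * A) * A"
      using \<epsilon> A_nonneg by (intro mult_mono order_trans[OF L(2)] mult_left_mono f_L2 p(2)) auto
    finally show ?thesis by (simp add: power2_eq_square mult.assoc)
  qed
  ultimately show ?thesis
    by (intro exI[of _ "LINT x|lborel. cutoff \<epsilon> x * (cmod (?f1 x))\<^sup>2"] exI[of _ "LINT x|lborel. ?c' x * (cnj (f x) * ?f1 x)"])
       (auto simp: algebra_simps eq_neg_iff_add_eq_0)
qed

lemma laplacian_continuous: "continuous_on UNIV (laplacian f)"
  unfolding laplacian_def[abs_def] by (intro continuous_on_sum partial_props)

text \<open>The contribution of \<open>P\<close> is \<open>- (cos \<theta> * P)\<close>, which is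
  not positive. It is discarded, and there remains one cutoff error per coordinate
  direction.\<close>

lemma energy_laplacian:
  assumes \<epsilon>: "\<epsilon> > 0" and \<theta>: "0 \<le> cos \<theta>"
  shows "Re (cis \<theta> * (LINT x|lborel. of_real (cutoff \<epsilon> x) * (cnj (f x) * laplacian f x))) \<le> 4 * \<epsilon> * A\<^sup>2 * real DIM('a)"
proof -
  let ?I = "\<lambda>b. LINT x|lborel. of_real (cutoff \<epsilon> x) * (cnj (f x) * partial b (partial b f) x)"
  have "integrable lborel (\<lambda>x. of_real (cutoff \<epsilon> x) * (cnj (f x) * partial b (partial b f) x))" if "b \<in> Basis" for b
    by (intro Cc_integrable Cc_cutoff_mult \<epsilon> continuous_intros f_continuous partial_props that)
  then have eq: "(LINT x|lborel. of_real (cutoff \<epsilon> x) * (cnj (f x) * laplacian f x)) = (\<Sum>b\<in>Basis. ?I b)"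
    unfolding laplacian_def sum_distrib_left by (subst Bochner_Integration.integral_sum) auto
  have "Re (cis \<theta> * ?I b) \<le> 4 * \<epsilon> * A\<^sup>2" if b: "b \<in> Basis" for b
  proof -
    obtain P Q where PQ: "?I b = - of_real P - Q" "0 \<le> P" "cmod Q \<le> 4 * \<epsilon> * A\<^sup>2"
      using energy_partial[OF \<epsilon> b] by blast
    have "Re (cis \<theta> * ?I b) = - (cos \<theta> * P) - Re (cis \<theta> * Q)"
      unfolding PQ(1) by (simp add: algebra_simps)
    moreover have "\<bar>Re (cis \<theta> * Q)\<bar> \<le> cmod Q"
      using abs_Re_le_cmod[of "cis \<theta> * Q"] by (simp add: norm_mult)
    moreover have "0 \<le> cos \<theta> * P" using \<theta> PQ by simp
    ultimately show ?thesis using PQ(3) by linarith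
  qed
  then have "(\<Sum>b\<in>(Basis::'a set). Re (cis \<theta> * ?I b)) \<le> (\<Sum>b\<in>(Basis::'a set). 4 * \<epsilon> * A\<^sup>2)"
    by (intro sum_mono)
  then show ?thesis unfolding eq by (simp add: sum_distrib_left mult.commute)
qed

end

section \<open>Time derivative of the energy, Gronwall and uniqueness\<close>

text \<open>The mean value inequality turns the bound on \<open>e'\<close> into one for all
  difference quotients. Working within \<open>{0..T}\<close> includes the one-sided derivatives at
  the end points.\<close>

lemma integral_has_real_derivative:
  fixes e e' :: "real \<Rightarrow> 'a::euclidean_space \<Rightarrow> real"
  assumes int: "\<And>t. t \<in> {0..T} \<Longrightarrow> integrable lborel (e t)"
    and m: "\<And>t. t \<in> {0..T} \<Longrightarrow> e' t \<in> borel_measurable borel"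
    and d: "\<And>t x. t \<in> {0..T} \<Longrightarrow> ((\<lambda>\<tau>. e \<tau> x) has_real_derivative e' t x) (at t within {0..T})"
    and b: "\<And>t x. t \<in> {0..T} \<Longrightarrow> \<bar>e' t x\<bar> \<le> B x" and B: "integrable lborel B"
    and t: "t \<in> {0..T}"
  shows "((\<lambda>\<tau>. LINT x|lborel. e \<tau> x) has_real_derivative (LINT x|lborel. e' t x)) (at t within {0..T})"
  unfolding has_field_derivative_iff tendsto_at_iff_sequentially
proof (intro allI impI)
  fix X :: "nat \<Rightarrow> real" assume X: "\<forall>i. X i \<in> {0..T} - {t}" "X \<longlonglongrightarrow> t"
  have lip: "\<bar>e \<tau> x - e t x\<bar> \<le> B x * \<bar>\<tau> - t\<bar>" if "\<tau> \<in> {0..T}" for \<tau> x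
  proof -
    have "norm (e \<tau> x - e t x) \<le> B x * norm (\<tau> - t)"
    proof (rule differentiable_bound[of "{0..T}" "\<lambda>\<tau>. e \<tau> x" "\<lambda>t h. e' t x * h"])
      show "((\<lambda>\<tau>. e \<tau> x) has_derivative (\<lambda>h. e' t x * h)) (at t within {0..T})" if "t \<in> {0..T}" for t
        using d[OF that] by (simp add: has_field_derivative_def)
      show "onorm (\<lambda>h. e' t x * h) \<le> B x" if "t \<in> {0..T}" for t
        using b[OF that, of x] by (intro onorm_bound) (auto simp: abs_mult intro!: mult_right_mono)
    qed (use that t in auto)
    then show ?thesis by simp
  qed
  have "(\<lambda>n. LINT x|lborel. (e (X n) x - e t x) / (X n - t)) \<longlonglongrightarrow> (LINT x|lborel. e' t x)"
  proof (rule integral_dominated_convergence[where w=B])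
    show "AE x in lborel. (\<lambda>n. (e (X n) x - e t x) / (X n - t)) \<longlonglongrightarrow> e' t x"
    proof (rule AE_I2)
      fix x
      show "(\<lambda>n. (e (X n) x - e t x) / (X n - t)) \<longlonglongrightarrow> e' t x"
        using d[OF t, of x] X unfolding has_field_derivative_iff tendsto_at_iff_sequentially comp_def by blast
    qed
    show "AE x in lborel. norm ((e (X n) x - e t x) / (X n - t)) \<le> B x" for n
    proof (rule AE_I2)
      fix x
      have "X n \<in> {0..T}" "0 < \<bar>X n - t\<bar>" using X by auto
      then show "norm ((e (X n) x - e t x) / (X n - t)) \<le> B x"
        using lip[of "X n" x] by (simp add: divide_le_eq)
    qed
    show "(\<lambda>x. (e (X n) x - e t x) / (X n - t)) \<in> borel_measurable lborel" for n
      using int[of "X n"] int[OF t] X by (intro borel_measurable_divide borel_measurable_diff) auto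
  qed (use m[OF t] B in auto)
  moreover have "(LINT x|lborel. (e (X n) x - e t x) / (X n - t)) = ((LINT x|lborel. e (X n) x) - (LINT x|lborel. e t x)) / (X n - t)" for n
    using int[of "X n"] int[OF t] X by simp
  ultimately show "((\<lambda>y. ((LINT x|lborel. e y x) - (LINT x|lborel. e t x)) / (y - t)) \<circ> X) \<longlonglongrightarrow> (LINT x|lborel. e' t x)"
    by (simp only: comp_def)
qed

text \<open>\<open>exp (- (L * t)) * E t - c * t\<close> has nonpositive derivative. The bound is
  proportional to \<open>c\<close>, which will be the cutoff error and tends to 0 with
  \<epsilon>.\<close>

lemma gronwall_linear:
  fixes E E' :: "real \<Rightarrow> real"
  assumes d: "\<And>t. t \<in> {0..T} \<Longrightarrow> (E has_real_derivative E' t) (at t within {0..T})"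
    and le: "\<And>t. t \<in> {0..T} \<Longrightarrow> E' t \<le> c + L * E t" and "E 0 = 0" "0 \<le> c" "0 \<le> L" and t: "t \<in> {0..T}"
  shows "E t \<le> exp (L * t) * (c * t)"
proof (cases "t = 0")
  case False
  define H where "H \<tau> = exp (- (L * \<tau>)) * E \<tau> - c * \<tau>" for \<tau>
  have "\<exists>x\<in>{0<..<t}. H t - H 0 = (\<lambda>h. (exp (- (L * x)) * (E' x - L * E x) - c) * h) (t - 0)"
  proof (rule mvt_simple)
    fix x assume x: "0 \<le> x" "x \<le> t"
    have "(E has_real_derivative E' x) (at x within {0..t})"
      by (rule DERIV_subset[OF d]) (use x t in auto)
    then have "(H has_real_derivative exp (- (L * x)) * (E' x - L * E x) - c) (at x within {0..t})"
      unfolding H_def[abs_def] by (auto intro!: derivative_eq_intros simp: algebra_simps)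
    then show "(H has_derivative (\<lambda>h. (exp (- (L * x)) * (E' x - L * E x) - c) * h)) (at x within {0..t})"
      by (simp add: has_field_derivative_def)
  qed (use t False in auto)
  then obtain x where x: "0 < x" "x < t" "H t - H 0 = (exp (- (L * x)) * (E' x - L * E x) - c) * t" by auto
  have "exp (- (L * x)) * (E' x - L * E x) \<le> exp (- (L * x)) * c"
    using le[of x] x t by (intro mult_left_mono) auto
  also have "\<dots> \<le> 1 * c" using assms x by (intro mult_right_mono) auto
  finally have "H t - H 0 \<le> 0" unfolding x(3) using t by (intro mult_nonpos_nonneg) auto
  then have "exp (- (L * t)) * E t \<le> c * t" using assms by (simp add: H_def)
  then have "exp (L * t) * (exp (- (L * t)) * E t) \<le> exp (L * t) * (c * t)" by (intro mult_left_mono) auto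
  then show ?thesis by (simp flip: mult.assoc exp_add)
qed (use assms in simp)

text \<open>For each cutoff scale \<epsilon>, Gronwall bounds the localised energy by a multiple of
  \<epsilon>. A fixed cutoff that is positive at x lies below all cutoffs with smaller \<epsilon>,
  so its energy is 0, and continuity gives the value at x itself.\<close>

lemma energy_uniqueness:
  fixes w F :: "real \<Rightarrow> 'a::euclidean_space \<Rightarrow> complex"
  assumes s3: "s > 3 + real DIM('a) / 2" and \<theta>: "0 \<le> cos \<theta>"
    and rep: "\<And>t. t \<in> {0..T} \<Longrightarrow> Hs_rep s A (w t) (g t)"
    and eq: "\<And>t x. t \<in> {0..T} \<Longrightarrow> ((\<lambda>\<tau>. w \<tau> x) has_vector_derivative (cis \<theta> * laplacian (w t) x + F t x)) (at t within {0..T})"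
    and F: "\<And>t x. t \<in> {0..T} \<Longrightarrow> cmod (F t x) \<le> L * cmod (w t x)" and Fc: "\<And>t. t \<in> {0..T} \<Longrightarrow> continuous_on UNIV (F t)"
    and L: "0 \<le> L" and w0: "\<And>x. w 0 x = 0" and t: "t \<in> {0..T}"
  shows "w t x = 0"
proof -
  have Hs: "Hs_function s A (w t) (g t)" if "t \<in> {0..T}" for t
    using rep[OF that] s3 by (simp add: Hs_function_def)
  have A: "0 \<le> A" by (rule Hs_function.A_nonneg[OF Hs[OF t]])
  let ?K = "\<lambda>m. L2_norm (\<lambda>\<xi>::'a. of_real (wt (m - s) \<xi>)) * A"
  have K0: "0 \<le> ?K m" for m using A by simp
  note wc = Hs_function.f_continuous[OF Hs] and lc = Hs_function.laplacian_continuous[OF Hs]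
  have wK: "cmod (w t x) \<le> ?K 0" and lK: "cmod (laplacian (w t) x) \<le> ?K 2" if "t \<in> {0..T}" for t x
    using Hs_function.f_bound[OF Hs[OF that]] Hs_function.laplacian_bound[OF Hs[OF that]] by auto
  define wt' where "wt' t x = cis \<theta> * laplacian (w t) x + F t x" for t x
  have w'K: "cmod (wt' t x) \<le> ?K 2 + L * ?K 0" if "t \<in> {0..T}" for t x
  proof -
    have "cmod (wt' t x) \<le> cmod (laplacian (w t) x) + cmod (F t x)"
      unfolding wt'_def using norm_triangle_ineq[of "cis \<theta> * laplacian (w t) x" "F t x"] by (simp add: norm_mult)
    also have "\<dots> \<le> ?K 2 + L * ?K 0"
      using lK[OF that, of x] F[OF that, of x] mult_left_mono[OF wK[OF that, of x] L] by linarith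
    finally show ?thesis .
  qed
  have w'c: "continuous_on UNIV (wt' t)" if "t \<in> {0..T}" for t
    unfolding wt'_def[abs_def] by (intro continuous_intros lc Fc that)
  have main: "(LINT x|lborel. cutoff \<epsilon> x * (cmod (w t x))\<^sup>2) \<le> exp (2 * L * t) * (8 * \<epsilon> * A\<^sup>2 * real DIM('a) * t)"
    if \<epsilon>: "\<epsilon> > 0" for \<epsilon>
  proof -
    let ?e' = "\<lambda>t x. cutoff \<epsilon> x * (2 * Re (cnj (w t x) * wt' t x))"
    have ci: "integrable lborel (\<lambda>x. cutoff \<epsilon> x * h x)" if "continuous_on UNIV h" for h :: "'a \<Rightarrow> real"
    proof -
      have "integrable lborel (\<lambda>x. complex_of_real (cutoff \<epsilon> x) * of_real (h x))"
        by (intro Cc_integrable Cc_cutoff_mult \<epsilon> continuous_intros that)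
      then have "integrable lborel (\<lambda>x. complex_of_real (cutoff \<epsilon> x * h x))" by simp
      then show ?thesis by (simp only: complex_of_real_integrable_eq)
    qed
    have d: "((\<lambda>\<tau>. LINT x|lborel. cutoff \<epsilon> x * (cmod (w \<tau> x))\<^sup>2) has_real_derivative (LINT x|lborel. ?e' t x)) (at t within {0..T})"
      if t: "t \<in> {0..T}" for t
    \<comment> \<open>The cutoff confines a constant bound for w and its time derivative; that
      constant depends on \<open>A\<close> and \<open>L\<close> and hence not on time.\<close>
    proof (rule integral_has_real_derivative[where B="\<lambda>x. cutoff \<epsilon> x * (2 * (?K 0 * (?K 2 + L * ?K 0)))", OF _ _ _ _ _ t])
      fix t assume t: "t \<in> {0..T}"
      show "integrable lborel (\<lambda>x. cutoff \<epsilon> x * (cmod (w t x))\<^sup>2)"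
        by (intro ci continuous_intros wc t)
      have "continuous_on UNIV (?e' t)" by (intro continuous_intros wc w'c t cutoff_continuous)
      then show "?e' t \<in> borel_measurable borel" by (rule borel_measurable_continuous_onI)
      fix x
      have "((\<lambda>\<tau>. w \<tau> x) has_vector_derivative wt' t x) (at t within {0..T})"
        using eq[OF t, of x] by (simp add: wt'_def)
      from has_vector_derivative_mult[OF has_vector_derivative_cnj[OF this] this]
      have "((\<lambda>\<tau>. Re (cnj (w \<tau> x) * w \<tau> x)) has_vector_derivative Re (cnj (w t x) * wt' t x + cnj (wt' t x) * w t x)) (at t within {0..T})"
        by (rule bounded_linear.has_vector_derivative[OF bounded_linear_Re])
      moreover have "Re (cnj (w \<tau> x) * w \<tau> x) = (cmod (w \<tau> x))\<^sup>2" for \<tau>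
        by (simp add: cmod_power2 flip: power2_eq_square)
      moreover have "Re (cnj (w t x) * wt' t x + cnj (wt' t x) * w t x) = 2 * Re (cnj (w t x) * wt' t x)" by simp
      ultimately have "((\<lambda>\<tau>. (cmod (w \<tau> x))\<^sup>2) has_real_derivative 2 * Re (cnj (w t x) * wt' t x)) (at t within {0..T})"
        by (simp add: has_real_derivative_iff_has_vector_derivative)
      then show "((\<lambda>\<tau>. cutoff \<epsilon> x * (cmod (w \<tau> x))\<^sup>2) has_real_derivative ?e' t x) (at t within {0..T})"
        by (rule DERIV_cmult)
      have "\<bar>Re (cnj (w t x) * wt' t x)\<bar> \<le> cmod (w t x) * cmod (wt' t x)"
        using abs_Re_le_cmod[of "cnj (w t x) * wt' t x"] by (simp add: norm_mult)
      also have "\<dots> \<le> ?K 0 * (?K 2 + L * ?K 0)"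
        by (intro mult_mono wK[OF t] w'K[OF t] K0) auto
      finally show "\<bar>?e' t x\<bar> \<le> cutoff \<epsilon> x * (2 * (?K 0 * (?K 2 + L * ?K 0)))"
        using cutoff_nonneg[of \<epsilon> x] by (simp add: abs_mult mult_left_mono)
    qed (intro ci continuous_intros)
    have le: "(LINT x|lborel. ?e' t x) \<le> 8 * \<epsilon> * A\<^sup>2 * real DIM('a) + 2 * L * (LINT x|lborel. cutoff \<epsilon> x * (cmod (w t x))\<^sup>2)"
      if t: "t \<in> {0..T}" for t
    proof -
      let ?J = "LINT x|lborel. of_real (cutoff \<epsilon> x) * (cnj (w t x) * laplacian (w t) x)"
      have iJ: "integrable lborel (\<lambda>x. of_real (cutoff \<epsilon> x) * (cnj (w t x) * laplacian (w t) x))"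
        by (intro Cc_integrable Cc_cutoff_mult \<epsilon> continuous_intros wc lc t)
      have iJ': "integrable lborel (\<lambda>x. Re (cis \<theta> * (of_real (cutoff \<epsilon> x) * (cnj (w t x) * laplacian (w t) x))))"
        by (intro integrable_Re integrable_mult_right iJ)
      have "?e' t x \<le> 2 * Re (cis \<theta> * (of_real (cutoff \<epsilon> x) * (cnj (w t x) * laplacian (w t) x))) + 2 * L * (cutoff \<epsilon> x * (cmod (w t x))\<^sup>2)" for x
      proof -
        have "Re (cnj (w t x) * F t x) \<le> cmod (w t x) * cmod (F t x)"
          using complex_Re_le_cmod[of "cnj (w t x) * F t x"] by (simp add: norm_mult)
        also have "\<dots> \<le> cmod (w t x) * (L * cmod (w t x))" by (intro mult_left_mono F t) auto
        finally have "Re (cnj (w t x) * F t x) \<le> L * (cmod (w t x))\<^sup>2" by (simp add: power2_eq_square mult_ac)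
        then have "cutoff \<epsilon> x * Re (cnj (w t x) * F t x) \<le> cutoff \<epsilon> x * (L * (cmod (w t x))\<^sup>2)"
          by (intro mult_left_mono cutoff_nonneg)
        moreover have "?e' t x = 2 * Re (cis \<theta> * (of_real (cutoff \<epsilon> x) * (cnj (w t x) * laplacian (w t) x))) + 2 * (cutoff \<epsilon> x * Re (cnj (w t x) * F t x))"
          unfolding wt'_def by (simp add: algebra_simps)
        ultimately show ?thesis by (simp add: mult_ac)
      qed
      then have "(LINT x|lborel. ?e' t x) \<le> (LINT x|lborel. 2 * Re (cis \<theta> * (of_real (cutoff \<epsilon> x) * (cnj (w t x) * laplacian (w t) x))) + 2 * L * (cutoff \<epsilon> x * (cmod (w t x))\<^sup>2))"
        by (intro integral_mono Bochner_Integration.integrable_add integrable_mult_right iJ' ci continuous_intros wc w'c t)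
      also have "\<dots> = 2 * (LINT x|lborel. Re (cis \<theta> * (of_real (cutoff \<epsilon> x) * (cnj (w t x) * laplacian (w t) x)))) + 2 * L * (LINT x|lborel. cutoff \<epsilon> x * (cmod (w t x))\<^sup>2)"
        by (subst Bochner_Integration.integral_add)
          (intro integrable_mult_right iJ' ci continuous_intros wc t | simp only: integral_mult_right_zero)+
      also have "(LINT x|lborel. Re (cis \<theta> * (of_real (cutoff \<epsilon> x) * (cnj (w t x) * laplacian (w t) x)))) = Re (cis \<theta> * ?J)"
        by (subst integral_Re) (intro integrable_mult_right iJ, simp only: integral_mult_right_zero)
      also have "Re (cis \<theta> * ?J) \<le> 4 * \<epsilon> * A\<^sup>2 * real DIM('a)"
        by (rule Hs_function.energy_laplacian[OF Hs[OF t] \<epsilon> \<theta>])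
      finally show ?thesis by simp
    qed
    show ?thesis
      by (rule gronwall_linear[OF d le]) (use \<epsilon> L t w0 in auto)
  qed
  \<comment> \<open>Chosen so that \<open>\<epsilon>1 * norm x < 1\<close>, which places x strictly
    inside the support of this cutoff.\<close>
  define \<epsilon>1 where "\<epsilon>1 = 1 / (1 + norm x)"
  have \<epsilon>1: "0 < \<epsilon>1" by (simp add: \<epsilon>1_def add_pos_nonneg)
  let ?p = "\<lambda>y::'a. cutoff \<epsilon>1 y * (cmod (w t y))\<^sup>2"
  have int: "integrable lborel (\<lambda>y. cutoff \<epsilon> y * (cmod (w t y))\<^sup>2)" if "\<epsilon> > 0" for \<epsilon>
  proof -
    have "integrable lborel (\<lambda>y. complex_of_real (cutoff \<epsilon> y) * of_real ((cmod (w t y))\<^sup>2))"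
      by (intro Cc_integrable Cc_cutoff_mult that continuous_intros wc t)
    then have "integrable lborel (\<lambda>y. complex_of_real (cutoff \<epsilon> y * (cmod (w t y))\<^sup>2))" by simp
    then show ?thesis by (simp only: complex_of_real_integrable_eq)
  qed
  let ?C = "exp (2 * L * t) * (8 * A\<^sup>2 * real DIM('a) * t)"
  have small: "(LINT y|lborel. ?p y) \<le> ?C * \<epsilon>" if "0 < \<epsilon>" "\<epsilon> < \<epsilon>1" for \<epsilon>
  proof -
    have "(LINT y|lborel. ?p y) \<le> (LINT y|lborel. cutoff \<epsilon> y * (cmod (w t y))\<^sup>2)"
    proof (rule integral_mono[OF int[OF \<epsilon>1] int[OF that(1)]])
      fix y :: 'a
      have "\<epsilon>\<^sup>2 \<le> \<epsilon>1\<^sup>2" using that by (intro power_mono) auto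
      then have "\<epsilon>\<^sup>2 * (norm y)\<^sup>2 \<le> \<epsilon>1\<^sup>2 * (norm y)\<^sup>2" by (intro mult_right_mono) auto
      then have "cutoff \<epsilon>1 y \<le> cutoff \<epsilon> y" unfolding cutoff_def by (intro power_mono) auto
      then show "?p y \<le> cutoff \<epsilon> y * (cmod (w t y))\<^sup>2" by (intro mult_right_mono) auto
    qed
    also have "\<dots> \<le> ?C * \<epsilon>" using main[OF that(1)] by (simp add: mult_ac)
    finally show ?thesis .
  qed
  have "(LINT y|lborel. ?p y) \<le> 0"
  proof (rule tendsto_lowerbound)
    have "((\<lambda>\<epsilon>. ?C * \<epsilon>) \<longlongrightarrow> ?C * 0) (at_right 0)" by (intro tendsto_intros)
    then show "((\<lambda>\<epsilon>. ?C * \<epsilon>) \<longlongrightarrow> 0) (at_right 0)" by simp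
    show "\<forall>\<^sub>F \<epsilon> in at_right 0. (LINT y|lborel. ?p y) \<le> ?C * \<epsilon>"
      using eventually_at_right_less[of 0] eventually_at_right_real[OF \<epsilon>1]
      by eventually_elim (use small in auto)
  qed simp
  moreover have "0 \<le> (LINT y|lborel. ?p y)" by (intro integral_nonneg_AE) (auto simp: cutoff_nonneg)
  ultimately have z: "(LINT y|lborel. ?p y) = 0" by simp
  have "?p x = 0"
    by (rule continuous_nonneg_integral_zero[OF _ _ int[OF \<epsilon>1] z])
       (auto intro!: continuous_intros cutoff_continuous wc t simp: cutoff_nonneg)
  moreover have "cutoff \<epsilon>1 x \<noteq> 0"
  proof -
    have "\<epsilon>1 * norm x < 1" by (simp add: \<epsilon>1_def add_pos_nonneg)
    then have "(\<epsilon>1 * norm x)\<^sup>2 < 1" using \<epsilon>1 by (intro power_less_one_iff[THEN iffD2]) auto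
    then show ?thesis by (auto simp: cutoff_def power_mult_distrib max_def)
  qed
  ultimately show ?thesis by simp
qed

section \<open>The initial datum and the nonlinearity\<close>

text \<open>\<open>bump 0\<close> is the classical flat function. The extra division by
  \<open>t ^ m\<close> makes the family closed under differentiation up to linear
  combinations.\<close>

definition bump :: "nat \<Rightarrow> real \<Rightarrow> real" where
  "bump m t = (if t \<le> 0 then 0 else exp (- 1 / t) / t ^ m)"

lemma bump_tendsto_0: "(bump m \<longlongrightarrow> 0) (at 0)"
  unfolding filterlim_at_split
proof
  have "\<forall>\<^sub>F t in at_left 0. bump m t = 0"
    by (simp add: eventually_at_filter bump_def)
  then show "(bump m \<longlongrightarrow> 0) (at_left 0)" by (rule tendsto_eventually)
  have "((\<lambda>t. (inverse t) ^ m / exp (inverse t)) \<longlongrightarrow> (0::real)) (at_right 0)"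
    by (rule filterlim_compose[OF tendsto_power_div_exp_0 filterlim_inverse_at_top_right])
  then show "(bump m \<longlongrightarrow> 0) (at_right 0)"
    by (rule Lim_transform_eventually)
       (auto simp: eventually_at_filter bump_def exp_minus field_simps)
qed

lemma bump_deriv: "(bump m has_real_derivative bump (m + 2) t - real m * bump (m + 1) t) (at t)"
proof (cases t "0::real" rule: linorder_cases)
  case greater
  have "((\<lambda>t. exp (- 1 / t) / t ^ m) has_real_derivative bump (m + 2) t - real m * bump (m + 1) t) (at t)"
    using greater
    by (auto intro!: derivative_eq_intros simp: bump_def field_simps power2_eq_square) 
       (cases m; simp add: field_simps)
  then show ?thesis
    by (rule has_field_derivative_transform_within_open[of _ _ _ "{0<..}"]) (use greater in \<open>auto simp: bump_def\<close>)
next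
  case less
  have "((\<lambda>t. 0) has_real_derivative bump (m + 2) t - real m * bump (m + 1) t) (at t)"
    using less by (auto simp: bump_def)
  then show ?thesis
    by (rule has_field_derivative_transform_within_open[of _ _ _ "{..<0}"]) (use less in \<open>auto simp: bump_def\<close>)
next
  case equal
  \<comment> \<open>Division by h turns \<open>bump m\<close> into \<open>bump (m + 1)\<close>, so
    the difference quotient at 0 is covered by \<open>bump_tendsto_0\<close>.\<close>
  have "(\<lambda>h. bump m h / h) \<midarrow>0\<rightarrow> 0"
    by (rule Lim_transform_eventually[OF bump_tendsto_0[of "m + 1"]])
       (auto simp: bump_def)
  then show ?thesis using equal by (simp add: has_field_derivative_iff bump_def)
qed

text \<open>An algebra that contains the datum and is stable under directional derivatives. Since
  \<open>C_k\<close> iterates partial derivatives, membership yields every order by one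
  induction.\<close>

inductive bump_poly :: "('a::euclidean_space \<Rightarrow> complex) \<Rightarrow> bool" where
  const: "bump_poly (\<lambda>x. c)"
| coord: "bump_poly (\<lambda>x. of_real (x \<bullet> v))"
| bump: "bump_poly (\<lambda>x. of_real (bump m (1 - (norm x)\<^sup>2)))"
| add: "bump_poly f \<Longrightarrow> bump_poly g \<Longrightarrow> bump_poly (\<lambda>x. f x + g x)"
| mult: "bump_poly f \<Longrightarrow> bump_poly g \<Longrightarrow> bump_poly (\<lambda>x. f x * g x)"

lemma bump_poly_has_derivative:
  "bump_poly f \<Longrightarrow> \<exists>f'. (\<forall>x. (f has_derivative f' x) (at x)) \<and> (\<forall>v. bump_poly (\<lambda>x. f' x v))"
proof (induction rule: bump_poly.induct)
  case (const c)
  show ?case by (rule exI[of _ "\<lambda>x v. 0"]) (auto intro: bump_poly.const)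
next
  case (coord v)
  show ?case
    by (rule exI[of _ "\<lambda>x y. of_real (y \<bullet> v)"])
       (auto intro!: bump_poly.const derivative_eq_intros)
next
  case (bump m)
  let ?d = "\<lambda>x::'a. bump (m + 2) (1 - (norm x)\<^sup>2) - real m * bump (m + 1) (1 - (norm x)\<^sup>2)"
  have "((\<lambda>x::'a. complex_of_real (bump m (1 - (norm x)\<^sup>2))) has_derivative (\<lambda>v. of_real (?d x * (- (2 * (x \<bullet> v)))))) (at x)" for x
  proof -
    have "((\<lambda>x::'a. 1 - (norm x)\<^sup>2) has_derivative (\<lambda>v. - (2 * (x \<bullet> v)))) (at x)"
      unfolding power2_norm_eq_inner
      by (auto intro!: derivative_eq_intros simp: inner_commute)
    from has_derivative_compose[OF this bump_deriv[unfolded has_field_derivative_def]]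
    have "((\<lambda>x::'a. bump m (1 - (norm x)\<^sup>2)) has_derivative (\<lambda>v. ?d x * (- (2 * (x \<bullet> v))))) (at x)" .
    then show ?thesis by (rule has_derivative_of_real)
  qed
  moreover have "bump_poly (\<lambda>x. complex_of_real (?d x * (- (2 * (x \<bullet> v)))))" for v :: 'a
  proof -
    have "bump_poly (\<lambda>x::'a. (of_real (bump (m + 2) (1 - (norm x)\<^sup>2)) + (- of_nat m) * of_real (bump (m + 1) (1 - (norm x)\<^sup>2))) * ((- 2) * of_real (x \<bullet> v)))"
      by (intro bump_poly.intros)
    then show ?thesis by (simp add: algebra_simps)
  qed
  ultimately show ?case
    by (intro exI[of _ "\<lambda>x v. of_real (?d x * (- (2 * (x \<bullet> v))))"] conjI allI)
next
  case (add f g)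
  then obtain f' g' where "\<forall>x. (f has_derivative f' x) (at x)" "\<forall>v. bump_poly (\<lambda>x. f' x v)"
    "\<forall>x. (g has_derivative g' x) (at x)" "\<forall>v. bump_poly (\<lambda>x. g' x v)" by blast
  then show ?case
    by (intro exI[of _ "\<lambda>x v. f' x v + g' x v"]) (auto intro!: bump_poly.add has_derivative_add)
next
  case (mult f g)
  then obtain f' g' where "\<forall>x. (f has_derivative f' x) (at x)" "\<forall>v. bump_poly (\<lambda>x. f' x v)"
    "\<forall>x. (g has_derivative g' x) (at x)" "\<forall>v. bump_poly (\<lambda>x. g' x v)" by blast
  with mult.hyps show ?case
    by (intro exI[of _ "\<lambda>x v. f x * g' x v + f' x v * g x"])
       (auto intro!: bump_poly.add bump_poly.mult has_derivative_mult)
qed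

lemma bump_poly_C_k: "bump_poly f \<Longrightarrow> C_k k f"
proof (induction k arbitrary: f)
  case 0
  then show ?case
    using bump_poly_has_derivative[of f] by (auto simp: continuous_on_eq_continuous_at intro: has_derivative_continuous)
next
  case (Suc k)
  from bump_poly_has_derivative[OF Suc.prems] obtain f'
    where f': "\<And>x. (f has_derivative f' x) (at x)" "\<And>v. bump_poly (\<lambda>x. f' x v)" by blast
  have "partial b f = (\<lambda>x. f' x b)" for b
  proof
    fix x
    have "((\<lambda>h. f (x + h *\<^sub>R b)) has_derivative (\<lambda>h. f' x (h *\<^sub>R b))) (at 0)"
    proof (rule has_derivative_compose[where g=f])
      show "((\<lambda>h. x + h *\<^sub>R b) has_derivative (\<lambda>h. h *\<^sub>R b)) (at 0)"
        by (auto intro!: derivative_eq_intros)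
    qed (use f' in simp)
    moreover have "f' x (h *\<^sub>R b) = h *\<^sub>R f' x b" for h
      using f'(1)[of x] by (simp add: has_derivative_bounded_linear linear_simps)
    ultimately have "((\<lambda>h. f (x + h *\<^sub>R b)) has_vector_derivative f' x b) (at 0)"
      by (simp add: has_vector_derivative_def)
    then show "partial b f x = f' x b" unfolding partial_def by (rule vector_derivative_at)
  qed
  moreover have "f differentiable_on UNIV"
    using f'(1) by (auto simp: differentiable_on_def differentiable_def intro: has_derivative_at_withinI)
  ultimately show ?case using Suc.IH f'(2) by simp
qed

definition odd_bump :: "'a \<Rightarrow> 'a::euclidean_space \<Rightarrow> complex" where
  "odd_bump e x = of_real (x \<bullet> e) * of_real (bump 0 (1 - (norm x)\<^sup>2))"

lemma odd_bump_smooth: "smooth_compact_support (odd_bump e)"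
  unfolding smooth_compact_support_def
proof
  have "bump_poly (odd_bump e)" unfolding odd_bump_def[abs_def] by (intro bump_poly.intros)
  then show "\<forall>k. C_k k (odd_bump e)" using bump_poly_C_k by blast
  have "norm x \<le> 1" if "odd_bump e x \<noteq> 0" for x
  proof (rule ccontr)
    assume "\<not> norm x \<le> 1"
    then have "1 \<le> (norm x)\<^sup>2" by (simp add: one_le_power)
    then show False using that by (simp add: odd_bump_def bump_def)
  qed
  then have "{x. odd_bump e x \<noteq> 0} \<subseteq> cball 0 1" by auto
  then show "compact (closure {x. odd_bump e x \<noteq> 0})"
    using bounded_subset[OF bounded_cball] by (simp add: compact_closure)
qed

lemma odd_bump_minus: "odd_bump e (- x) = - odd_bump e x"
  by (simp add: odd_bump_def)

lemma odd_bump_lower_bound: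
  assumes "norm e = 1" "0 < h" "h \<le> 1 / 2"
  shows "exp (- 2) * h \<le> Re (odd_bump e (h *\<^sub>R e))"
proof -
  \<comment> \<open>The constant \<open>exp (- 2)\<close> comes from
    \<open>1 - h\<^sup>2 \<ge> 1 / 2\<close>, hence
    \<open>- 1 / (1 - h\<^sup>2) \<ge> - 2\<close>.\<close>
  have "h\<^sup>2 \<le> (1 / 2)\<^sup>2" using assms by (intro power_mono) auto
  then have h: "1 / 2 \<le> 1 - h\<^sup>2" by (simp add: power2_eq_square)
  then have "- 2 \<le> - 1 / (1 - h\<^sup>2)" by (simp add: divide_le_eq le_divide_eq)
  then have "exp (- 2) \<le> bump 0 (1 - h\<^sup>2)" using h by (simp add: bump_def)
  moreover have "e \<bullet> e = 1" using assms(1) by (simp add: power2_norm_eq_inner[symmetric])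
  then have "Re (odd_bump e (h *\<^sub>R e)) = h * bump 0 (1 - h\<^sup>2)"
    using assms by (simp add: odd_bump_def)
  ultimately show ?thesis using assms(2) by (simp add: mult.commute)
qed

section \<open>The power nonlinearity\<close>

definition pnl :: "real \<Rightarrow> complex \<Rightarrow> complex" where
  "pnl \<alpha> z = of_real (cmod z powr \<alpha>) * z"

lemma pnl_minus: "pnl \<alpha> (- z) = - pnl \<alpha> z"
  by (simp add: pnl_def)

lemma pnl_continuous: "0 < \<alpha> \<Longrightarrow> continuous_on UNIV (pnl \<alpha>)"
  unfolding pnl_def by (intro continuous_intros continuous_on_powr') auto

lemma pnl_double: "pnl \<alpha> (2 * z) = of_real (2 powr (1 + \<alpha>)) * pnl \<alpha> z"
  by (simp add: pnl_def norm_mult powr_mult powr_add)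

text \<open>For \<open>cmod w \<le> cmod z\<close> the ratio r of the moduli satisfies
  \<open>r \<le> r powr \<alpha>\<close> because \<open>\<alpha> < 1\<close>, and this controls the
  difference of the two powers. The explicit factor \<open>K powr \<alpha>\<close> matters: for
  arguments of size h it supplies the gain \<open>h powr \<alpha>\<close>.\<close>

lemma pnl_diff:
  assumes \<alpha>: "0 < \<alpha>" "\<alpha> < 1" and "cmod z \<le> K" "cmod w \<le> K"
  shows "cmod (pnl \<alpha> z - pnl \<alpha> w) \<le> 2 * K powr \<alpha> * cmod (z - w)"
proof -
  have main: "cmod (pnl \<alpha> z - pnl \<alpha> w) \<le> 2 * cmod z powr \<alpha> * cmod (z - w)" if "cmod w \<le> cmod z" for z w
  proof (cases "z = 0")
    case True
    then show ?thesis using that by simp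
  next
    case False
    let ?r = "cmod w / cmod z"
    have r: "0 \<le> ?r" "?r \<le> 1" using False that by auto
    have r\<alpha>: "?r \<le> ?r powr \<alpha>"
      using powr_mono'[of \<alpha> 1 ?r] \<alpha> r by (cases "?r = 0") auto
    have "cmod w powr \<alpha> = ?r powr \<alpha> * cmod z powr \<alpha>"
      using False by (simp add: powr_divide)
    then have "?r * cmod z powr \<alpha> \<le> cmod w powr \<alpha>"
      using mult_right_mono[OF r\<alpha>, of "cmod z powr \<alpha>"] by simp
    then have "cmod z powr \<alpha> - cmod w powr \<alpha> \<le> cmod z powr \<alpha> * (1 - ?r)" by (simp add: algebra_simps)
    then have "(cmod z powr \<alpha> - cmod w powr \<alpha>) * cmod w \<le> cmod z powr \<alpha> * (1 - ?r) * cmod w"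
      by (rule mult_right_mono) simp
    also have "\<dots> = cmod z powr \<alpha> * (?r * (cmod z - cmod w))"
      using False by (simp add: field_simps)
    also have "\<dots> \<le> cmod z powr \<alpha> * (1 * cmod (z - w))"
      using r that norm_triangle_ineq2[of z w] by (intro mult_left_mono mult_mono) auto
    finally have 1: "(cmod z powr \<alpha> - cmod w powr \<alpha>) * cmod w \<le> cmod z powr \<alpha> * cmod (z - w)" by simp
    have "pnl \<alpha> z - pnl \<alpha> w = of_real (cmod z powr \<alpha>) * (z - w) + of_real (cmod z powr \<alpha> - cmod w powr \<alpha>) * w"
      by (simp add: pnl_def algebra_simps)
    then have "cmod (pnl \<alpha> z - pnl \<alpha> w) \<le> cmod z powr \<alpha> * cmod (z - w) + \<bar>cmod z powr \<alpha> - cmod w powr \<alpha>\<bar> * cmod w"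
      using norm_triangle_ineq by (metis norm_mult norm_of_real abs_of_nonneg powr_ge_zero)
    also have "\<bar>cmod z powr \<alpha> - cmod w powr \<alpha>\<bar> = cmod z powr \<alpha> - cmod w powr \<alpha>"
      using powr_mono2[of \<alpha> "cmod w" "cmod z"] \<alpha> that by simp
    finally show ?thesis using 1 by simp
  qed
  have K: "cmod z powr \<alpha> \<le> K powr \<alpha>" "cmod w powr \<alpha> \<le> K powr \<alpha>"
    using assms by (auto intro!: powr_mono2)
  show ?thesis
  proof (cases "cmod w \<le> cmod z")
    case True
    show ?thesis
      by (rule order_trans[OF main[OF True]]) (use K in \<open>auto intro!: mult_right_mono\<close>)
  next
    case False
    then have "cmod z \<le> cmod w" by simp
    from main[OF this] have "cmod (pnl \<alpha> z - pnl \<alpha> w) \<le> 2 * cmod w powr \<alpha> * cmod (z - w)"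
      by (simp add: norm_minus_commute)
    also have "\<dots> \<le> 2 * K powr \<alpha> * cmod (z - w)" using K by (auto intro!: mult_right_mono)
    finally show ?thesis .
  qed
qed

lemma Re_pnl_lower_bound:
  assumes "0 < \<alpha>" "0 \<le> c" "c \<le> Re z"
  shows "c powr (1 + \<alpha>) \<le> Re (pnl \<alpha> z)"
proof (cases "c = 0")
  case True
  then show ?thesis using assms by (simp add: pnl_def)
next
  case False
  have "c powr \<alpha> * c \<le> cmod z powr \<alpha> * Re z"
    using assms complex_Re_le_cmod[of z] by (intro mult_mono powr_mono2) auto
  then show ?thesis using assms False by (simp add: pnl_def powr_add mult.commute)
qed

section \<open>Nonexistence\<close>

lemma Hs_rep_mono: "Hs_rep s A f g \<Longrightarrow> A \<le> A' \<Longrightarrow> Hs_rep s A' f g"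
  by (auto simp: Hs_rep_def)

text \<open>The sum is twice the even part and measures the failure of oddness. On the Fourier side
  the symbol of the Laplacian is even, so reflecting \<open>g\<close> reflects the
  Laplacian.\<close>

lemma laplacian_odd_part:
  fixes f :: "'a::euclidean_space \<Rightarrow> complex"
  assumes rep: "Hs_rep s A f g" and s3: "s > 3 + real DIM('a) / 2"
  shows "laplacian (\<lambda>x. f x + f (- x)) x = laplacian f x + laplacian f (- x)"
    and "Hs_rep s (A + A) (\<lambda>x. f x + f (- x)) (\<lambda>\<xi>. g \<xi> + g (- \<xi>))"
proof -
  show rep': "Hs_rep s (A + A) (\<lambda>x. f x + f (- x)) (\<lambda>\<xi>. g \<xi> + g (- \<xi>))"
    by (rule Hs_rep_add[OF rep Hs_rep_reflect[OF rep]]) (use s3 in simp)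
  interpret f: Hs_function s A f g using rep s3 by unfold_locales
  interpret w: Hs_function s "A + A" "\<lambda>x. f x + f (- x)" "\<lambda>\<xi>. g \<xi> + g (- \<xi>)" using rep' s3 by unfold_locales
  let ?G = "\<lambda>\<xi>. - (of_real ((norm \<xi>)\<^sup>2) * g \<xi>)"
  have "integrable lborel (\<lambda>\<xi>. cmod (?G \<xi>))" using f.integrable_g2 by (simp add: norm_mult norm_power)
  then have i: "integrable lborel ?G" by (subst (asm) integrable_norm_iff) auto
  have i': "integrable lborel (\<lambda>\<xi>. ?G (- \<xi>))"
    using lborel_integrable_affine[OF i, of "-1" 0] by simp
  have m: "?G \<in> borel_measurable borel" by measurable
  have "laplacian (\<lambda>x. f x + f (- x)) x = FT 1 (\<lambda>\<xi>. ?G \<xi> + ?G (- \<xi>)) x"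
    unfolding w.laplacian_f by (simp add: algebra_simps)
  also have "\<dots> = FT 1 ?G x + FT 1 (\<lambda>\<xi>. ?G (- \<xi>)) x" by (rule FT_add[OF i i'])
  also have "FT 1 (\<lambda>\<xi>. ?G (- \<xi>)) x = FT 1 ?G (- x)" by (rule FT_reflect[OF m])
  finally show "laplacian (\<lambda>x. f x + f (- x)) x = laplacian f x + laplacian f (- x)"
    unfolding f.laplacian_f .
qed

lemma laplacian_zero: "laplacian (\<lambda>x. 0) x = 0"
proof -
  have "partial b (\<lambda>x. 0) = (\<lambda>x. 0)" for b :: 'a
    unfolding partial_def by (auto intro: vector_derivative_at)
  then show ?thesis by (simp add: laplacian_def)
qed

text \<open>Continuity of the curve at time 0 keeps u within \<eta> of the datum on a short
  interval, and adding the bound for the datum gives a uniform \<open>A\<close>. The small \<eta>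
  later protects the slope at the origin, while \<open>A\<close> feeds all other estimates.\<close>

lemma solution_Hs_bound:
  fixes u :: "real \<Rightarrow> 'a::euclidean_space \<Rightarrow> complex"
  assumes sol: "is_solution \<theta> \<mu> \<alpha> s T u0 u" and T: "T > 0" and \<eta>: "\<eta> > 0" and s: "s > real DIM('a) / 2"
  shows "\<exists>t1 A. 0 < t1 \<and> t1 \<le> T \<and> 0 \<le> A \<and>
    (\<forall>t\<in>{0..t1}. (\<exists>g. Hs_rep s \<eta> (\<lambda>x. u t x - u0 x) g) \<and> (\<exists>g. Hs_rep s A (u t) g))"
proof -
  have sob: "sobolev s (u t)" and cont: "continuous_on UNIV (u t)" if "t \<in> {0..T}" for t
    using sol that by (auto simp: is_solution_def continuous_into_sobolev_def)
  have u0: "u 0 = u0" using sol by (simp add: is_solution_def)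
  have 0: "0 \<in> {0..T}" using T by simp
  have "((\<lambda>\<tau>. sobolev_norm s (\<lambda>x. u \<tau> x - u 0 x)) \<longlongrightarrow> 0) (at 0 within {0..T})"
    using sol 0 by (auto simp: is_solution_def continuous_into_sobolev_def)
  from order_tendstoD(2)[OF this \<eta>] obtain d where d: "d > 0"
    "\<And>\<tau>. \<tau> \<in> {0..T} \<Longrightarrow> \<tau> \<noteq> 0 \<Longrightarrow> dist \<tau> 0 < d \<Longrightarrow> sobolev_norm s (\<lambda>x. u \<tau> x - u 0 x) < \<eta>"
    unfolding eventually_at by blast
  obtain w0 where w0: "bessel_potential s (u 0) w0" using sob[OF 0] by (auto simp: sobolev_def)
  from bessel_potential_imp_Hs_rep[OF cont[OF 0] w0 s] obtain g0 where g0: "Hs_rep s (L2_norm w0) (u 0) g0" by blast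
  have rep: "\<exists>g. Hs_rep s (sobolev_norm s (\<lambda>x. u t x - u 0 x)) (\<lambda>x. u t x - u 0 x) g" if t: "t \<in> {0..T}" for t
  proof -
    obtain wt where "bessel_potential s (u t) wt" using sob[OF t] by (auto simp: sobolev_def)
    from bessel_potential_diff[OF this w0]
    have "bessel_potential s (\<lambda>x. u t x - u 0 x) (SOME w. bessel_potential s (\<lambda>x. u t x - u 0 x) w)"
      by (rule someI[of "bessel_potential s (\<lambda>x. u t x - u 0 x)"])
    from bessel_potential_imp_Hs_rep[OF _ this s] show ?thesis
      unfolding sobolev_norm_def using cont[OF t] cont[OF 0] by (auto intro: continuous_on_diff)
  qed
  define t1 where "t1 = min T (d / 2)"
  \<comment> \<open>The limit in the definition of continuity ignores the time 0 itself, so the zero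
    difference there receives its representation by hand.\<close>
  have zero: "Hs_rep s \<eta> (\<lambda>x. u 0 x - u 0 x) (\<lambda>\<xi>. 0)"
    using \<eta> by (auto simp: Hs_rep_def FT_def L2_def L2_norm_def)
  have small: "\<exists>g. Hs_rep s \<eta> (\<lambda>x. u t x - u 0 x) g" if t: "t \<in> {0..t1}" for t
  proof (cases "t = 0")
    case True
    then show ?thesis using zero by blast
  next
    case False
    have "t \<in> {0..T}" "dist t 0 < d" using t d(1) by (auto simp: t1_def)
    with rep[of t] d(2)[of t] False show ?thesis by (meson Hs_rep_mono less_imp_le)
  qed
  have "\<exists>g. Hs_rep s (\<eta> + L2_norm w0) (u t) g" if t: "t \<in> {0..t1}" for t
  proof -
    from small[OF t] obtain g where "Hs_rep s \<eta> (\<lambda>x. u t x - u 0 x) g" by blast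
    from Hs_rep_add[OF this g0 s] show ?thesis by auto
  qed
  then show ?thesis using small d(1) T \<eta> unfolding u0[symmetric]
    by (intro exI[of _ t1] exI[of _ "\<eta> + L2_norm w0"]) (auto simp: t1_def)
qed

lemma solution_odd:
  fixes u :: "real \<Rightarrow> 'a::euclidean_space \<Rightarrow> complex"
  assumes sol: "is_solution \<theta> \<mu> \<alpha> s T u0 u" and s3: "s > 3 + real DIM('a) / 2"
    and \<alpha>: "0 < \<alpha>" "\<alpha> < 1" and \<theta>: "0 \<le> cos \<theta>" and odd: "\<And>x. u0 (- x) = - u0 x"
    and t1: "t1 \<le> T" and rep: "\<And>t. t \<in> {0..t1} \<Longrightarrow> \<exists>g. Hs_rep s A (u t) g" and t: "t \<in> {0..t1}"
  shows "u t (- x) = - u t x"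
proof -
  \<comment> \<open>The representation is chosen time by time; \<open>energy_uniqueness\<close>
    works with one time slice at once and asks only for the common bound.\<close>
  define g where "g t = (SOME g. Hs_rep s A (u t) g)" for t
  have g: "Hs_rep s A (u t) (g t)" if "t \<in> {0..t1}" for t
    unfolding g_def using rep[OF that] by (rule someI_ex)
  have Hs: "Hs_function s A (u t) (g t)" if "t \<in> {0..t1}" for t
    using g[OF that] s3 by unfold_locales
  define K where "K = L2_norm (\<lambda>\<xi>::'a. of_real (wt (0 - s) \<xi>)) * A"
  have uK: "cmod (u t x) \<le> K" if "t \<in> {0..t1}" for t x
    using Hs_function.f_bound[OF Hs[OF that]] by (simp add: K_def)
  have uc: "continuous_on UNIV (u t)" if "t \<in> {0..t1}" for t
    by (rule Hs_function.f_continuous[OF Hs[OF that]])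
  have ode: "((\<lambda>\<tau>. u \<tau> x) has_vector_derivative (cis \<theta> * laplacian (u t) x + \<mu> * pnl \<alpha> (u t x))) (at t within {0..t1})"
    if "t \<in> {0..t1}" for t x
  proof -
    have "t \<in> {0..T}" using that t1 by simp
    then have "((\<lambda>\<tau>. u \<tau> x) has_vector_derivative (cis \<theta> * laplacian (u t) x + \<mu> * of_real (cmod (u t x) powr \<alpha>) * u t x)) (at t within {0..T})"
      using sol by (simp add: is_solution_def)
    then show ?thesis
      using has_vector_derivative_within_subset[of _ _ t "{0..T}" "{0..t1}"] t1 by (simp add: pnl_def mult.assoc)
  qed
  have "u t x + u t (- x) = 0"
  proof (rule energy_uniqueness[where w="\<lambda>t x. u t x + u t (- x)" and F="\<lambda>t x. \<mu> * (pnl \<alpha> (u t x) + pnl \<alpha> (u t (- x)))"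
        and L="cmod \<mu> * (2 * K powr \<alpha>)" and g="\<lambda>t \<xi>. g t \<xi> + g t (- \<xi>)" and A="A + A" and T=t1, OF s3 \<theta>])
    fix t x assume t: "t \<in> {0..t1}"
    show "Hs_rep s (A + A) (\<lambda>x. u t x + u t (- x)) (\<lambda>\<xi>. g t \<xi> + g t (- \<xi>))"
      by (rule laplacian_odd_part(2)[OF g[OF t] s3])
    show "((\<lambda>\<tau>. u \<tau> x + u \<tau> (- x)) has_vector_derivative cis \<theta> * laplacian (\<lambda>x. u t x + u t (- x)) x + \<mu> * (pnl \<alpha> (u t x) + pnl \<alpha> (u t (- x)))) (at t within {0..t1})"
      using has_vector_derivative_add[OF ode[OF t, of x] ode[OF t, of "- x"]]
      unfolding laplacian_odd_part(1)[OF g[OF t] s3] by (simp add: algebra_simps)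
    \<comment> \<open>As \<open>pnl\<close> is odd, the sum of the two nonlinear terms is a
      difference at \<open>u t x\<close> and \<open>- u t (- x)\<close>, whose distance is exactly
      the modulus of w.\<close>
    have "cmod (pnl \<alpha> (u t x) - pnl \<alpha> (- u t (- x))) \<le> 2 * K powr \<alpha> * cmod (u t x - (- u t (- x)))"
      by (rule pnl_diff[OF \<alpha>]) (use uK[OF t] in auto)
    then show "cmod (\<mu> * (pnl \<alpha> (u t x) + pnl \<alpha> (u t (- x)))) \<le> cmod \<mu> * (2 * K powr \<alpha>) * cmod (u t x + u t (- x))"
      by (simp add: pnl_minus norm_mult mult_left_mono mult.assoc)
    have "continuous_on UNIV (\<lambda>x. u t (- x))"
      by (rule continuous_on_compose2[OF uc[OF t]]) (auto intro!: continuous_intros)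
    then show "continuous_on UNIV (\<lambda>x. \<mu> * (pnl \<alpha> (u t x) + pnl \<alpha> (u t (- x))))"
      using uc[OF t] by (intro continuous_intros continuous_on_compose2[OF pnl_continuous[OF \<alpha>(1)]]) auto
  next
    show "u 0 x + u 0 (- x) = 0" for x using sol odd by (simp add: is_solution_def)
  qed (use t in auto)
  then show ?thesis by (simp add: eq_neg_iff_add_eq_0 add.commute)
qed

text \<open>Dividing by \<open>h powr (1 + \<alpha>)\<close> leaves a fixed positive number below a quantity tending to 0.\<close>

lemma no_scale_bound:
  fixes \<kappa> :: real
  assumes "0 < \<alpha>" "\<alpha> < 1" "\<alpha> < \<beta>" "0 < t1" "0 < \<kappa>"
    and le: "\<And>h. 0 < h \<Longrightarrow> h \<le> 1 / 2 \<Longrightarrow> t1 * (\<kappa> * h powr (1 + \<alpha>) - C3 * h powr (1 + \<beta>) - C4 * h powr (2 + \<alpha>)) \<le> C5 * h\<^sup>2"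
  shows False
proof -
  have "t1 * \<kappa> \<le> 0"
  proof (rule tendsto_lowerbound)
    have "((\<lambda>h. t1 * (C3 * h powr (\<beta> - \<alpha>) + C4 * h) + C5 * h powr (1 - \<alpha>)) \<longlongrightarrow> t1 * (C3 * 0 powr (\<beta> - \<alpha>) + C4 * 0) + C5 * 0 powr (1 - \<alpha>)) (at_right 0)"
      using assms by (intro tendsto_intros tendsto_powr') (auto simp: eventually_at_filter)
    then show "((\<lambda>h. t1 * (C3 * h powr (\<beta> - \<alpha>) + C4 * h) + C5 * h powr (1 - \<alpha>)) \<longlongrightarrow> 0) (at_right 0)" by simp
    have "t1 * \<kappa> \<le> t1 * (C3 * h powr (\<beta> - \<alpha>) + C4 * h) + C5 * h powr (1 - \<alpha>)" if h: "0 < h" "h < 1 / 2" for h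
    proof -
      let ?p = "h powr (1 + \<alpha>)"
      have e: "h powr (1 + \<beta>) = ?p * h powr (\<beta> - \<alpha>)" "h powr (2 + \<alpha>) = ?p * h" "h\<^sup>2 = ?p * h powr (1 - \<alpha>)"
        using h powr_add[of h "1 + \<alpha>" 1] by (simp_all flip: powr_add powr_numeral add: add.commute)
      have "?p * (t1 * \<kappa>) \<le> ?p * (t1 * (C3 * h powr (\<beta> - \<alpha>) + C4 * h) + C5 * h powr (1 - \<alpha>))"
        using le[of h] h unfolding e by (simp add: algebra_simps)
      then show ?thesis using h by simp
    qed
    then show "\<forall>\<^sub>F h in at_right 0. t1 * \<kappa> \<le> t1 * (C3 * h powr (\<beta> - \<alpha>) + C4 * h) + C5 * h powr (1 - \<alpha>)"
      using eventually_at_right_real[of 0 "1 / 2 :: real"] by (auto elim: eventually_mono)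
  qed simp
  then show False using assms by (simp add: mult_le_0_iff)
qed

lemma growth_from_derivative:
  fixes f f' :: "real \<Rightarrow> real"
  assumes T: "0 < T" and d: "\<And>t. t \<in> {0..T} \<Longrightarrow> (f has_real_derivative f' t) (at t within {0..T})"
    and D: "\<And>t. t \<in> {0..T} \<Longrightarrow> D \<le> f' t"
  shows "T * D \<le> f T - f 0"
proof -
  have "\<exists>x\<in>{0<..<T}. f T - f 0 = (\<lambda>h. f' x * h) (T - 0)"
    by (rule mvt_simple[OF T]) (use d in \<open>auto simp: has_field_derivative_def\<close>)
  then obtain x where "0 < x" "x < T" "f T - f 0 = f' x * T" by auto
  then show ?thesis using D[of x] T mult_left_mono[of D "f' x" T] by (simp add: mult.commute)
qed

lemma no_solution:
  fixes e :: "'a::euclidean_space"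
  assumes \<alpha>: "0 < \<alpha>" "\<alpha> < 1" and \<mu>: "\<mu> \<noteq> 0" and \<theta>: "0 \<le> cos \<theta>"
    and s: "s > 3 + real DIM('a) / 2 + \<alpha>" and e: "norm e = 1" and T: "T > 0"
    and sol: "is_solution \<theta> \<mu> \<alpha> s T (odd_bump e) u"
  shows False
proof -
  have s3: "s > 3 + real DIM('a) / 2" using s \<alpha> by simp
  \<comment> \<open>Midpoint between \<alpha> and the surplus \<open>s - 3 - DIM('a) / 2\<close>,
    hence strictly between them; the cap 1 keeps \<open>1 + \<beta>\<close> within the orders that a
    second difference can see.\<close>
  define \<beta> where "\<beta> = min 1 ((\<alpha> + (s - 3 - real DIM('a) / 2)) / 2)"
  have \<beta>: "\<alpha> < \<beta>" "\<beta> \<le> 1" "0 \<le> \<beta>" "s > 3 + \<beta> + real DIM('a) / 2"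
    using s \<alpha> by (auto simp: \<beta>_def min_def field_simps)
  define N where "N m = L2_norm (\<lambda>\<xi>::'a. of_real (wt (m - s) \<xi>))" for m
  have N0: "0 \<le> N m" for m by (simp add: N_def)
  \<comment> \<open>Half the slope guaranteed by \<open>odd_bump_lower_bound\<close>: the deviation
    from the datum may consume the other half.\<close>
  define c where "c = exp (- 2 :: real) / 2"
  have c: "0 < c" by (simp add: c_def)
  \<comment> \<open>\<open>N 1 * \<eta>\<close> bounds the first differences of the deviation per
    unit step and must stay below \<open>c\<close>; the added 1 keeps the denominator
    positive.\<close>
  define \<eta> where "\<eta> = c / (N 1 + 1)"
  have \<eta>: "0 < \<eta>" "N 1 * \<eta> \<le> c" using c N0[of 1] by (auto simp: \<eta>_def field_simps)
  from solution_Hs_bound[OF sol T \<eta>(1)] s3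
  obtain t1 A where t1: "0 < t1" "t1 \<le> T" and A: "0 \<le> A"
    and rep1: "\<And>t. t \<in> {0..t1} \<Longrightarrow> \<exists>g. Hs_rep s \<eta> (\<lambda>x. u t x - odd_bump e x) g"
    and rep2: "\<And>t. t \<in> {0..t1} \<Longrightarrow> \<exists>g. Hs_rep s A (u t) g" by auto
  have odd: "u t (- x) = - u t x" if "t \<in> {0..t1}" for t x
    by (rule solution_odd[OF sol s3 \<alpha> \<theta> odd_bump_minus t1(2) rep2 that])
  have u00: "u t 0 = 0" if "t \<in> {0..t1}" for t using odd[OF that, of 0] by simp
  have lap0: "laplacian (u t) 0 = 0" if t: "t \<in> {0..t1}" for t
  proof -
    obtain g where "Hs_rep s A (u t) g" using rep2[OF t] by blast
    from laplacian_odd_part(1)[OF this s3, of 0] have "2 * laplacian (u t) 0 = 0"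
      by (simp add: odd[OF t] laplacian_zero)
    then show ?thesis by simp
  qed
  have ode: "((\<lambda>\<tau>. u \<tau> x) has_vector_derivative (cis \<theta> * laplacian (u t) x + \<mu> * pnl \<alpha> (u t x))) (at t within {0..t1})"
    if "t \<in> {0..t1}" for t x
  proof -
    have "t \<in> {0..T}" using that t1 by simp
    then have "((\<lambda>\<tau>. u \<tau> x) has_vector_derivative (cis \<theta> * laplacian (u t) x + \<mu> * of_real (cmod (u t x) powr \<alpha>) * u t x)) (at t within {0..T})"
      using sol by (simp add: is_solution_def)
    then show ?thesis
      using has_vector_derivative_within_subset[of _ _ t "{0..T}" "{0..t1}"] t1 by (simp add: pnl_def mult.assoc)
  qed
  define \<kappa> where "\<kappa> = (2 powr (1 + \<alpha>) - 2) * c powr (1 + \<alpha>)"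
  have "2 powr 1 < (2::real) powr (1 + \<alpha>)" using \<alpha> by (intro powr_less_mono) auto
  then have two: "0 < 2 powr (1 + \<alpha>) - (2::real)" by simp
  then have \<kappa>: "0 < \<kappa>" using c by (simp add: \<kappa>_def)
  \<comment> \<open>\<open>C3\<close> measures the Laplacian term, \<open>C4\<close> the error of
    replacing \<open>y\<close> by \<open>2 * z\<close> in the nonlinearity, and \<open>C5\<close>
    the size of \<open>U\<close> at the two end times.\<close>
  define C3 where "C3 = 4 * (N (3 + \<beta>) * A) / cmod \<mu>"
  define C4 where "C4 = 2 * (2 * (N 1 * A)) powr \<alpha> * (4 * (N 2 * A))"
  define C5 where "C5 = 2 * (4 * (N 2 * A)) / cmod \<mu>"
  have "t1 * (\<kappa> * h powr (1 + \<alpha>) - C3 * h powr (1 + \<beta>) - C4 * h powr (2 + \<alpha>)) \<le> C5 * h\<^sup>2"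
    if h: "0 < h" "h \<le> 1 / 2" for h
  proof -
    let ?D = "\<kappa> * h powr (1 + \<alpha>) - C3 * h powr (1 + \<beta>) - C4 * h powr (2 + \<alpha>)"
    define z where "z t = u t (h *\<^sub>R e)" for t
    define y where "y t = u t (2 *\<^sub>R (h *\<^sub>R e))" for t
    define lz where "lz t = laplacian (u t) (h *\<^sub>R e)" for t
    define ly where "ly t = laplacian (u t) (2 *\<^sub>R (h *\<^sub>R e))" for t
    have nh: "norm (h *\<^sub>R e) = h" "norm (2 *\<^sub>R (h *\<^sub>R e)) = 2 * h" using h e by auto
    have yz: "cmod (y t - 2 * z t) \<le> 4 * (N 2 * A) * h\<^sup>2"
      and lyz: "cmod (ly t - 2 * lz t) \<le> 4 * (N (3 + \<beta>) * A) * h powr (1 + \<beta>)"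
      and zb: "cmod (z t) \<le> h * (N 1 * A)" and yb: "cmod (y t) \<le> 2 * h * (N 1 * A)"
      and zl: "c * h \<le> Re (z t)"
      if t: "t \<in> {0..t1}" for t
    proof -
      obtain g where g: "Hs_rep s A (u t) g" using rep2[OF t] by blast
      interpret Hs_function s A "u t" g using g s3 by unfold_locales
      \<comment> \<open>The value at the origin vanishes, so this is a full second difference based
        at 0; the Laplacian bound below uses \<open>lap0\<close> in the same way.\<close>
      show "cmod (y t - 2 * z t) \<le> 4 * (N 2 * A) * h\<^sup>2"
        using f_second_difference[of 0 "h *\<^sub>R e"] unfolding nh add_0_left u00[OF t]
        by (simp add: y_def z_def N_def mult_ac)
      show "cmod (ly t - 2 * lz t) \<le> 4 * (N (3 + \<beta>) * A) * h powr (1 + \<beta>)"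
        using laplacian_second_difference[OF \<beta>(3,2,4), of 0 "h *\<^sub>R e"] unfolding nh add_0_left lap0[OF t]
        by (simp add: ly_def lz_def N_def mult_ac)
      show "cmod (z t) \<le> h * (N 1 * A)" "cmod (y t) \<le> 2 * h * (N 1 * A)"
        using f_first_difference[of 0 "h *\<^sub>R e"] f_first_difference[of 0 "2 *\<^sub>R (h *\<^sub>R e)"]
        unfolding nh add_0_left u00[OF t] by (simp_all add: y_def z_def N_def)
      obtain g' where g': "Hs_rep s \<eta> (\<lambda>x. u t x - odd_bump e x) g'" using rep1[OF t] by blast
      interpret v: Hs_function s \<eta> "\<lambda>x. u t x - odd_bump e x" g' using g' s3 by unfold_locales
      \<comment> \<open>Both u and the datum vanish at 0, so the deviation at
        \<open>h *\<^sub>R e\<close> is a first difference and carries a factor h. A mere sup bound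
        would not preserve the slope.\<close>
      have "cmod (z t - odd_bump e (h *\<^sub>R e)) \<le> h * (N 1 * \<eta>)"
        using v.f_first_difference[of 0 "h *\<^sub>R e"] unfolding nh add_0_left u00[OF t]
        by (simp add: z_def N_def odd_bump_def)
      also have "\<dots> \<le> h * c" using h \<eta> by (intro mult_left_mono) auto
      finally have "\<bar>Re (z t - odd_bump e (h *\<^sub>R e))\<bar> \<le> h * c"
        using abs_Re_le_cmod order_trans by blast
      then have "Re (odd_bump e (h *\<^sub>R e)) - h * c \<le> Re (z t)" by simp
      moreover have "2 * c * h \<le> Re (odd_bump e (h *\<^sub>R e))"
        using odd_bump_lower_bound[OF e h] by (simp add: c_def)
      ultimately show "c * h \<le> Re (z t)" by (simp add: algebra_simps)
    qed
    \<comment> \<open>Division by \<mu> leaves the nonlinearity with coefficient 1, so the lower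
      bound for \<open>Re (pnl \<alpha> (z t))\<close> applies for every complex \<mu>.\<close>
    define U where "U t = Re ((y t - 2 * z t) / \<mu>)" for t
    define U' where "U' t = Re ((cis \<theta> * (ly t - 2 * lz t)) / \<mu> + (pnl \<alpha> (y t) - 2 * pnl \<alpha> (z t)))" for t
    have U: "(U has_real_derivative U' t) (at t within {0..t1})" if t: "t \<in> {0..t1}" for t
    proof -
      have "((\<lambda>t. y t - 2 * z t) has_vector_derivative
         (cis \<theta> * ly t + \<mu> * pnl \<alpha> (y t)) - 2 * (cis \<theta> * lz t + \<mu> * pnl \<alpha> (z t))) (at t within {0..t1})"
        unfolding y_def z_def ly_def lz_def
        by (intro has_vector_derivative_diff has_vector_derivative_mult_right ode t)
      from has_vector_derivative_mult_right[OF this, of "inverse \<mu>"]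
      have "((\<lambda>t. Re (inverse \<mu> * (y t - 2 * z t))) has_vector_derivative
         Re (inverse \<mu> * ((cis \<theta> * ly t + \<mu> * pnl \<alpha> (y t)) - 2 * (cis \<theta> * lz t + \<mu> * pnl \<alpha> (z t))))) (at t within {0..t1})"
        by (rule bounded_linear.has_vector_derivative[OF bounded_linear_Re])
      moreover have "inverse \<mu> * ((cis \<theta> * ly t + \<mu> * pnl \<alpha> (y t)) - 2 * (cis \<theta> * lz t + \<mu> * pnl \<alpha> (z t)))
         = (cis \<theta> * (ly t - 2 * lz t)) / \<mu> + (pnl \<alpha> (y t) - 2 * pnl \<alpha> (z t))"
        using \<mu> by (simp add: field_simps)
      moreover have "inverse \<mu> * (y t - 2 * z t) = (y t - 2 * z t) / \<mu>" for t by (simp add: divide_inverse mult.commute)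
      ultimately show ?thesis
        by (simp only: U_def[abs_def] U'_def has_real_derivative_iff_has_vector_derivative)
    qed
    have D: "?D \<le> U' t" if t: "t \<in> {0..t1}" for t
    proof -
      have "cmod ((cis \<theta> * (ly t - 2 * lz t)) / \<mu>) \<le> C3 * h powr (1 + \<beta>)"
        using divide_right_mono[OF lyz[OF t], of "cmod \<mu>"] by (simp add: C3_def norm_mult norm_divide)
      then have 1: "- (C3 * h powr (1 + \<beta>)) \<le> Re ((cis \<theta> * (ly t - 2 * lz t)) / \<mu>)"
        using abs_Re_le_cmod[of "(cis \<theta> * (ly t - 2 * lz t)) / \<mu>"] by linarith
      \<comment> \<open>Both arguments are of size h and differ by order \<open>h\<^sup>2\<close>,
        so the error has order \<open>2 + \<alpha>\<close>. After the replacement, homogeneity gives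
        the exact coefficient \<open>2 powr (1 + \<alpha>) - 2\<close>.\<close>
      have "cmod (pnl \<alpha> (y t) - pnl \<alpha> (2 * z t)) \<le> 2 * (2 * h * (N 1 * A)) powr \<alpha> * cmod (y t - 2 * z t)"
        by (rule pnl_diff[OF \<alpha> yb[OF t]]) (use zb[OF t] in \<open>simp add: norm_mult\<close>)
      also have "\<dots> \<le> 2 * (2 * h * (N 1 * A)) powr \<alpha> * (4 * (N 2 * A) * h\<^sup>2)"
        by (intro mult_left_mono yz[OF t]) auto
      also have "(2 * h * (N 1 * A)) powr \<alpha> = (2 * (N 1 * A)) powr \<alpha> * h powr \<alpha>"
        by (subst powr_mult[symmetric]) (simp_all add: mult_ac)
      also have "2 * ((2 * (N 1 * A)) powr \<alpha> * h powr \<alpha>) * (4 * (N 2 * A) * h\<^sup>2) = C4 * (h powr \<alpha> * h\<^sup>2)"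
        by (simp add: C4_def)
      also have "h powr \<alpha> * h\<^sup>2 = h powr (2 + \<alpha>)"
        using h by (simp add: powr_add)
      finally have 2: "- (C4 * h powr (2 + \<alpha>)) \<le> Re (pnl \<alpha> (y t) - pnl \<alpha> (2 * z t))"
        using abs_Re_le_cmod[of "pnl \<alpha> (y t) - pnl \<alpha> (2 * z t)"] by linarith
      have "(c * h) powr (1 + \<alpha>) \<le> Re (pnl \<alpha> (z t))"
        by (rule Re_pnl_lower_bound[OF \<alpha>(1) _ zl[OF t]]) (use c h in simp)
      then have "(2 powr (1 + \<alpha>) - 2) * (c * h) powr (1 + \<alpha>) \<le> (2 powr (1 + \<alpha>) - 2) * Re (pnl \<alpha> (z t))"
        using two by (intro mult_left_mono) auto
      moreover have "(c * h) powr (1 + \<alpha>) = c powr (1 + \<alpha>) * h powr (1 + \<alpha>)" by (rule powr_mult)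
      ultimately have 3: "\<kappa> * h powr (1 + \<alpha>) \<le> (2 powr (1 + \<alpha>) - 2) * Re (pnl \<alpha> (z t))"
        by (simp add: \<kappa>_def mult.assoc)
      have "U' t = Re ((cis \<theta> * (ly t - 2 * lz t)) / \<mu>) + Re (pnl \<alpha> (y t) - pnl \<alpha> (2 * z t)) + (2 powr (1 + \<alpha>) - 2) * Re (pnl \<alpha> (z t))"
        unfolding U'_def pnl_double by (simp add: algebra_simps)
      with 1 2 3 show ?thesis by linarith
    qed
    have Ub: "\<bar>U t\<bar> \<le> 4 * (N 2 * A) / cmod \<mu> * h\<^sup>2" if t: "t \<in> {0..t1}" for t
    proof -
      have "\<bar>U t\<bar> \<le> cmod (y t - 2 * z t) / cmod \<mu>"
        unfolding U_def using abs_Re_le_cmod[of "(y t - 2 * z t) / \<mu>"] by (simp add: norm_divide)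
      also have "\<dots> \<le> 4 * (N 2 * A) * h\<^sup>2 / cmod \<mu>" by (intro divide_right_mono yz[OF t]) auto
      finally show ?thesis by simp
    qed
    have "t1 * ?D \<le> U t1 - U 0" by (rule growth_from_derivative[OF t1(1) U D])
    also have "\<dots> \<le> 2 * (4 * (N 2 * A) / cmod \<mu> * h\<^sup>2)"
    proof -
      have "\<bar>U t1\<bar> \<le> 4 * (N 2 * A) / cmod \<mu> * h\<^sup>2" "\<bar>U 0\<bar> \<le> 4 * (N 2 * A) / cmod \<mu> * h\<^sup>2"
        using Ub t1(1) by auto
      then show ?thesis by linarith
    qed
    also have "\<dots> = C5 * h\<^sup>2" by (simp add: C5_def)
    finally show ?thesis .
  qed
  from no_scale_bound[OF \<alpha> \<beta>(1) t1(1) \<kappa> this] show False .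
qed

theorem theorem3p2:
  fixes \<alpha> \<theta> s :: real and \<mu> :: complex
  assumes "0 < \<alpha>" and "\<alpha> < 1"
    and "\<mu> \<noteq> 0"
    and "- (pi / 2) \<le> \<theta>" and "\<theta> \<le> pi / 2"
    and "s > 3 + real CARD('n) / 2 + \<alpha>"
  shows "\<exists>u0 :: real ^ 'n::finite \<Rightarrow> complex.
           smooth_compact_support u0 \<and>
           \<not> (\<exists>T>0. \<exists>u. is_solution \<theta> \<mu> \<alpha> s T u0 u)"
proof -
  obtain e :: "real ^ 'n" where "e \<in> Basis" using nonempty_Basis by blast
  then have e: "norm e = 1" by simp
  have "0 \<le> cos \<theta>" using assms by (intro cos_ge_zero) auto
  then have "\<not> (\<exists>T>0. \<exists>u. is_solution \<theta> \<mu> \<alpha> s T (odd_bump e) u)"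
    using no_solution[OF assms(1-3) _ _ e] assms(6) by auto
  then show ?thesis using odd_bump_smooth by blast
qed

end
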